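(* Suppose that $1\le p<q<2$ and let $X$ be a Banach space. If $X$ has the $\mathcal K_{up}$-approximation property, then $X$ has the $\mathcal K_{uq}$-approximation property.
   Context: All Banach spaces are over the same, either real or complex, scalar field. $B_X$ denotes the closed unit ball of $X$, and $p'$ the dual exponent of $p$ ($1/p+1/p'=1$). $\mathcal L(X,Y)$ denotes the bounded linear operators and $\mathcal F(X,Y)$ the bounded finite-rank operators $X\to Y$. For $1\le p<\infty$, $\ell^p_w(X)$ is the space of weakly $p$-summable sequences $(x_k)$ in $X$, with norm $\|(x_k)\|_{p,w}=\sup_{x^*\in B_{X^*}}\big(\sum_{k}|x^*(x_k)|^p\big)^{1/p}$. A sequence $(x_k)\in\ell^p_w(X)$ is unconditionally $p$-summable, written $(x_k)\in\ell^p_u(X)$, if $\lim_{k\to\infty}\|(0,\ldots,0,x_k,x_{k+1},\ldots)\|_{p,w}=0$. The $p$-convex hull of $(x_k)\in\ell^p_w(X)$ is $p\text{-co}\{x_k\}=\{\sum_{k=1}^\infty\lambda_kx_k\mid(\lambda_k)\in B_{\ell^{p'}}\}$, where $B_{\ell^{p'}}$ is replaced by $B_{c_0}$ if $p=1$. An operator $T\in\mathcal L(X,Y)$ is unconditionally $p$-compact, $T\in\mathcal K_{up}(X,Y)$, if $T(B_X)\subset p\text{-co}\{y_k\}$ for some $(y_k)\in\ell^p_u(Y)$. Its norm is $\|T\|_{\mathcal K_{up}}=\inf\|(y_k)\|_{p,w}$, the infimum being over all such $(y_k)\in\ell^p_u(Y)$. With this norm $\mathcal K_{up}$ is a Banach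 operator ideal. A Banach space $X$ has the $\mathcal K_{up}$-approximation property if for every Banach space $Y$ the space $\mathcal F(Y,X)$ is dense in $\mathcal K_{up}(Y,X)$ with respect to $\|\cdot\|_{\mathcal K_{up}}$. *)

theory Defs
  imports "HOL-Analysis.Analysis" "HOL-Algebra.Module"
begin

text \<open>
  Banach spaces are carrier-based, so that one can quantify over all of them inside a formula and
  treat both scalar fields uniformly.  A space over the field \<open>'k\<close> (which will be \<^typ>\<open>real\<close> or
  \<^typ>\<open>complex\<close>) is a HOL-Algebra module over \<open>'k\<close> together with a norm.  The fields \<open>mult\<close> and \<open>one\<close>,
  inherited from the module record, are meaningful only for \<open>scalar_space\<close>, which serves both as
  the scalar ring and as the codomain of functionals.
\<close>

record ('k, 'a) nspace = "('k, 'a) module" +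
  nrm :: "'a \<Rightarrow> real"

definition scalar_space :: "('k::real_normed_field, 'k) nspace" where
  "scalar_space = \<lparr>carrier = UNIV, mult = (*), one = 1, zero = 0, add = (+), smult = (*), nrm = norm\<rparr>"

locale nvs = Module.module "scalar_space :: ('k, 'k) nspace" X
  for X :: "('k::real_normed_field, 'a) nspace" (structure) +
  assumes nrm_nonneg: "x \<in> carrier X \<Longrightarrow> 0 \<le> nrm X x"
    and nrm_eq_0_iff: "x \<in> carrier X \<Longrightarrow> nrm X x = 0 \<longleftrightarrow> x = \<zero>"
    and nrm_smult: "x \<in> carrier X \<Longrightarrow> nrm X (a \<odot> x) = norm a * nrm X x"
    and nrm_triangle:
      "\<lbrakk>x \<in> carrier X; y \<in> carrier X\<rbrakk> \<Longrightarrow> nrm X (x \<oplus> y) \<le> nrm X x + nrm X y"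

text \<open>The locale \<open>Metric_space\<close> requires a function that is symmetric and nonnegative
  also outside the carrier.\<close>

definition ndist :: "('k, 'a) nspace \<Rightarrow> 'a \<Rightarrow> 'a \<Rightarrow> real" where
  "ndist X x y = (if x \<in> carrier X \<and> y \<in> carrier X then nrm X (x \<ominus>\<^bsub>X\<^esub> y) else 0)"

definition banach_space :: "('k::real_normed_field, 'a) nspace \<Rightarrow> bool" where
  "banach_space X \<longleftrightarrow> nvs X \<and> Metric_space.mcomplete (carrier X) (ndist X)"

definition unit_ball :: "('k, 'a) nspace \<Rightarrow> 'a set" where
  "unit_ball X = {x \<in> carrier X. nrm X x \<le> 1}"

text \<open>Operators are HOL functions whose values outside the carrier of the domain are irrelevant.\<close>

definition bounded_ops :: "('k, 'a) nspace \<Rightarrow> ('k, 'b) nspace \<Rightarrow> ('a \<Rightarrow> 'b) set" where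
  "bounded_ops X Y =
     {T \<in> carrier X \<rightarrow> carrier Y.
        (\<forall>x\<in>carrier X. \<forall>y\<in>carrier X. T (x \<oplus>\<^bsub>X\<^esub> y) = T x \<oplus>\<^bsub>Y\<^esub> T y) \<and>
        (\<forall>a. \<forall>x\<in>carrier X. T (a \<odot>\<^bsub>X\<^esub> x) = a \<odot>\<^bsub>Y\<^esub> T x) \<and>
        (\<exists>C. \<forall>x\<in>carrier X. nrm Y (T x) \<le> C * nrm X x)}"

definition finite_rank_ops :: "('k, 'a) nspace \<Rightarrow> ('k, 'b) nspace \<Rightarrow> ('a \<Rightarrow> 'b) set" where
  "finite_rank_ops X Y =
     {T \<in> bounded_ops X Y. \<exists>S. finite S \<and> S \<subseteq> carrier Y \<and>
        (\<forall>x\<in>carrier X. \<exists>c. T x = finsum Y (\<lambda>s. c s \<odot>\<^bsub>Y\<^esub> s) S)}"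

definition dual_ball :: "('k::real_normed_field, 'a) nspace \<Rightarrow> ('a \<Rightarrow> 'k) set" where
  "dual_ball X = {f \<in> bounded_ops X scalar_space. \<forall>x\<in>unit_ball X. norm (f x) \<le> 1}"

definition lp_weak :: "real \<Rightarrow> ('k::real_normed_field, 'a) nspace \<Rightarrow> (nat \<Rightarrow> 'a) set" where
  "lp_weak p X = {x. range x \<subseteq> carrier X \<and>
     (\<forall>f\<in>bounded_ops X scalar_space. summable (\<lambda>k. norm (f (x k)) powr p))}"

text \<open>The norms below take values in \<^typ>\<open>ennreal\<close>, so that suprema of unbounded sets and infima
  of empty sets are infinite instead of unspecified.  The sums are only used where they converge,
  that is, for \<open>x \<in> lp_weak p X\<close>.\<close>

definition wnorm :: "real \<Rightarrow> ('k::real_normed_field, 'a) nspace \<Rightarrow> (nat \<Rightarrow> 'a) \<Rightarrow> ennreal" where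
  "wnorm p X x = (SUP f\<in>dual_ball X. ennreal ((\<Sum>k. norm (f (x k)) powr p) powr (1 / p)))"

definition lp_uncond :: "real \<Rightarrow> ('k::real_normed_field, 'a) nspace \<Rightarrow> (nat \<Rightarrow> 'a) set" where
  "lp_uncond p X = {x \<in> lp_weak p X.
     ((\<lambda>n. wnorm p X (\<lambda>k. if k < n then \<zero>\<^bsub>X\<^esub> else x k)) \<longlongrightarrow> 0) sequentially}"

definition conj_seq_ball :: "real \<Rightarrow> (nat \<Rightarrow> 'k::real_normed_field) set" where
  "conj_seq_ball p =
     (if p = 1 then {c. c \<longlonglongrightarrow> 0 \<and> (\<forall>k. norm (c k) \<le> 1)}
      else {c. summable (\<lambda>k. norm (c k) powr (p / (p - 1))) \<and>
               (\<Sum>k. norm (c k) powr (p / (p - 1))) \<le> 1})"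

definition p_co :: "real \<Rightarrow> ('k::real_normed_field, 'a) nspace \<Rightarrow> (nat \<Rightarrow> 'a) \<Rightarrow> 'a set" where
  "p_co p X x = {z \<in> carrier X. \<exists>c\<in>conj_seq_ball p.
     (\<lambda>n. nrm X (finsum X (\<lambda>k. c k \<odot>\<^bsub>X\<^esub> x k) {..<n} \<ominus>\<^bsub>X\<^esub> z)) \<longlonglongrightarrow> 0}"

definition Kup_ops ::
  "real \<Rightarrow> ('k::real_normed_field, 'a) nspace \<Rightarrow> ('k, 'b) nspace \<Rightarrow> ('a \<Rightarrow> 'b) set" where
  "Kup_ops p X Y =
     {T \<in> bounded_ops X Y. \<exists>y\<in>lp_uncond p Y. T ` unit_ball X \<subseteq> p_co p Y y}"

definition Kup_norm ::
  "real \<Rightarrow> ('k::real_normed_field, 'a) nspace \<Rightarrow> ('k, 'b) nspace \<Rightarrow> ('a \<Rightarrow> 'b) \<Rightarrow> ennreal" where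
  "Kup_norm p X Y T =
     (INF y\<in>{y \<in> lp_uncond p Y. T ` unit_ball X \<subseteq> p_co p Y y}. wnorm p Y y)"

text \<open>HOL cannot quantify over types inside a formula.  Hence the type argument \<open>'b\<close>: the test
  spaces \<open>Y\<close> are all Banach spaces whose elements lie in the universe \<open>'b\<close>, with
  arbitrary carrier, operations and norm.\<close>

definition Kup_AP :: "'b itself \<Rightarrow> real \<Rightarrow> ('k::real_normed_field, 'a) nspace \<Rightarrow> bool" where
  "Kup_AP U p X \<longleftrightarrow>
     (\<forall>Y :: ('k, 'b) nspace. banach_space Y \<longrightarrow>
        (\<forall>T\<in>Kup_ops p Y X. \<forall>\<epsilon>>0. \<exists>F\<in>finite_rank_ops Y X.
           Kup_norm p Y X (\<lambda>y. T y \<ominus>\<^bsub>X\<^esub> F y) < \<epsilon>))"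

end

theory Submission
  imports Defs "HOL-Complex_Analysis.Great_Picard"
begin

text \<open>
  Write \<open>r'\<close> for the exponent dual to \<open>r\<close>. A sequence \<open>x\<close> in \<open>lp_uncond q X\<close> is the same thing as a
  compact operator \<open>S : \<ell>\<^sup>q\<^sup>' \<rightarrow> X\<close> (defined on \<open>c\<^sub>0\<close> if \<open>q = 1\<close>), and \<open>p_co q X x\<close> is the image of the
  unit ball under \<open>S\<close>. The proof compares such images for the two exponents and then factors an
  operator through one of them.

  For \<open>1 \<le> p < q < 2\<close> the space \<open>\<ell>\<^sup>q\<close> embeds isomorphically into \<open>L\<^sup>p\<close>: independent symmetric
  variables with tails of order \<open>t\<^sup>-\<^sup>q\<close> span a copy of it. Dually, \<open>\<ell>\<^sup>q\<^sup>'\<close> is a quotient of \<open>L\<^sup>p\<^sup>'\<close>. On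
  finitely many coordinates this is done with finitely many elementary events and with
  constants that do not depend on the number of coordinates (\<open>finite_heavy_tailed_systems\<close>).
  Cutting \<open>x\<close> into blocks whose weak norms decrease geometrically, and replacing each block by
  such a system, gives \<open>y\<close> in \<open>lp_uncond p X\<close> with \<open>p_co q X x \<subseteq> p_co p X y\<close>
  (\<open>p_co_subset_smaller_exponent\<close>).

  Now let \<open>T\<close> map the unit ball of \<open>Y\<close> into \<open>p_co q X x\<close>. One can multiply \<open>x k\<close> by scalars \<open>1 / \<beta> k\<close>
  that tend to infinity and still stay in \<open>lp_uncond q X\<close> (\<open>lp_uncond_rescale\<close>); let \<open>D\<close> be the hull
  of the rescaled sequence. Since \<open>q > 1\<close>, \<open>D\<close> is a closed bounded absolutely convex set, so the
  span of \<open>D\<close> with the gauge of \<open>D\<close> as norm is a Banach space \<open>Z\<close>. Its elements are elements of \<open>X\<close>,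
  so it is a legitimate test space in the universe of \<open>X\<close> whatever the universe of \<open>Y\<close> is. The
  operator \<open>T\<close> factors through \<open>Z\<close>, and by the inclusion of hulls the inclusion map of \<open>Z\<close> into \<open>X\<close> is
  unconditionally \<open>p\<close>-compact.

  The hypothesis yields a finite rank \<open>F : Z \<rightarrow> X\<close> such that \<open>z - F z\<close> lies in the \<open>p\<close>-hull of a
  sequence of small weak norm for all \<open>z\<close> in \<open>D\<close>. Hence \<open>f (z - F z)\<close> is small for all \<open>z\<close> in \<open>D\<close> and
  all functionals \<open>f\<close> in the dual ball, and by the duality between \<open>\<ell>\<^sup>q\<close> and \<open>\<ell>\<^sup>q\<^sup>'\<close> the sequence
  \<open>w k = x k - F (x k)\<close> has small weak \<open>q\<close>-norm; the factors \<open>\<beta> k\<close> make the tails of \<open>w\<close> tend to \<open>0\<close>.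
  Because \<open>T u - F (T u)\<close> lies in \<open>p_co q X w\<close> for \<open>u\<close> in the unit ball of \<open>Y\<close>, the operator \<open>F \<circ> T\<close> is
  the desired approximation of \<open>T\<close> (\<open>Kup_AP_larger_exponent\<close>).

  Most identities and norm estimates in \<open>X\<close> are checked by applying all functionals, which
  turns them into statements about scalars. This needs norming functionals; the Hahn-Banach
  theorem that provides them is the only place where the real and the complex field are
  treated separately.
\<close>

section \<open>Normed spaces and their functionals\<close>

lemma scalar_space_simps [simp]:
  "carrier scalar_space = UNIV" "add scalar_space x y = x + y" "mult scalar_space x y = x * y"
  "monoid.one scalar_space = 1" "ring.zero scalar_space = 0" "smult scalar_space x y = x * y"
  "nrm scalar_space x = norm x"
  by (simp_all add: scalar_space_def)

context nvs begin

lemma sm_closed [simp, intro]: "x \<in> carrier X \<Longrightarrow> a \<odot> x \<in> carrier X"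
  using smult_closed[of a x] by simp

lemma sm_add_left: "x \<in> carrier X \<Longrightarrow> (a + b) \<odot> x = a \<odot> x \<oplus> b \<odot> x"
  using smult_l_distr[of a b x] by simp

lemma sm_add_right: "\<lbrakk>x \<in> carrier X; y \<in> carrier X\<rbrakk> \<Longrightarrow> a \<odot> (x \<oplus> y) = a \<odot> x \<oplus> a \<odot> y"
  using smult_r_distr[of a x y] by simp

lemma sm_mult: "x \<in> carrier X \<Longrightarrow> a \<odot> (b \<odot> x) = (a * b) \<odot> x"
  using smult_assoc1[of a b x] by simp

lemma sm_one [simp]: "x \<in> carrier X \<Longrightarrow> 1 \<odot> x = x"
  using smult_one[of x] by simp

lemma sm_zero_left [simp]: "x \<in> carrier X \<Longrightarrow> 0 \<odot> x = \<zero>"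
  using smult_l_null[of x] by simp

lemma sm_zero_right [simp]: "a \<odot> \<zero> = \<zero>"
  using smult_r_null[of a] by simp

lemma uminus_eq_sm: "x \<in> carrier X \<Longrightarrow> \<ominus> x = (- 1) \<odot> x"
proof -
  assume x: "x \<in> carrier X"
  have "(- 1) \<odot> x \<oplus> x = (- 1 + 1) \<odot> x"
    using x sm_add_left[of x "-1" 1] by simp
  also have "\<dots> = \<zero>" using x by simp
  finally show ?thesis using x by (metis M.minus_equality sm_closed)
qed

lemma minus_eq_sm: "\<lbrakk>x \<in> carrier X; y \<in> carrier X\<rbrakk> \<Longrightarrow> x \<ominus> y = x \<oplus> (- 1) \<odot> y"
  by (simp add: a_minus_def uminus_eq_sm)

lemma nrm_zero [simp]: "nrm X \<zero> = 0"
  using nrm_eq_0_iff[of \<zero>] by simp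

lemma nrm_uminus: "x \<in> carrier X \<Longrightarrow> nrm X (\<ominus> x) = nrm X x"
  by (simp add: uminus_eq_sm nrm_smult)

lemma nrm_minus_commute: "\<lbrakk>x \<in> carrier X; y \<in> carrier X\<rbrakk> \<Longrightarrow> nrm X (x \<ominus> y) = nrm X (y \<ominus> x)"
  using nrm_uminus[of "x \<ominus> y"] by (simp add: a_minus_def M.minus_add M.a_comm)

lemma minus_add_minus:
  "\<lbrakk>x \<in> carrier X; y \<in> carrier X; z \<in> carrier X\<rbrakk> \<Longrightarrow> (x \<ominus> y) \<oplus> (y \<ominus> z) = x \<ominus> z"
  by (simp add: a_minus_def M.a_assoc M.r_neg2 M.r_neg1)

lemma nrm_minus_triangle:
  "\<lbrakk>x \<in> carrier X; y \<in> carrier X; z \<in> carrier X\<rbrakk> \<Longrightarrow> nrm X (x \<ominus> z) \<le> nrm X (x \<ominus> y) + nrm X (y \<ominus> z)"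
  using nrm_triangle[of "x \<ominus> y" "y \<ominus> z"] by (simp add: minus_add_minus)

lemma minus_eq_zero_iff: "\<lbrakk>x \<in> carrier X; y \<in> carrier X\<rbrakk> \<Longrightarrow> x \<ominus> y = \<zero> \<longleftrightarrow> x = y"
proof
  assume x: "x \<in> carrier X" and y: "y \<in> carrier X" and "x \<ominus> y = \<zero>"
  have "x = (x \<ominus> y) \<oplus> y" using x y by (simp add: a_minus_def M.a_assoc M.l_neg)
  then show "x = y" using y \<open>x \<ominus> y = \<zero>\<close> by simp
qed (simp add: a_minus_def M.r_neg)

lemma Metric_space_ndist: "Metric_space (carrier X) (ndist X)"
proof
  show "0 \<le> ndist X x y" for x y by (simp add: ndist_def nrm_nonneg)
  show "ndist X x y = ndist X y x" for x y by (simp add: ndist_def nrm_minus_commute)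
  show "ndist X x y = 0 \<longleftrightarrow> x = y" if "x \<in> carrier X" "y \<in> carrier X" for x y
    using that by (simp add: ndist_def nrm_eq_0_iff minus_eq_zero_iff)
  show "ndist X x z \<le> ndist X x y + ndist X y z"
    if "x \<in> carrier X" "y \<in> carrier X" "z \<in> carrier X" for x y z
    using that by (simp add: ndist_def nrm_minus_triangle)
qed

text \<open>
  Completeness in terms of the norm alone, the form in which it is used and verified below.
\<close>

lemma banach_space_iff:
  "banach_space X \<longleftrightarrow> (\<forall>u. range u \<subseteq> carrier X \<longrightarrow>
      (\<forall>e>0. \<exists>N. \<forall>m\<ge>N. \<forall>n\<ge>N. nrm X (u m \<ominus> u n) < e) \<longrightarrow>
      (\<exists>z\<in>carrier X. (\<lambda>n. nrm X (u n \<ominus> z)) \<longlonglongrightarrow> 0))"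
proof -
  interpret Met: Metric_space "carrier X" "ndist X" by (rule Metric_space_ndist)
  have lim: "limitin Met.mtopology u z sequentially \<longleftrightarrow> z \<in> carrier X \<and> (\<lambda>n. nrm X (u n \<ominus> z)) \<longlonglongrightarrow> 0"
    if "range u \<subseteq> carrier X" for u z
  proof -
    have "u n \<in> carrier X" for n using that by auto
    then show ?thesis
      by (auto simp: Met.limitin_metric_dist_null ndist_def)
  qed
  have cauchy: "Met.MCauchy u \<longleftrightarrow> range u \<subseteq> carrier X \<and> (\<forall>e>0. \<exists>N. \<forall>m\<ge>N. \<forall>n\<ge>N. nrm X (u m \<ominus> u n) < e)" for u
  proof (cases "range u \<subseteq> carrier X")
    case True
    then have "u n \<in> carrier X" for n by auto
    then show ?thesis using True by (auto simp: Met.MCauchy_def ndist_def)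
  qed (simp add: Met.MCauchy_def)
  have "nvs X" by unfold_locales
  moreover have "Met.mcomplete \<longleftrightarrow> (\<forall>u. range u \<subseteq> carrier X \<longrightarrow>
      (\<forall>e>0. \<exists>N. \<forall>m\<ge>N. \<forall>n\<ge>N. nrm X (u m \<ominus> u n) < e) \<longrightarrow>
      (\<exists>z\<in>carrier X. (\<lambda>n. nrm X (u n \<ominus> z)) \<longlonglongrightarrow> 0))"
    unfolding Met.mcomplete_def
  proof (intro iff_allI)
    fix u
    show "(Met.MCauchy u \<longrightarrow> (\<exists>z. limitin Met.mtopology u z sequentially)) \<longleftrightarrow>
      (range u \<subseteq> carrier X \<longrightarrow>
      (\<forall>e>0. \<exists>N. \<forall>m\<ge>N. \<forall>n\<ge>N. nrm X (u m \<ominus> u n) < e) \<longrightarrow>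
      (\<exists>z\<in>carrier X. (\<lambda>n. nrm X (u n \<ominus> z)) \<longlonglongrightarrow> 0))"
      unfolding cauchy by (cases "range u \<subseteq> carrier X") (simp_all only: lim Bex_def simp_thms)
  qed
  ultimately show ?thesis unfolding banach_space_def by blast
qed

end

lemma bounded_opsD:
  assumes "T \<in> bounded_ops X Y"
  shows "x \<in> carrier X \<Longrightarrow> T x \<in> carrier Y"
    and "\<lbrakk>x \<in> carrier X; y \<in> carrier X\<rbrakk> \<Longrightarrow> T (x \<oplus>\<^bsub>X\<^esub> y) = T x \<oplus>\<^bsub>Y\<^esub> T y"
    and "x \<in> carrier X \<Longrightarrow> T (a \<odot>\<^bsub>X\<^esub> x) = a \<odot>\<^bsub>Y\<^esub> T x"
  using assms by (auto simp: bounded_ops_def)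

lemma nvs_scalar_space: "nvs (scalar_space :: ('k::real_normed_field, 'k) nspace)"
proof -
  have inv: "\<exists>y. y + x = (0::'k)" for x by (rule exI[of _ "-x"]) simp
  have inv': "\<exists>y. x + y = (0::'k)" for x by (rule exI[of _ "-x"]) simp
  have "cring (scalar_space :: ('k, 'k) nspace)"
  proof (intro cringI abelian_groupI comm_monoidI)
  qed (auto simp: algebra_simps intro: inv inv')
  moreover then have "abelian_group (scalar_space :: ('k, 'k) nspace)"
    by (simp add: cring_def ring_def)
  ultimately have "module (scalar_space :: ('k, 'k) nspace) (scalar_space :: ('k, 'k) nspace)"
    by (intro moduleI) (auto simp: algebra_simps)
  then show ?thesis
    by (intro nvs.intro nvs_axioms.intro) (auto simp: norm_mult norm_triangle_ineq)
qed

lemma bounded_ops_zero: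
  assumes "nvs X" "nvs Y" "T \<in> bounded_ops X Y"
  shows "T \<zero>\<^bsub>X\<^esub> = \<zero>\<^bsub>Y\<^esub>"
proof -
  interpret X: nvs X by fact
  interpret Y: nvs Y by fact
  show ?thesis using bounded_opsD(3)[OF assms(3), of "\<zero>\<^bsub>X\<^esub>" 0] bounded_opsD(1)[OF assms(3), of "\<zero>\<^bsub>X\<^esub>"] by simp
qed

lemma bounded_ops_minus:
  assumes "nvs X" "nvs Y" "T \<in> bounded_ops X Y" "x \<in> carrier X" "y \<in> carrier X"
  shows "T (x \<ominus>\<^bsub>X\<^esub> y) = T x \<ominus>\<^bsub>Y\<^esub> T y"
proof -
  interpret X: nvs X by fact
  interpret Y: nvs Y by fact
  show ?thesis using assms(4,5)
    by (simp add: X.minus_eq_sm Y.minus_eq_sm bounded_opsD[OF assms(3)])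
qed

lemma bounded_ops_finsum:
  assumes "nvs X" "nvs Y" "T \<in> bounded_ops X Y" "finite A" "\<And>i. i \<in> A \<Longrightarrow> x i \<in> carrier X"
  shows "T (finsum X x A) = finsum Y (\<lambda>i. T (x i)) A"
proof -
  interpret X: nvs X by fact
  interpret Y: nvs Y by fact
  show ?thesis using assms(4,5)
  proof (induction A rule: finite_induct)
    case empty
    then show ?case by (simp add: bounded_ops_zero[OF assms(1-3)])
  next
    case (insert i A)
    then show ?case
      by (simp add: Pi_def bounded_opsD[OF assms(3)] X.finsum_closed)
  qed
qed

lemma finsum_scalar_space: "finsum (scalar_space :: ('k::real_normed_field, 'k) nspace) f A = sum f A"
proof (cases "finite A")
  case True
  interpret S: nvs "scalar_space :: ('k, 'k) nspace" by (rule nvs_scalar_space)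
  show ?thesis using True by (induction A rule: finite_induct) (simp_all add: Pi_def)
next
  case False
  then show ?thesis by (simp add: finsum_def finprod_def)
qed

lemma scalar_minus: "x \<ominus>\<^bsub>(scalar_space :: ('k::real_normed_field, 'k) nspace)\<^esub> y = x - y"
proof -
  interpret S: nvs "scalar_space :: ('k, 'k) nspace" by (rule nvs_scalar_space)
  show ?thesis by (simp add: S.minus_eq_sm)
qed

lemma (in nvs) functional_simps:
  assumes "f \<in> bounded_ops X scalar_space"
  shows "\<lbrakk>x \<in> carrier X; y \<in> carrier X\<rbrakk> \<Longrightarrow> f (x \<oplus> y) = f x + f y"
    and "x \<in> carrier X \<Longrightarrow> f (a \<odot> x) = a * f x"
    and "f \<zero> = 0"
    and "\<lbrakk>x \<in> carrier X; y \<in> carrier X\<rbrakk> \<Longrightarrow> f (x \<ominus> y) = f x - f y"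
    and "\<lbrakk>finite A; \<And>i. i \<in> A \<Longrightarrow> u i \<in> carrier X\<rbrakk> \<Longrightarrow> f (finsum X u A) = (\<Sum>i\<in>A. f (u i))"
proof -
  note nX = nvs_axioms and nS = nvs_scalar_space
  show "\<lbrakk>x \<in> carrier X; y \<in> carrier X\<rbrakk> \<Longrightarrow> f (x \<oplus> y) = f x + f y"
    "x \<in> carrier X \<Longrightarrow> f (a \<odot> x) = a * f x"
    using bounded_opsD[OF assms] by simp_all
  show "f \<zero> = 0" using bounded_ops_zero[OF nX nS assms] by simp
  show "\<lbrakk>x \<in> carrier X; y \<in> carrier X\<rbrakk> \<Longrightarrow> f (x \<ominus> y) = f x - f y"
    using bounded_ops_minus[OF nX nS assms] by (simp add: scalar_minus)
  show "\<lbrakk>finite A; \<And>i. i \<in> A \<Longrightarrow> u i \<in> carrier X\<rbrakk> \<Longrightarrow> f (finsum X u A) = (\<Sum>i\<in>A. f (u i))"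
    by (rule bounded_ops_finsum[OF nX nS assms, unfolded finsum_scalar_space])
qed

lemma (in nvs) dual_ball_bound:
  assumes f: "f \<in> dual_ball X" and x: "x \<in> carrier X"
  shows "norm (f x) \<le> nrm X x"
proof (cases "nrm X x = 0")
  case True
  then show ?thesis using f x functional_simps(3)[of f] by (simp add: nrm_eq_0_iff dual_ball_def)
next
  case False
  then have pos: "nrm X x > 0" using nrm_nonneg[OF x] by simp
  let ?y = "of_real (1 / nrm X x) \<odot> x"
  have "?y \<in> unit_ball X" using x pos by (simp add: unit_ball_def nrm_smult norm_divide)
  then have "norm (f ?y) \<le> 1" using f by (auto simp: dual_ball_def)
  moreover have "f ?y = of_real (1 / nrm X x) * f x"
    using f x by (intro functional_simps(2)) (auto simp: dual_ball_def)
  ultimately show ?thesis using pos by (simp add: norm_mult norm_divide divide_le_eq)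
qed

section \<open>Hahn-Banach\<close>

definition sublinear :: "('k::real_normed_field, 'a) nspace \<Rightarrow> ('a \<Rightarrow> real) \<Rightarrow> bool" where
  "sublinear X s \<longleftrightarrow>
     (\<forall>x\<in>carrier X. \<forall>y\<in>carrier X. s (x \<oplus>\<^bsub>X\<^esub> y) \<le> s x + s y) \<and>
     (\<forall>x\<in>carrier X. \<forall>r\<ge>0. s (of_real r \<odot>\<^bsub>X\<^esub> x) = r * s x)"

text \<open>
  The infimum lies below \<open>s\<close>, is again sublinear, and takes a value at most \<open>- s y\<close> at \<open>- y\<close>. A
  minimal sublinear function is therefore equal to all its slides, which forces it to be
  additive.
\<close>

definition slide :: "('k::real_normed_field, 'a) nspace \<Rightarrow> ('a \<Rightarrow> real) \<Rightarrow> 'a \<Rightarrow> 'a \<Rightarrow> real" where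
  "slide X s y x = (INF t\<in>{0..}. s (x \<oplus>\<^bsub>X\<^esub> of_real t \<odot>\<^bsub>X\<^esub> y) - t * s y)"

context nvs begin

lemma sublinear_zero: "sublinear X s \<Longrightarrow> s \<zero> = 0"
  using sm_zero_right[of 0] M.zero_closed unfolding sublinear_def
  by (metis mult_zero_left of_real_0 order_refl)

lemma sublinear_lower: "\<lbrakk>sublinear X s; x \<in> carrier X\<rbrakk> \<Longrightarrow> - s (\<ominus> x) \<le> s x"
proof -
  assume s: "sublinear X s" and x: "x \<in> carrier X"
  have "s (x \<oplus> \<ominus> x) \<le> s x + s (\<ominus> x)" using s x unfolding sublinear_def by blast
  then show ?thesis using sublinear_zero[OF s] x by (simp add: M.r_neg)
qed

lemma slide_term_lower:
  assumes s: "sublinear X s" and "x \<in> carrier X" "y \<in> carrier X" "t \<ge> 0"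
  shows "- s (\<ominus> x) \<le> s (x \<oplus> of_real t \<odot> y) - t * s y"
proof -
  have "t * s y = s (of_real t \<odot> y)" using assms unfolding sublinear_def by simp
  also have "of_real t \<odot> y = (x \<oplus> of_real t \<odot> y) \<oplus> \<ominus> x"
    using assms by (simp add: M.a_ac M.r_neg1 M.r_neg2)
  also have "s \<dots> \<le> s (x \<oplus> of_real t \<odot> y) + s (\<ominus> x)"
    using assms unfolding sublinear_def by (meson M.add.inv_closed M.add.m_closed sm_closed)
  finally show ?thesis by simp
qed

lemma slide_bdd_below:
  assumes "sublinear X s" "x \<in> carrier X" "y \<in> carrier X"
  shows "bdd_below ((\<lambda>t. s (x \<oplus> of_real t \<odot> y) - t * s y) ` {0..})"
  by (rule bdd_belowI2[of _ "- s (\<ominus> x)"]) (use assms slide_term_lower in auto)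

lemma slide_le:
  assumes "sublinear X s" "x \<in> carrier X" "y \<in> carrier X" "t \<ge> 0"
  shows "slide X s y x \<le> s (x \<oplus> of_real t \<odot> y) - t * s y"
  unfolding slide_def using assms by (intro cINF_lower slide_bdd_below) auto

lemma slide_le_self:
  assumes "sublinear X s" "x \<in> carrier X" "y \<in> carrier X"
  shows "slide X s y x \<le> s x"
  using slide_le[OF assms, of 0] assms by simp

lemma slide_uminus_le:
  assumes "sublinear X s" "y \<in> carrier X"
  shows "slide X s y (\<ominus> y) \<le> - s y"
  using slide_le[of s "\<ominus> y" y 1] assms sublinear_zero[of s] by (simp add: M.l_neg)

lemma sublinear_slide:
  assumes s: "sublinear X s" and y: "y \<in> carrier X"
  shows "sublinear X (slide X s y)"
  unfolding sublinear_def
proof (intro conjI ballI allI impI)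
  have add: "s (u \<oplus> v) \<le> s u + s v" if "u \<in> carrier X" "v \<in> carrier X" for u v
    using s that by (simp add: sublinear_def)
  fix x x' assume x: "x \<in> carrier X" and x': "x' \<in> carrier X"
  have "slide X s y (x \<oplus> x') - (s (x' \<oplus> of_real t' \<odot> y) - t' * s y) \<le> s (x \<oplus> of_real t \<odot> y) - t * s y"
    if "t \<ge> 0" "t' \<ge> 0" for t t'
  proof -
    have "slide X s y (x \<oplus> x') \<le> s ((x \<oplus> x') \<oplus> of_real (t + t') \<odot> y) - (t + t') * s y"
      using that x x' y s by (intro slide_le) auto
    also have "(x \<oplus> x') \<oplus> of_real (t + t') \<odot> y = (x \<oplus> of_real t \<odot> y) \<oplus> (x' \<oplus> of_real t' \<odot> y)"
      using x x' y by (simp add: sm_add_left M.a_ac)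
    also have "s \<dots> \<le> s (x \<oplus> of_real t \<odot> y) + s (x' \<oplus> of_real t' \<odot> y)"
      using x x' y by (intro add) auto
    finally show ?thesis by (simp add: algebra_simps)
  qed
  then have "slide X s y (x \<oplus> x') - (s (x' \<oplus> of_real t' \<odot> y) - t' * s y) \<le> slide X s y x" if "t' \<ge> 0" for t'
    unfolding slide_def[of X s y x] using that by (intro cINF_greatest) auto
  then have "slide X s y (x \<oplus> x') - slide X s y x \<le> s (x' \<oplus> of_real t' \<odot> y) - t' * s y" if "t' \<ge> 0" for t'
    using that by (simp add: algebra_simps)
  then have "slide X s y (x \<oplus> x') - slide X s y x \<le> slide X s y x'"
    unfolding slide_def[of X s y x'] by (intro cINF_greatest) auto
  then show "slide X s y (x \<oplus> x') \<le> slide X s y x + slide X s y x'" by simp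
next
  have hom: "s (of_real r \<odot> u) = r * s u" if "u \<in> carrier X" "r \<ge> 0" for r u
    using s that by (simp add: sublinear_def)
  have le: "slide X s y (of_real r \<odot> x) \<le> r * slide X s y x" if x: "x \<in> carrier X" and r: "r > 0" for x r
  proof -
    have "slide X s y (of_real r \<odot> x) / r \<le> s (x \<oplus> of_real t \<odot> y) - t * s y" if t: "t \<ge> 0" for t
    proof -
      have "slide X s y (of_real r \<odot> x) \<le> s (of_real r \<odot> x \<oplus> of_real (r * t) \<odot> y) - (r * t) * s y"
        using x y t r s by (intro slide_le) auto
      also have "of_real r \<odot> x \<oplus> of_real (r * t) \<odot> y = of_real r \<odot> (x \<oplus> of_real t \<odot> y)"
        using x y by (simp add: sm_add_right sm_mult)
      also have "s \<dots> = r * s (x \<oplus> of_real t \<odot> y)" using x y r by (intro hom) auto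
      finally show ?thesis by (subst pos_divide_le_eq[OF r]) (simp add: algebra_simps)
    qed
    then have "slide X s y (of_real r \<odot> x) / r \<le> slide X s y x"
      unfolding slide_def[of X s y x] by (intro cINF_greatest) auto
    then show ?thesis using r by (simp add: divide_le_eq mult.commute)
  qed
  fix x and r :: real assume x: "x \<in> carrier X" and r: "0 \<le> r"
  show "slide X s y (of_real r \<odot> x) = r * slide X s y x"
  proof (cases "r = 0")
    case True
    have "slide X s y \<zero> \<le> 0" using slide_le_self[OF s _ y, of \<zero>] sublinear_zero[OF s] by simp
    moreover have "0 \<le> slide X s y \<zero>"
      unfolding slide_def using hom y by (intro cINF_greatest) auto
    ultimately show ?thesis using True x by simp
  next
    case False
    then have rp: "r > 0" using r by simp
    have "slide X s y (of_real (1 / r) \<odot> (of_real r \<odot> x)) \<le> (1 / r) * slide X s y (of_real r \<odot> x)"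
      using x rp by (intro le) auto
    then have "r * slide X s y x \<le> slide X s y (of_real r \<odot> x)"
      using x rp by (simp add: sm_mult field_simps flip: of_real_mult)
    then show ?thesis using le[OF x rp] by simp
  qed
qed

text \<open>
  Subadditivity of a pointwise infimum fails in general; in a chain, two members used for \<open>x\<close>
  and \<open>y\<close> can be replaced by the smaller of the two.
\<close>

lemma sublinear_chain_INF:
  assumes sub: "\<And>s. s \<in> C \<Longrightarrow> sublinear X s" and ne: "C \<noteq> {}"
    and chain: "\<And>s t. \<lbrakk>s \<in> C; t \<in> C\<rbrakk> \<Longrightarrow> (\<forall>x\<in>carrier X. s x \<le> t x) \<or> (\<forall>x\<in>carrier X. t x \<le> s x)"
    and bdd: "\<And>x. x \<in> carrier X \<Longrightarrow> bdd_below ((\<lambda>s. s x) ` C)"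
  shows "sublinear X (\<lambda>x. INF s\<in>C. s x)"
  unfolding sublinear_def
proof (intro conjI ballI allI impI)
  fix x y assume x: "x \<in> carrier X" and y: "y \<in> carrier X"
  have "(INF s\<in>C. s (x \<oplus> y)) \<le> s x + t y" if st: "s \<in> C" "t \<in> C" for s t
  proof -
    obtain r where r: "r \<in> C" "r x \<le> s x" "r y \<le> t y"
      using chain[OF st] st x y by (metis order_refl)
    have "(INF s\<in>C. s (x \<oplus> y)) \<le> r (x \<oplus> y)" using r x y bdd by (intro cINF_lower) auto
    also have "\<dots> \<le> r x + r y" using sub[OF r(1)] x y by (simp add: sublinear_def)
    finally show ?thesis using r by simp
  qed
  then have "(INF s\<in>C. s (x \<oplus> y)) - t y \<le> (INF s\<in>C. s x)" if "t \<in> C" for t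
    using that ne by (intro cINF_greatest) (auto simp: algebra_simps)
  then have "(INF s\<in>C. s (x \<oplus> y)) - (INF s\<in>C. s x) \<le> (INF t\<in>C. t y)"
    using ne by (intro cINF_greatest) (auto simp: algebra_simps)
  then show "(INF s\<in>C. s (x \<oplus> y)) \<le> (INF s\<in>C. s x) + (INF s\<in>C. s y)" by simp
next
  fix x and r :: real assume x: "x \<in> carrier X" and r: "0 \<le> r"
  have "(INF s\<in>C. s (of_real r \<odot> x)) = (INF s\<in>C. r * s x)"
    using sub x r by (intro INF_cong) (auto simp: sublinear_def)
  also have "\<dots> = r * (INF s\<in>C. s x)"
  proof (cases "r = 0")
    case False
    then have rp: "r > 0" using r by simp
    have "(INF s\<in>C. r * s x) / r \<le> (INF s\<in>C. s x)"
    proof (intro cINF_greatest ne)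
      fix s assume "s \<in> C"
      have "bdd_below ((\<lambda>s. r * s x) ` C)"
      proof -
        obtain B where "\<And>s. s \<in> C \<Longrightarrow> B \<le> s x" using bdd[OF x] by (auto simp: bdd_below_def)
        then show ?thesis using rp by (intro bdd_belowI2[of _ "r * B"]) auto
      qed
      then have "(INF s\<in>C. r * s x) \<le> r * s x" using \<open>s \<in> C\<close> by (intro cINF_lower) auto
      then show "(INF s\<in>C. r * s x) / r \<le> s x" using rp by (simp add: divide_le_eq mult.commute)
    qed
    moreover have "r * (INF s\<in>C. s x) \<le> (INF s\<in>C. r * s x)"
      using ne rp bdd[OF x] by (intro cINF_greatest) (auto intro!: mult_left_mono cINF_lower)
    ultimately show ?thesis using rp by (simp add: divide_le_eq mult.commute)
  qed (use ne in simp)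
  finally show "(INF s\<in>C. s (of_real r \<odot> x)) = r * (INF s\<in>C. s x)" .
qed

text \<open>
  A form of the Hahn-Banach theorem that needs no partially defined functionals. Zorn's lemma
  gives a minimal sublinear function below \<open>s\<close>; it equals its slide in the direction \<open>y\<close>, and the
  term with \<open>t = 1\<close> in that infimum is the missing inequality for additivity. Functions are made
  zero outside the carrier so that the pointwise order is antisymmetric.
\<close>

lemma ex_additive_below_sublinear:
  assumes s: "sublinear X s"
  obtains u where "sublinear X u" "\<And>x. x \<in> carrier X \<Longrightarrow> u x \<le> s x"
    "\<And>x y. \<lbrakk>x \<in> carrier X; y \<in> carrier X\<rbrakk> \<Longrightarrow> u (x \<oplus> y) = u x + u y"
proof -
  define A where "A = {t. sublinear X t \<and> (\<forall>x\<in>carrier X. t x \<le> s x) \<and> (\<forall>x. x \<notin> carrier X \<longrightarrow> t x = 0)}"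
  define P :: "('a \<Rightarrow> real) \<Rightarrow> ('a \<Rightarrow> real) \<Rightarrow> bool" where "P = (\<lambda>a b. \<forall>x. b x \<le> a x)"
  have trunc: "sublinear X (\<lambda>x. if x \<in> carrier X then t x else 0)" if "sublinear X t" for t
    using that by (auto simp: sublinear_def)
  have po: "partial_order_on A (relation_of P A)"
    by (rule partial_order_on_relation_ofI) (auto simp: P_def fun_eq_iff intro: order_trans antisym)
  have "\<exists>m\<in>A. \<forall>a\<in>A. P m a \<longrightarrow> a = m"
  proof (rule predicate_Zorn[OF po])
    fix C assume C: "C \<in> Chains (relation_of P A)"
    have CA: "C \<subseteq> A" using C by (auto simp: Chains_def relation_of_def)
    show "\<exists>u\<in>A. \<forall>a\<in>C. P a u"
    proof (cases "C = {}")
      case True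
      then show ?thesis using trunc[OF s] by (intro bexI[of _ "\<lambda>x. if x \<in> carrier X then s x else 0"]) (auto simp: A_def)
    next
      case False
      define u where "u x = (if x \<in> carrier X then INF t\<in>C. t x else 0)" for x
      have bdd: "bdd_below ((\<lambda>t. t x) ` C)" if x: "x \<in> carrier X" for x
      proof (rule bdd_belowI2)
        fix t assume "t \<in> C"
        then have t: "t \<in> A" using CA by auto
        then have "- t (\<ominus> x) \<le> t x" using x by (intro sublinear_lower) (auto simp: A_def)
        moreover have "t (\<ominus> x) \<le> s (\<ominus> x)" using t x by (auto simp: A_def)
        ultimately show "- s (\<ominus> x) \<le> t x" by simp
      qed
      have "sublinear X (\<lambda>x. INF t\<in>C. t x)"
      proof (rule sublinear_chain_INF)
        fix t t' assume "t \<in> C" "t' \<in> C"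
        then show "(\<forall>x\<in>carrier X. t x \<le> t' x) \<or> (\<forall>x\<in>carrier X. t' x \<le> t x)"
          using C by (auto simp: Chains_def relation_of_def P_def)
      qed (use CA False bdd in \<open>auto simp: A_def\<close>)
      then have "sublinear X u" unfolding u_def by (rule trunc)
      moreover have "u x \<le> t x" if "t \<in> C" for t x
        using that CA bdd by (auto simp: u_def A_def intro: cINF_lower)
      moreover obtain t0 where "t0 \<in> C" using False by blast
      then have "u x \<le> s x" if "x \<in> carrier X" for x
        using calculation(2)[of t0 x] CA that by (force simp: A_def)
      ultimately have "u \<in> A" "\<forall>a\<in>C. P a u" by (auto simp: A_def P_def u_def)
      then show ?thesis by blast
    qed
  qed
  then obtain m where m: "m \<in> A" and min: "\<And>a. a \<in> A \<Longrightarrow> P m a \<Longrightarrow> a = m" by blast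
  have sm: "sublinear X m" and ms: "\<And>x. x \<in> carrier X \<Longrightarrow> m x \<le> s x" and m0: "\<And>x. x \<notin> carrier X \<Longrightarrow> m x = 0"
    using m by (auto simp: A_def)
  have fix_slide: "slide X m y x = m x" if y: "y \<in> carrier X" and x: "x \<in> carrier X" for x y
  proof -
    let ?t = "\<lambda>x. if x \<in> carrier X then slide X m y x else 0"
    have "?t \<in> A" unfolding A_def
      using trunc[OF sublinear_slide[OF sm y]] slide_le_self[OF sm _ y] ms by (auto intro: order_trans)
    moreover have "P m ?t" unfolding P_def using slide_le_self[OF sm _ y] m0 by auto
    ultimately have "?t = m" by (rule min)
    then have "?t x = m x" by (rule fun_cong)
    then show ?thesis using x by simp
  qed
  show thesis
  proof (rule that[OF sm ms])
    fix x y assume x: "x \<in> carrier X" and y: "y \<in> carrier X"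
    have "m x \<le> m (x \<oplus> y) - m y" using slide_le[OF sm x y, of 1] fix_slide[OF y x] y by simp
    moreover have "m (x \<oplus> y) \<le> m x + m y" using sm x y by (simp add: sublinear_def)
    ultimately show "m (x \<oplus> y) = m x + m y" by simp
  qed
qed

text \<open>
  Starting from the slide of the norm in the direction \<open>x0\<close> instead of the norm itself forces
  the value at \<open>x0\<close>.
\<close>

lemma ex_real_norming:
  assumes x0: "x0 \<in> carrier X"
  obtains u where "\<And>x. x \<in> carrier X \<Longrightarrow> u x \<le> nrm X x"
    "\<And>x y. \<lbrakk>x \<in> carrier X; y \<in> carrier X\<rbrakk> \<Longrightarrow> u (x \<oplus> y) = u x + u y"
    "\<And>x r. x \<in> carrier X \<Longrightarrow> u (of_real r \<odot> x) = r * u x"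
    "u x0 = nrm X x0"
proof -
  have n: "sublinear X (nrm X)" by (simp add: sublinear_def nrm_triangle nrm_smult)
  obtain u where u: "sublinear X u" "\<And>x. x \<in> carrier X \<Longrightarrow> u x \<le> slide X (nrm X) x0 x"
    "\<And>x y. \<lbrakk>x \<in> carrier X; y \<in> carrier X\<rbrakk> \<Longrightarrow> u (x \<oplus> y) = u x + u y"
    using ex_additive_below_sublinear[OF sublinear_slide[OF n x0]] by blast
  have le: "u x \<le> nrm X x" if "x \<in> carrier X" for x
    using u(2)[OF that] slide_le_self[OF n that x0] by simp
  have neg: "u (\<ominus> x) = - u x" if "x \<in> carrier X" for x
    using u(3)[of x "\<ominus> x"] that sublinear_zero[OF u(1)] by (simp add: M.r_neg)
  have "u (\<ominus> x0) \<le> - nrm X x0" using u(2)[of "\<ominus> x0"] slide_uminus_le[OF n x0] x0 by simp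
  then have eq: "u x0 = nrm X x0" using neg[OF x0] le[OF x0] by simp
  have hom: "u (of_real r \<odot> x) = r * u x" if x: "x \<in> carrier X" for x r
  proof (cases "r \<ge> 0")
    case True
    then show ?thesis using u(1) x by (simp add: sublinear_def)
  next
    case False
    have "u (of_real r \<odot> x) = u (\<ominus> (of_real (- r) \<odot> x))"
      using x by (simp add: uminus_eq_sm sm_mult)
    also have "\<dots> = - u (of_real (- r) \<odot> x)" using x by (intro neg) auto
    also have "u (of_real (- r) \<odot> x) = (- r) * u x"
      using False u(1) x by (simp add: sublinear_def del: of_real_minus)
    finally show ?thesis by simp
  qed
  show thesis by (rule that[OF le u(3) hom eq])
qed

end

lemma norming_real:
  fixes X :: "(real, 'a) nspace"
  assumes "nvs X" "x0 \<in> carrier X"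
  shows "\<exists>f\<in>dual_ball X. norm (f x0) = nrm X x0"
proof -
  interpret nvs X by fact
  obtain u where u: "\<And>x. x \<in> carrier X \<Longrightarrow> u x \<le> nrm X x"
    "\<And>x y. \<lbrakk>x \<in> carrier X; y \<in> carrier X\<rbrakk> \<Longrightarrow> u (x \<oplus>\<^bsub>X\<^esub> y) = u x + u y"
    "\<And>x r. x \<in> carrier X \<Longrightarrow> u (of_real r \<odot>\<^bsub>X\<^esub> x) = r * u x"
    "u x0 = nrm X x0"
    using ex_real_norming[OF assms(2)] by blast
  have "\<bar>u x\<bar> \<le> nrm X x" if "x \<in> carrier X" for x
    using u(1)[OF that] u(1)[of "(- 1) \<odot>\<^bsub>X\<^esub> x"] u(3)[OF that, of "-1"] that by (simp add: nrm_smult)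
  then have "u \<in> dual_ball X"
    unfolding dual_ball_def bounded_ops_def unit_ball_def using u(2,3)
    by (auto intro!: exI[of _ 1] intro: order_trans)
  then show ?thesis using u(4) nrm_nonneg[OF assms(2)] by (intro bexI[of _ u]) auto
qed

text \<open>
  A real functional \<open>u\<close> is the real part of the complex functional \<open>x \<mapsto> u x - \<i> u (\<i> x)\<close>, and
  rotating the argument shows that both have the same bound.
\<close>

lemma norming_complex:
  fixes X :: "(complex, 'a) nspace"
  assumes "nvs X" "x0 \<in> carrier X"
  shows "\<exists>f\<in>dual_ball X. norm (f x0) = nrm X x0"
proof -
  interpret nvs X by fact
  obtain u where u: "\<And>x. x \<in> carrier X \<Longrightarrow> u x \<le> nrm X x"
    "\<And>x y. \<lbrakk>x \<in> carrier X; y \<in> carrier X\<rbrakk> \<Longrightarrow> u (x \<oplus>\<^bsub>X\<^esub> y) = u x + u y"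
    "\<And>x r. x \<in> carrier X \<Longrightarrow> u (of_real r \<odot>\<^bsub>X\<^esub> x) = r * u x"
    "u x0 = nrm X x0"
    using ex_real_norming[OF assms(2)] by blast
  define f where "f x = Complex (u x) (- u (\<i> \<odot>\<^bsub>X\<^esub> x))" for x
  have f_add: "f (x \<oplus>\<^bsub>X\<^esub> y) = f x + f y" if "x \<in> carrier X" "y \<in> carrier X" for x y
    using that by (simp add: f_def u(2) sm_add_right complex_eq_iff)
  have f_smult: "f (a \<odot>\<^bsub>X\<^esub> x) = a * f x" if x: "x \<in> carrier X" for a x
  proof -
    have 1: "u (a \<odot>\<^bsub>X\<^esub> x) = Re a * u x + Im a * u (\<i> \<odot>\<^bsub>X\<^esub> x)" for a
    proof -
      have "a = of_real (Re a) + of_real (Im a) * \<i>" by (simp add: complex_eq_iff)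
      then have "a \<odot>\<^bsub>X\<^esub> x = of_real (Re a) \<odot>\<^bsub>X\<^esub> x \<oplus>\<^bsub>X\<^esub> of_real (Im a) \<odot>\<^bsub>X\<^esub> (\<i> \<odot>\<^bsub>X\<^esub> x)"
        using x by (metis sm_add_left sm_mult)
      then show ?thesis using x by (simp add: u(2,3))
    qed
    have 2: "u (\<i> \<odot>\<^bsub>X\<^esub> (a \<odot>\<^bsub>X\<^esub> x)) = - Im a * u x + Re a * u (\<i> \<odot>\<^bsub>X\<^esub> x)"
      using x 1[of "\<i> * a"] by (simp add: sm_mult)
    show ?thesis unfolding f_def 2 1[of a] by (simp add: complex_eq_iff)
  qed
  have f_bound: "norm (f x) \<le> nrm X x" if x: "x \<in> carrier X" for x
  proof (cases "f x = 0")
    case True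
    then show ?thesis using nrm_nonneg[OF x] by simp
  next
    case False
    define c where "c = cnj (sgn (f x))"
    have c: "norm c = 1" using False by (simp add: c_def norm_sgn)
    have "c * f x = of_real (inverse (norm (f x))) * (f x * cnj (f x))"
      by (simp add: c_def sgn_div_norm scaleR_conv_of_real)
    also have "\<dots> = of_real (norm (f x))"
      using False by (simp add: complex_norm_square[symmetric] power2_eq_square)
    finally have "f (c \<odot>\<^bsub>X\<^esub> x) = of_real (norm (f x))"
      using x by (simp add: f_smult)
    then have "norm (f x) = u (c \<odot>\<^bsub>X\<^esub> x)" by (simp add: f_def complex_eq_iff)
    also have "\<dots> \<le> nrm X (c \<odot>\<^bsub>X\<^esub> x)" using x by (intro u) auto
    also have "\<dots> = nrm X x" using x c by (simp add: nrm_smult)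
    finally show ?thesis .
  qed
  have "f \<in> dual_ball X"
    unfolding dual_ball_def bounded_ops_def unit_ball_def using f_add f_smult f_bound
    by (auto intro!: exI[of _ 1]) (meson f_bound order_trans)
  moreover have "norm (f x0) = nrm X x0"
  proof (rule antisym)
    have "u x0 \<le> norm (f x0)" using abs_Re_le_cmod[of "f x0"] by (simp add: f_def)
    then show "nrm X x0 \<le> norm (f x0)" by (simp add: u(4))
  qed (use f_bound assms in auto)
  ultimately show ?thesis by blast
qed

section \<open>Unconditionally summable sequences through their tails\<close>

text \<open>
  The common setting for real and complex scalars: the norm is recovered from functionals.
  The Euclidean structure of the scalars supplies compactness of balls and the inner product
  for the second moments below.
\<close>

locale norming_space = nvs X for X :: "('k::{real_normed_field,euclidean_space}, 'a) nspace" (structure) +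
  assumes norming: "x \<in> carrier X \<Longrightarrow> \<exists>f\<in>dual_ball X. norm (f x) = nrm X x"

context norming_space begin

lemma nrm_leI: "\<lbrakk>x \<in> carrier X; \<And>f. f \<in> dual_ball X \<Longrightarrow> norm (f x) \<le> B\<rbrakk> \<Longrightarrow> nrm X x \<le> B"
  using norming[of x] by metis

lemma dual_ballD: "f \<in> dual_ball X \<Longrightarrow> f \<in> bounded_ops X scalar_space"
  by (simp add: dual_ball_def)

lemma vec_eqI:
  assumes "x \<in> carrier X" "y \<in> carrier X" "\<And>f. f \<in> dual_ball X \<Longrightarrow> f x = f y"
  shows "x = y"
proof -
  have "nrm X (x \<ominus> y) \<le> 0"
    using assms by (intro nrm_leI) (auto simp: functional_simps(4)[OF dual_ballD])
  then have "x \<ominus> y = \<zero>" using assms nrm_nonneg[of "x \<ominus> y"] by (simp add: nrm_eq_0_iff[symmetric])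
  then show ?thesis using assms by (simp add: minus_eq_zero_iff)
qed

end

definition psum :: "('k, 'a) nspace \<Rightarrow> (nat \<Rightarrow> 'k) \<Rightarrow> (nat \<Rightarrow> 'a) \<Rightarrow> nat \<Rightarrow> 'a" where
  "psum X c x n = finsum X (\<lambda>k. c k \<odot>\<^bsub>X\<^esub> x k) {..<n}"

lemma p_co_altdef:
  "p_co p X x = {z \<in> carrier X. \<exists>c\<in>conj_seq_ball p. (\<lambda>n. nrm X (psum X c x n \<ominus>\<^bsub>X\<^esub> z)) \<longlonglongrightarrow> 0}"
  by (simp add: p_co_def psum_def)

context nvs begin

lemma psum_closed [simp, intro]: "range x \<subseteq> carrier X \<Longrightarrow> psum X c x n \<in> carrier X"
  unfolding psum_def by (intro M.finsum_closed) (auto intro!: sm_closed)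

lemma functional_psum:
  assumes "f \<in> bounded_ops X scalar_space" "range x \<subseteq> carrier X"
  shows "f (psum X c x n) = (\<Sum>k<n. c k * f (x k))"
proof -
  have x: "x k \<in> carrier X" for k using assms(2) by auto
  show ?thesis unfolding psum_def using x
    by (simp add: functional_simps(5)[OF assms(1)] functional_simps(2)[OF assms(1)])
qed

lemma functional_LIMSEQ:
  assumes f: "f \<in> dual_ball X" and u: "\<And>n. u n \<in> carrier X" and z: "z \<in> carrier X"
    and lim: "(\<lambda>n. nrm X (u n \<ominus> z)) \<longlonglongrightarrow> 0"
  shows "(\<lambda>n. f (u n)) \<longlonglongrightarrow> f z"
proof -
  have fb: "f \<in> bounded_ops X scalar_space" using f by (simp add: dual_ball_def)
  have "norm (f (u n) - f z) \<le> nrm X (u n \<ominus> z)" for n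
    using dual_ball_bound[OF f, of "u n \<ominus> z"] u z functional_simps(4)[OF fb, of "u n" z] by simp
  then have "(\<lambda>n. f (u n) - f z) \<longlonglongrightarrow> 0"
    by (intro Lim_null_comparison[OF _ lim]) auto
  then show ?thesis by (simp add: LIM_zero_cancel)
qed

lemma scale_to_dual_ball:
  assumes f: "f \<in> bounded_ops X scalar_space"
  obtains C where "C > 0" "(\<lambda>x. f x / of_real C) \<in> dual_ball X"
proof -
  obtain C where C: "\<And>x. x \<in> carrier X \<Longrightarrow> norm (f x) \<le> C * nrm X x"
    using f by (simp add: bounded_ops_def) blast
  define D where "D = max C 1"
  have D: "D > 0" by (simp add: D_def)
  have b: "norm (f x / of_real D) \<le> nrm X x" if "x \<in> carrier X" for x
  proof -
    have "norm (f x) \<le> D * nrm X x"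
      using C[OF that] nrm_nonneg[OF that] mult_right_mono[of C D "nrm X x"] by (simp add: D_def)
    then show ?thesis using D by (simp add: norm_divide divide_le_eq mult.commute)
  qed
  have "(\<lambda>x. f x / of_real D) \<in> dual_ball X"
    unfolding dual_ball_def bounded_ops_def unit_ball_def using b functional_simps[OF f]
    by (auto simp: add_divide_distrib intro!: exI[of _ 1]) (meson b order_trans)
  then show thesis using that D by blast
qed

lemma lp_weakI:
  assumes p: "p \<ge> 1" and x: "range x \<subseteq> carrier X"
    and B: "\<And>f m. f \<in> dual_ball X \<Longrightarrow> (\<Sum>k<m. norm (f (x k)) powr p) \<le> B"
  shows "x \<in> lp_weak p X"
  unfolding lp_weak_def
proof (clarsimp simp: x)
  fix f assume f: "f \<in> bounded_ops X scalar_space"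
  obtain C where C: "C > 0" "(\<lambda>x. f x / of_real C) \<in> dual_ball X"
    using scale_to_dual_ball[OF f] by blast
  have "summable (\<lambda>k. norm (f (x k) / of_real C) powr p)"
    by (rule summableI_nonneg_bounded[of _ B]) (use B[OF C(2)] in \<open>auto simp: lessThan_atLeast0\<close>)
  then have "summable (\<lambda>k. C powr p * (norm (f (x k)) / C) powr p)"
    using C(1) by (intro summable_mult) (simp add: norm_divide)
  then show "summable (\<lambda>k. norm (f (x k)) powr p)"
    using C(1) by (simp add: powr_divide)
qed

lemma wnorm_leI:
  assumes p: "p \<ge> 1" and B0: "B \<ge> 0"
    and B: "\<And>f m. f \<in> dual_ball X \<Longrightarrow> (\<Sum>k<m. norm (f (x k)) powr p) \<le> B powr p"
  shows "wnorm p X x \<le> ennreal B"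
  unfolding wnorm_def
proof (rule SUP_least)
  fix f assume f: "f \<in> dual_ball X"
  have s: "summable (\<lambda>k. norm (f (x k)) powr p)"
    by (rule summableI_nonneg_bounded[of _ "B powr p"]) (use B[OF f] in \<open>auto simp: lessThan_atLeast0\<close>)
  have "(\<Sum>k. norm (f (x k)) powr p) \<le> B powr p"
    by (rule suminf_le_const[OF s]) (use B[OF f] in \<open>auto simp: lessThan_atLeast0\<close>)
  then have "(\<Sum>k. norm (f (x k)) powr p) powr (1 / p) \<le> (B powr p) powr (1 / p)"
    using p s by (intro powr_mono2 suminf_nonneg) auto
  also have "\<dots> = B" using p B0 by (simp add: powr_powr)
  finally show "ennreal ((\<Sum>k. norm (f (x k)) powr p) powr (1 / p)) \<le> ennreal B"
    by (rule ennreal_leI)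
qed

lemma wnormD:
  assumes p: "p \<ge> 1" and x: "x \<in> lp_weak p X" and B: "wnorm p X x \<le> ennreal B" "B \<ge> 0"
    and f: "f \<in> dual_ball X"
  shows "(\<Sum>k<m. norm (f (x k)) powr p) \<le> B powr p"
proof -
  have s: "summable (\<lambda>k. norm (f (x k)) powr p)" using x f by (auto simp: lp_weak_def dual_ball_def)
  let ?S = "\<Sum>k. norm (f (x k)) powr p"
  have S0: "?S \<ge> 0" using s by (intro suminf_nonneg) auto
  have "ennreal (?S powr (1 / p)) \<le> wnorm p X x" unfolding wnorm_def by (rule SUP_upper) fact
  then have "?S powr (1 / p) \<le> B" using B by (meson ennreal_le_iff order_trans)
  then have "(?S powr (1 / p)) powr p \<le> B powr p" using p by (intro powr_mono2) auto
  moreover have "(?S powr (1 / p)) powr p = ?S" using p S0 by (simp add: powr_powr)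
  moreover have "(\<Sum>k<m. norm (f (x k)) powr p) \<le> ?S" using s by (intro sum_le_suminf) auto
  ultimately show ?thesis by simp
qed

lemma tail_sum_eq:
  fixes x :: "nat \<Rightarrow> 'a"
  assumes "f \<in> dual_ball X" and "p \<ge> 1"
  shows "(\<Sum>k<m. norm (f (if k < n then \<zero> else x k)) powr p) = (\<Sum>k=n..<m. norm (f (x k)) powr p)"
proof -
  have "f \<zero> = 0" using assms functional_simps(3)[of f] by (simp add: dual_ball_def)
  then have "(\<Sum>k<m. norm (f (if k < n then \<zero> else x k)) powr p) = (\<Sum>k<m. if k \<in> {n..} then norm (f (x k)) powr p else 0)"
    using assms by (intro sum.cong) auto
  also have "\<dots> = (\<Sum>k=n..<m. norm (f (x k)) powr p)"
    by (subst sum.inter_restrict[symmetric]) (auto intro!: sum.cong)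
  finally show ?thesis .
qed

lemma lp_uncondI:
  assumes p: "p \<ge> 1" and x: "range x \<subseteq> carrier X"
    and tail: "\<And>e. e > 0 \<Longrightarrow> \<exists>N. \<forall>f\<in>dual_ball X. \<forall>m. (\<Sum>k=N..<m. norm (f (x k)) powr p) \<le> e"
  shows "x \<in> lp_uncond p X"
proof -
  have xk: "x k \<in> carrier X" for k using x by auto
  obtain N where N: "\<And>f m. f \<in> dual_ball X \<Longrightarrow> (\<Sum>k=N..<m. norm (f (x k)) powr p) \<le> 1"
    using tail[of 1] by auto
  have weak: "x \<in> lp_weak p X"
  proof (rule lp_weakI[OF p x])
    fix f m assume f: "f \<in> dual_ball X"
    have "(\<Sum>k<m. norm (f (x k)) powr p) \<le> (\<Sum>k\<in>{..<N} \<union> {N..<m}. norm (f (x k)) powr p)"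
      by (intro sum_mono2) auto
    also have "\<dots> = (\<Sum>k<N. norm (f (x k)) powr p) + (\<Sum>k=N..<m. norm (f (x k)) powr p)"
      by (intro sum.union_disjoint) auto
    also have "\<dots> \<le> (\<Sum>k<N. nrm X (x k) powr p) + 1"
      using N[OF f] p xk dual_ball_bound[OF f] by (intro add_mono sum_mono powr_mono2) auto
    finally show "(\<Sum>k<m. norm (f (x k)) powr p) \<le> (\<Sum>k<N. nrm X (x k) powr p) + 1" .
  qed
  have "((\<lambda>n. wnorm p X (\<lambda>k. if k < n then \<zero> else x k)) \<longlongrightarrow> 0) sequentially"
  proof (rule order_tendstoI)
    fix a :: ennreal assume "a < 0"
    then show "\<forall>\<^sub>F n in sequentially. a < wnorm p X (\<lambda>k. if k < n then \<zero> else x k)" by simp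
  next
    fix a :: ennreal assume "0 < a"
    then obtain b where b: "0 < b" "b < a" using dense by blast
    then obtain e where e: "b = ennreal e" "e > 0" by (cases b) (auto simp: ennreal_less_zero_iff)
    obtain N where N: "\<And>f m. f \<in> dual_ball X \<Longrightarrow> (\<Sum>k=N..<m. norm (f (x k)) powr p) \<le> e powr p"
      using tail[of "e powr p"] e by auto
    have "wnorm p X (\<lambda>k. if k < n then \<zero> else x k) \<le> ennreal e" if "n \<ge> N" for n
    proof (rule wnorm_leI[OF p])
      fix f m assume f: "f \<in> dual_ball X"
      have "(\<Sum>k=n..<m. norm (f (x k)) powr p) \<le> (\<Sum>k=N..<m. norm (f (x k)) powr p)"
        using that by (intro sum_mono2) auto
      then show "(\<Sum>k<m. norm (f (if k < n then \<zero> else x k)) powr p) \<le> e powr p"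
        using N[OF f, of m] tail_sum_eq[OF f p, of n x m] by simp
    qed (use e in simp)
    then show "\<forall>\<^sub>F n in sequentially. wnorm p X (\<lambda>k. if k < n then \<zero> else x k) < a"
      using b(2) unfolding e(1) eventually_sequentially by (meson order_le_less_trans)
  qed
  then show ?thesis using weak by (simp add: lp_uncond_def)
qed

text \<open>
  Together with the preceding lemma, this describes \<open>lp_uncond\<close> by tail sums of powers that are
  small uniformly over the dual ball, which is the form in which the later estimates use it.
\<close>

lemma lp_uncondD:
  assumes p: "p \<ge> 1" and x: "x \<in> lp_uncond p X"
  shows "range x \<subseteq> carrier X"
    and "e > 0 \<Longrightarrow> \<exists>N. \<forall>f\<in>dual_ball X. \<forall>m. (\<Sum>k=N..<m. norm (f (x k)) powr p) \<le> e"
proof -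
  have weak: "x \<in> lp_weak p X"
    and lim: "((\<lambda>n. wnorm p X (\<lambda>k. if k < n then \<zero> else x k)) \<longlongrightarrow> 0) sequentially"
    using x by (auto simp: lp_uncond_def)
  show range: "range x \<subseteq> carrier X" using weak by (simp add: lp_weak_def)
  assume e: "e > 0"
  have "eventually (\<lambda>n. wnorm p X (\<lambda>k. if k < n then \<zero> else x k) < ennreal (e powr (1 / p))) sequentially"
    using lim e by (intro order_tendstoD(2)) auto
  then obtain N where N: "wnorm p X (\<lambda>k. if k < N then \<zero> else x k) < ennreal (e powr (1 / p))"
    by (auto simp: eventually_sequentially)
  have tw: "(\<lambda>k. if k < N then \<zero> else x k) \<in> lp_weak p X"
    unfolding lp_weak_def
  proof (intro CollectI conjI ballI)
    show "range (\<lambda>k. if k < N then \<zero> else x k) \<subseteq> carrier X" using range by auto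
    fix f assume f: "f \<in> bounded_ops X scalar_space"
    have "summable (\<lambda>k. norm (f (x k)) powr p)" using weak f by (auto simp: lp_weak_def)
    then show "summable (\<lambda>k. norm (f (if k < N then \<zero> else x k)) powr p)"
      by (rule summable_comparison_test'[where N = 0]) (simp add: functional_simps(3)[OF f])
  qed
  show "\<exists>N. \<forall>f\<in>dual_ball X. \<forall>m. (\<Sum>k=N..<m. norm (f (x k)) powr p) \<le> e"
  proof (intro exI ballI allI)
    fix f m assume f: "f \<in> dual_ball X"
    have "(\<Sum>k<m. norm (f (if k < N then \<zero> else x k)) powr p) \<le> (e powr (1 / p)) powr p"
      using N by (intro wnormD[OF p tw _ _ f]) auto
    then show "(\<Sum>k=N..<m. norm (f (x k)) powr p) \<le> e"
      using e p tail_sum_eq[OF f p, of N x m] by (simp add: powr_powr)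
  qed
qed

text \<open>
  \<open>R n\<close> is the supremum of the tail sums over the dual ball; it is finite because all but
  finitely many terms are controlled by one tail and the others by the norms.
\<close>

lemma lp_uncond_tail_bound:
  assumes p: "p \<ge> 1" and x: "x \<in> lp_uncond p X"
  obtains R :: "nat \<Rightarrow> real" where "antimono R" "R \<longlonglongrightarrow> 0" "\<And>n. R n \<ge> 0"
    "\<And>f n m. f \<in> dual_ball X \<Longrightarrow> (\<Sum>k=n..<m. norm (f (x k)) powr p) \<le> R n"
proof -
  have xk: "x k \<in> carrier X" for k using lp_uncondD(1)[OF p x] by auto
  define S where "S f n m = (\<Sum>k=n..<m. norm (f (x k)) powr p)" for f :: "'a \<Rightarrow> 'k" and n m
  define R where "R n = (SUP fm\<in>dual_ball X \<times> UNIV. S (fst fm) n (snd fm))" for n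
  obtain N where N: "\<And>f m. f \<in> dual_ball X \<Longrightarrow> S f N m \<le> 1"
    using lp_uncondD(2)[OF p x, of 1] by (auto simp: S_def)
  have bound: "S f n m \<le> (\<Sum>k<N. nrm X (x k) powr p) + 1" if f: "f \<in> dual_ball X" for f n m
  proof -
    have "S f n m \<le> (\<Sum>k\<in>{..<N} \<union> {N..<m}. norm (f (x k)) powr p)"
      unfolding S_def by (intro sum_mono2) auto
    also have "\<dots> = (\<Sum>k<N. norm (f (x k)) powr p) + S f N m"
      unfolding S_def by (intro sum.union_disjoint) auto
    also have "\<dots> \<le> (\<Sum>k<N. nrm X (x k) powr p) + 1"
      using N[OF f] p xk dual_ball_bound[OF f] by (intro add_mono sum_mono powr_mono2) auto
    finally show ?thesis .
  qed
  have bdd: "bdd_above ((\<lambda>fm. S (fst fm) n (snd fm)) ` (dual_ball X \<times> UNIV))" for n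
    by (rule bdd_aboveI2) (use bound in auto)
  have le: "S f n m \<le> R n" if "f \<in> dual_ball X" for f n m
    unfolding R_def using that cSUP_upper[OF _ bdd, of "(f, m)" n] by auto
  have "(\<lambda>_. 0) \<in> dual_ball X"
    unfolding dual_ball_def bounded_ops_def by (auto intro!: exI[of _ 0])
  then have ne: "dual_ball X \<times> (UNIV :: nat set) \<noteq> {}" by auto
  have R0: "R n \<ge> 0" for n using le[OF \<open>(\<lambda>_. 0) \<in> dual_ball X\<close>, of n n] by (simp add: S_def)
  have anti: "antimono R"
  proof (rule antimonoI)
    fix n n' :: nat assume nn: "n \<le> n'"
    show "R n' \<le> R n" unfolding R_def[of n']
    proof (rule cSUP_least[OF ne], clarsimp)
      fix f m assume "f \<in> dual_ball X"
      have "S f n' m \<le> S f n m" unfolding S_def using nn by (intro sum_mono2) auto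
      then show "S f n' m \<le> R n" using le[OF \<open>f \<in> dual_ball X\<close>, of n m] by simp
    qed
  qed
  have "R \<longlonglongrightarrow> 0"
  proof (rule LIMSEQ_I)
    fix e :: real assume e: "0 < e"
    obtain N where N: "\<And>f m. f \<in> dual_ball X \<Longrightarrow> S f N m \<le> e / 2"
      using lp_uncondD(2)[OF p x, of "e / 2"] e by (auto simp: S_def)
    have "R N \<le> e / 2" unfolding R_def by (rule cSUP_least[OF ne]) (use N in auto)
    then have "norm (R n - 0) < e" if "n \<ge> N" for n
      using antimonoD[OF anti that] R0[of n] e by simp
    then show "\<exists>no. \<forall>n\<ge>no. norm (R n - 0) < e" by blast
  qed
  then show thesis using that[OF anti _ R0] le by (auto simp: S_def)
qed

end

section \<open>Conjugate coefficients and hulls\<close>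

lemma conj_seq_ballD:
  assumes "p > 1" "c \<in> conj_seq_ball p"
  shows "finite K \<Longrightarrow> (\<Sum>k\<in>K. norm (c k) powr (p / (p - 1))) \<le> 1"
proof -
  assume K: "finite K"
  have s: "summable (\<lambda>k. norm (c k) powr (p / (p - 1)))" "(\<Sum>k. norm (c k) powr (p / (p - 1))) \<le> 1"
    using assms by (auto simp: conj_seq_ball_def)
  have "(\<Sum>k\<in>K. norm (c k) powr (p / (p - 1))) \<le> (\<Sum>k. norm (c k) powr (p / (p - 1)))"
    using s K by (intro sum_le_suminf) auto
  then show ?thesis using s by simp
qed

lemma conj_seq_ballI:
  assumes "p > 1" "\<And>n. (\<Sum>k<n. norm (c k) powr (p / (p - 1))) \<le> 1"
  shows "c \<in> conj_seq_ball p"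
proof -
  have s: "summable (\<lambda>k. norm (c k) powr (p / (p - 1)))"
    by (rule summableI_nonneg_bounded[of _ 1]) (use assms in auto)
  then show ?thesis using assms suminf_le_const[OF s, of 1] by (simp add: conj_seq_ball_def)
qed

lemma conj_seq_ball_norm_le_1:
  assumes "p > 1" "c \<in> conj_seq_ball p"
  shows "norm (c k) \<le> 1"
proof (rule ccontr)
  assume "\<not> norm (c k) \<le> 1"
  then have "norm (c k) powr (p / (p - 1)) > 1 powr (p / (p - 1))"
    using assms(1) by (intro powr_less_mono2) auto
  then show False using conj_seq_ballD[OF assms, of "{k}"] by simp
qed

lemma conj_seq_ball_Hoelder:
  fixes g :: "nat \<Rightarrow> real"
  assumes p: "p \<ge> 1" and c: "c \<in> conj_seq_ball p" and K: "finite K"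
    and g: "\<And>k. g k \<ge> 0" and B: "B \<ge> 0" "(\<Sum>k\<in>K. g k powr p) \<le> B powr p"
  shows "(\<Sum>k\<in>K. norm (c k) * g k) \<le> B"
proof (cases "p = 1")
  case True
  then have "norm (c k) \<le> 1" for k using c by (simp add: conj_seq_ball_def)
  then have "(\<Sum>k\<in>K. norm (c k) * g k) \<le> (\<Sum>k\<in>K. g k)"
    using g by (intro sum_mono mult_left_le_one_le) auto
  then show ?thesis using B True g by simp
next
  case False
  then have p1: "p > 1" using p by simp
  define r where "r = p / (p - 1)"
  have r: "r > 1" "1 / r + 1 / p = 1" using p1 by (auto simp: r_def field_simps)
  show ?thesis
  proof (cases "B = 0")
    case True
    then have "(\<Sum>k\<in>K. g k powr p) = 0" using B p1 by (intro antisym sum_nonneg) auto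
    then have "g k = 0" if "k \<in> K" for k using that K by (subst (asm) sum_nonneg_eq_0_iff) auto
    then show ?thesis using True by simp
  next
    case False
    then have Bp: "B > 0" using B by simp
    have "(\<Sum>k\<in>K. norm (c k) * (g k / B)) \<le> (\<Sum>k\<in>K. norm (c k) powr r / r + (g k / B) powr p / p)"
      using r p1 g Bp by (intro sum_mono Youngs_inequality) auto
    also have "\<dots> = (\<Sum>k\<in>K. norm (c k) powr r) / r + (\<Sum>k\<in>K. g k powr p) / B powr p / p"
      using g Bp by (simp add: sum.distrib sum_divide_distrib powr_divide)
    also have "\<dots> \<le> 1 / r + 1 / p"
      using conj_seq_ballD[OF p1 c K] B(2) Bp r(1) p1
      by (intro add_mono divide_right_mono) (auto simp: r_def divide_le_eq)
    finally have "(\<Sum>k\<in>K. norm (c k) * g k) / B \<le> 1"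
      using r by (simp add: sum_divide_distrib)
    then show ?thesis using Bp by (simp add: divide_le_eq)
  qed
qed

text \<open>
  The equality case of Hoelder's inequality: the coefficient is \<open>\<bar>v k\<bar>\<^sup>q\<^sup>-\<^sup>1\<close>, rotated by the
  inverse of the sign of \<open>v k\<close> and normalized.
\<close>

lemma ex_dual_coefficients:
  fixes v :: "nat \<Rightarrow> 'k::real_normed_field"
  assumes q: "q > 1" and K: "finite K"
  obtains a where "a \<in> conj_seq_ball q" "\<And>k. k \<notin> K \<Longrightarrow> a k = 0"
    "(\<Sum>k\<in>K. a k * v k) = of_real ((\<Sum>k\<in>K. norm (v k) powr q) powr (1 / q))"
proof -
  define r where "r = q / (q - 1)"
  have r: "r > 1" "(q - 1) * r = q" using q by (auto simp: r_def field_simps)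
  define S where "S = (\<Sum>k\<in>K. norm (v k) powr q)"
  have S0: "S \<ge> 0" by (simp add: S_def sum_nonneg)
  define a where "a k = (if k \<in> K then of_real (norm (v k) powr (q - 1) / S powr (1 / r)) / sgn (v k) else 0)" for k
  have nsgn: "norm (inverse (sgn x)) \<le> 1" for x :: 'k by (simp add: norm_inverse norm_sgn)
  have na: "norm (a k) powr r \<le> norm (v k) powr q / S" if "k \<in> K" for k
  proof -
    have "norm (a k) = norm (v k) powr (q - 1) / S powr (1 / r) * norm (inverse (sgn (v k)))"
      using that by (simp add: a_def divide_inverse norm_mult norm_inverse)
    also have "\<dots> \<le> norm (v k) powr (q - 1) / S powr (1 / r)"
      using nsgn by (intro mult_left_le) auto
    finally have "norm (a k) powr r \<le> (norm (v k) powr (q - 1) / S powr (1 / r)) powr r"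
      using r by (intro powr_mono2) auto
    also have "\<dots> = norm (v k) powr q / S"
      using r S0 by (simp add: powr_divide powr_powr)
    finally show ?thesis .
  qed
  have "(\<Sum>k<n. norm (a k) powr r) \<le> 1" for n
  proof -
    have "(\<Sum>k<n. norm (a k) powr r) = (\<Sum>k\<in>{..<n} \<inter> K. norm (a k) powr r)"
      using r by (intro sum.mono_neutral_right) (auto simp: a_def)
    also have "\<dots> \<le> (\<Sum>k\<in>K. norm (a k) powr r)" using K by (intro sum_mono2) auto
    also have "\<dots> \<le> (\<Sum>k\<in>K. norm (v k) powr q / S)" by (intro sum_mono na)
    also have "\<dots> = S / S" by (simp only: S_def sum_divide_distrib)
    also have "\<dots> \<le> 1" by simp
    finally show ?thesis .
  qed
  then have "a \<in> conj_seq_ball q" using q by (intro conj_seq_ballI) (auto simp: r_def)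
  moreover have "(\<Sum>k\<in>K. a k * v k) = of_real (S powr (1 / q))"
  proof (cases "S = 0")
    case True
    then have "norm (v k) powr q = 0" if "k \<in> K" for k
      using that K unfolding S_def by (subst (asm) sum_nonneg_eq_0_iff) auto
    then show ?thesis using True by (intro trans[OF sum.neutral]) auto
  next
    case False
    then have Sp: "S > 0" using S0 by simp
    have "a k * v k = of_real (norm (v k) powr q / S powr (1 / r))" if "k \<in> K" for k
    proof (cases "v k = 0")
      case False
      have "v k = of_real (norm (v k)) * sgn (v k)" using False
        by (simp add: sgn_div_norm scaleR_conv_of_real)
      moreover have "sgn (v k) \<noteq> 0" using False by (simp add: sgn_zero_iff)
      ultimately have "v k / sgn (v k) = of_real (norm (v k))"
        by (metis nonzero_mult_div_cancel_right)
      moreover have "a k * v k = of_real (norm (v k) powr (q - 1) / S powr (1 / r)) * (v k / sgn (v k))"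
        using that by (simp add: a_def)
      ultimately have "a k * v k = of_real (norm (v k) powr (q - 1) / S powr (1 / r)) * of_real (norm (v k))"
        by simp
      also have "\<dots> = of_real (norm (v k) powr (q - 1) * norm (v k) / S powr (1 / r))"
        by (simp flip: of_real_mult)
      also have "norm (v k) powr (q - 1) * norm (v k) = norm (v k) powr q"
        using False by (simp add: powr_diff)
      finally show ?thesis .
    qed (use that q in simp)
    then have "(\<Sum>k\<in>K. a k * v k) = of_real (\<Sum>k\<in>K. norm (v k) powr q / S powr (1 / r))"
      by simp
    also have "(\<Sum>k\<in>K. norm (v k) powr q / S powr (1 / r)) = S / S powr (1 / r)"
      by (simp add: S_def sum_divide_distrib)
    also have "\<dots> = S powr (1 - 1 / r)" using Sp by (simp add: powr_diff)
    also have "1 - 1 / r = 1 / q" using q by (simp add: r_def field_simps)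
    finally show ?thesis .
  qed
  ultimately show thesis using that[of a] by (simp add: a_def S_def)
qed

text \<open>
  Convexity of \<open>t \<mapsto> t\<^sup>r\<close> together with its value \<open>0\<close> at \<open>0\<close>. Young's inequality is the tangent
  inequality for this function, taken at the point \<open>\<alpha> x + \<beta> y\<close>.
\<close>

lemma powr_subconvex:
  fixes x y \<alpha> \<beta> r :: real
  assumes r: "r > 1" and "x \<ge> 0" "y \<ge> 0" "\<alpha> \<ge> 0" "\<beta> \<ge> 0" "\<alpha> + \<beta> \<le> 1"
  shows "(\<alpha> * x + \<beta> * y) powr r \<le> \<alpha> * x powr r + \<beta> * y powr r"
proof -
  define t where "t = \<alpha> * x + \<beta> * y"
  have t: "t \<ge> 0" using assms by (simp add: t_def)
  have tangent: "r * (s * t powr (r - 1)) \<le> s powr r + (r - 1) * t powr r" if "s \<ge> 0" for s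
  proof -
    have "1 / r + 1 / (r / (r - 1)) = 1" using r by (simp add: field_simps)
    then have "s * t powr (r - 1) \<le> s powr r / r + (t powr (r - 1)) powr (r / (r - 1)) / (r / (r - 1))"
      using r that by (intro Youngs_inequality) (auto simp: field_simps)
    moreover have "(t powr (r - 1)) powr (r / (r - 1)) = t powr r" using r by (simp add: powr_powr)
    ultimately show ?thesis using r by (simp add: field_simps)
  qed
  have "t * t powr (r - 1) = t powr r" using t by (cases "t = 0") (simp_all add: powr_diff)
  then have "r * t powr r = r * ((\<alpha> * x + \<beta> * y) * t powr (r - 1))"
    by (simp add: t_def[symmetric])
  also have "\<dots> = \<alpha> * (r * (x * t powr (r - 1))) + \<beta> * (r * (y * t powr (r - 1)))"
    by (simp add: algebra_simps)
  also have "\<dots> \<le> \<alpha> * (x powr r + (r - 1) * t powr r) + \<beta> * (y powr r + (r - 1) * t powr r)"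
    using assms by (intro add_mono mult_left_mono tangent) auto
  also have "\<dots> = \<alpha> * x powr r + \<beta> * y powr r + (\<alpha> + \<beta>) * ((r - 1) * t powr r)"
    by (simp add: algebra_simps)
  also have "\<dots> \<le> \<alpha> * x powr r + \<beta> * y powr r + 1 * ((r - 1) * t powr r)"
    using assms by (intro add_left_mono mult_right_mono) auto
  finally show ?thesis by (simp add: t_def algebra_simps)
qed

lemma conj_seq_ball_abs_convex:
  fixes u v :: "nat \<Rightarrow> 'k::real_normed_field"
  assumes q: "q > 1" and u: "u \<in> conj_seq_ball q" and v: "v \<in> conj_seq_ball q" and ab: "norm a + norm b \<le> 1"
  shows "(\<lambda>k. a * u k + b * v k) \<in> conj_seq_ball q"
proof (rule conj_seq_ballI[OF q])
  fix n
  define r where "r = q / (q - 1)"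
  have r: "r > 1" using q by (simp add: r_def field_simps)
  have "norm (a * x + b * y) powr r \<le> norm a * norm x powr r + norm b * norm y powr r" for x y
  proof -
    have "norm (a * x + b * y) \<le> norm a * norm x + norm b * norm y "
      using norm_triangle_ineq[of "a * x" "b * y"] by (simp add: norm_mult)
    then have "norm (a * x + b * y) powr r \<le> (norm a * norm x + norm b * norm y) powr r"
      using r by (intro powr_mono2) auto
    also have "\<dots> \<le> norm a * norm x powr r + norm b * norm y powr r"
      using ab by (intro powr_subconvex[OF r]) auto
    finally show ?thesis .
  qed
  then have "(\<Sum>k<n. norm (a * u k + b * v k) powr r)
      \<le> (\<Sum>k<n. norm a * norm (u k) powr r + norm b * norm (v k) powr r)"
    by (intro sum_mono)
  also have "\<dots> = norm a * (\<Sum>k<n. norm (u k) powr r) + norm b * (\<Sum>k<n. norm (v k) powr r)"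
    by (simp add: sum.distrib sum_distrib_left)
  also have "\<dots> \<le> norm a * 1 + norm b * 1"
    using conj_seq_ballD[OF q u, of "{..<n}"] conj_seq_ballD[OF q v, of "{..<n}"]
    by (intro add_mono mult_left_mono) (auto simp: r_def)
  finally show "(\<Sum>k<n. norm (a * u k + b * v k) powr (q / (q - 1))) \<le> 1"
    using ab by (simp add: r_def)
qed

text \<open>
  Weak compactness of the unit ball of \<open>\<ell>\<^sup>q\<^sup>'\<close>, where \<open>q > 1\<close> is essential: a diagonal sequence
  converges in every coordinate, and the norm bound survives because it is a bound on finite
  partial sums.
\<close>

lemma conj_seq_ball_cluster_point:
  fixes c :: "nat \<Rightarrow> nat \<Rightarrow> 'k::{real_normed_field, heine_borel}"
  assumes q: "q > 1" and c: "\<And>i. c i \<in> conj_seq_ball q"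
  obtains s d where "strict_mono (s :: nat \<Rightarrow> nat)" "d \<in> conj_seq_ball q" "\<And>k. (\<lambda>i. c (s i) k) \<longlonglongrightarrow> d k"
proof -
  obtain s where s: "strict_mono (s :: nat \<Rightarrow> nat)" "\<And>k. k \<in> UNIV \<Longrightarrow> \<exists>l. (\<lambda>i. c (s i) k) \<longlonglongrightarrow> l"
    using function_convergent_subsequence[of UNIV c 1] conj_seq_ball_norm_le_1[OF q c] by (metis countableI_type)
  then obtain d where d: "\<And>k. (\<lambda>i. c (s i) k) \<longlonglongrightarrow> d k" by (metis UNIV_I)
  have "d \<in> conj_seq_ball q"
  proof (rule conj_seq_ballI[OF q])
    fix n
    have "(\<lambda>i. \<Sum>k<n. norm (c (s i) k) powr (q / (q - 1))) \<longlonglongrightarrow> (\<Sum>k<n. norm (d k) powr (q / (q - 1)))"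
      using q d by (intro tendsto_sum tendsto_powr' tendsto_norm tendsto_const) auto
    then show "(\<Sum>k<n. norm (d k) powr (q / (q - 1))) \<le> 1"
      by (rule LIMSEQ_le_const2) (use conj_seq_ballD[OF q c] in auto)
  qed
  then show thesis using that s(1) d by blast
qed

context norming_space begin

text \<open>
  Hoelder's inequality for a section of the series, with a bound that does not depend on the
  coefficients.
\<close>

lemma functional_psum_diff_le:
  assumes p: "p \<ge> 1" and x: "range x \<subseteq> carrier X" and c: "c \<in> conj_seq_ball p" and f: "f \<in> dual_ball X"
    and B: "B \<ge> 0" "\<And>m. (\<Sum>k=n..<m. norm (f (x k)) powr p) \<le> B" and nm: "n \<le> m"
  shows "norm (f (psum X c x m) - f (psum X c x n)) \<le> B powr (1 / p)"
proof -
  have "f (psum X c x m) - f (psum X c x n) = (\<Sum>k=n..<m. c k * f (x k))"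
    using nm by (simp add: functional_psum[OF dual_ballD[OF f] x] sum_diff_nat_ivl lessThan_atLeast0)
  also have "norm \<dots> \<le> (\<Sum>k=n..<m. norm (c k) * norm (f (x k)))"
    by (intro order_trans[OF norm_sum]) (simp add: norm_mult)
  also have "\<dots> \<le> B powr (1 / p)"
    using p B by (intro conj_seq_ball_Hoelder[OF p c]) (auto simp: powr_powr)
  finally show ?thesis .
qed

lemma p_co_functional_le:
  assumes p: "p \<ge> 1" and x: "range x \<subseteq> carrier X" and z: "z \<in> p_co p X x" and f: "f \<in> dual_ball X"
    and B: "B \<ge> 0" "\<And>m. (\<Sum>k<m. norm (f (x k)) powr p) \<le> B powr p"
  shows "norm (f z) \<le> B"
proof -
  obtain c where z: "z \<in> carrier X" and c: "c \<in> conj_seq_ball p" "(\<lambda>n. nrm X (psum X c x n \<ominus> z)) \<longlonglongrightarrow> 0"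
    using z by (auto simp: p_co_altdef)
  have "(\<lambda>n. f (psum X c x n)) \<longlonglongrightarrow> f z"
    using c z x by (intro functional_LIMSEQ[OF f]) auto
  moreover have "norm (f (psum X c x n)) \<le> B" for n
  proof -
    have "norm (f (psum X c x n) - f (psum X c x 0)) \<le> (B powr p) powr (1 / p)"
      using B by (intro functional_psum_diff_le[OF p x c(1) f]) (auto simp: lessThan_atLeast0)
    moreover have "f (psum X c x 0) = 0" using functional_psum[OF dual_ballD[OF f] x, of c 0] by simp
    ultimately show ?thesis using p B by (simp add: powr_powr)
  qed
  ultimately show ?thesis by (intro LIMSEQ_le_const2[OF tendsto_norm]) auto
qed

lemma series_converges:
  assumes X: "banach_space X" and p: "p \<ge> 1" and x: "x \<in> lp_uncond p X" and c: "c \<in> conj_seq_ball p"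
  obtains z where "z \<in> carrier X" "(\<lambda>n. nrm X (psum X c x n \<ominus> z)) \<longlonglongrightarrow> 0"
proof -
  have xr: "range x \<subseteq> carrier X" using lp_uncondD(1)[OF p x] .
  have mono: "\<exists>N. \<forall>m\<ge>N. \<forall>n\<ge>N. n \<le> m \<longrightarrow> nrm X (psum X c x m \<ominus> psum X c x n) < e" if e: "e > 0" for e
  proof -
    obtain N where N: "\<And>f m. f \<in> dual_ball X \<Longrightarrow> (\<Sum>k=N..<m. norm (f (x k)) powr p) \<le> (e / 2) powr p"
      using lp_uncondD(2)[OF p x, of "(e / 2) powr p"] e by auto
    have "nrm X (psum X c x m \<ominus> psum X c x n) \<le> e / 2" if nm: "N \<le> n" "n \<le> m" for m n
    proof (rule nrm_leI)
      fix f assume f: "f \<in> dual_ball X"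
      have le: "(\<Sum>k=n..<m. norm (f (x k)) powr p) \<le> (e / 2) powr p" for m
        using N[OF f, of m] sum_mono2[of "{N..<m}" "{n..<m}" "\<lambda>k. norm (f (x k)) powr p"] nm by fastforce
      have "norm (f (psum X c x m) - f (psum X c x n)) \<le> ((e / 2) powr p) powr (1 / p)"
        using le nm by (intro functional_psum_diff_le[OF p xr c f]) auto
      then show "norm (f (psum X c x m \<ominus> psum X c x n)) \<le> e / 2"
        using e p xr by (simp add: functional_simps(4)[OF dual_ballD[OF f]] powr_powr)
    qed (use xr in \<open>simp add: M.minus_closed\<close>)
    then show ?thesis using e by (intro exI[of _ N]) fastforce
  qed
  have "\<exists>N. \<forall>m\<ge>N. \<forall>n\<ge>N. nrm X (psum X c x m \<ominus> psum X c x n) < e" if e: "e > 0" for e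
  proof -
    obtain N where N: "\<And>m n. \<lbrakk>m \<ge> N; n \<ge> N; n \<le> m\<rbrakk> \<Longrightarrow> nrm X (psum X c x m \<ominus> psum X c x n) < e"
      using mono[OF e] by blast
    have "nrm X (psum X c x m \<ominus> psum X c x n) < e" if "m \<ge> N" "n \<ge> N" for m n
      using N[of m n] N[of n m] that nrm_minus_commute[of "psum X c x m" "psum X c x n"] xr
      by (cases "n \<le> m") auto
    then show ?thesis by blast
  qed
  moreover have "range (psum X c x) \<subseteq> carrier X" using xr by auto
  ultimately show thesis using X that unfolding banach_space_iff by blast
qed

lemma p_co_abs_convex:
  assumes q: "q > 1" and x: "range x \<subseteq> carrier X" and u: "u \<in> p_co q X x" and v: "v \<in> p_co q X x"
    and ab: "norm a + norm b \<le> 1"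
  shows "a \<odot> u \<oplus> b \<odot> v \<in> p_co q X x"
proof -
  obtain c d where u: "u \<in> carrier X" "c \<in> conj_seq_ball q" "(\<lambda>n. nrm X (psum X c x n \<ominus> u)) \<longlonglongrightarrow> 0"
    and v: "v \<in> carrier X" "d \<in> conj_seq_ball q" "(\<lambda>n. nrm X (psum X d x n \<ominus> v)) \<longlonglongrightarrow> 0"
    using u v by (auto simp: p_co_altdef)
  define e where "e k = a * c k + b * d k" for k
  have e: "e \<in> conj_seq_ball q" unfolding e_def by (rule conj_seq_ball_abs_convex[OF q u(2) v(2) ab])
  have le: "nrm X (psum X e x n \<ominus> (a \<odot> u \<oplus> b \<odot> v))
      \<le> norm a * nrm X (psum X c x n \<ominus> u) + norm b * nrm X (psum X d x n \<ominus> v)" for n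
  proof (rule nrm_leI)
    fix f assume f: "f \<in> dual_ball X"
    note fs = functional_simps[OF dual_ballD[OF f]] functional_psum[OF dual_ballD[OF f] x]
    have "f (psum X e x n \<ominus> (a \<odot> u \<oplus> b \<odot> v)) = a * f (psum X c x n \<ominus> u) + b * f (psum X d x n \<ominus> v)"
      using u v x by (simp add: fs e_def algebra_simps sum.distrib sum_distrib_left)
    also have "norm \<dots> \<le> norm a * norm (f (psum X c x n \<ominus> u)) + norm b * norm (f (psum X d x n \<ominus> v))"
      by (intro order_trans[OF norm_triangle_ineq]) (simp add: norm_mult)
    also have "\<dots> \<le> norm a * nrm X (psum X c x n \<ominus> u) + norm b * nrm X (psum X d x n \<ominus> v)"
      using u v x by (intro add_mono mult_left_mono dual_ball_bound[OF f]) auto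
    finally show "norm (f (psum X e x n \<ominus> (a \<odot> u \<oplus> b \<odot> v))) \<le> \<dots>" .
  qed (use u v x in auto)
  have "(\<lambda>n. norm a * nrm X (psum X c x n \<ominus> u) + norm b * nrm X (psum X d x n \<ominus> v)) \<longlonglongrightarrow> norm a * 0 + norm b * 0"
    by (intro tendsto_intros u v)
  then have lim0: "(\<lambda>n. norm a * nrm X (psum X c x n \<ominus> u) + norm b * nrm X (psum X d x n \<ominus> v)) \<longlonglongrightarrow> 0"
    by simp
  have nn: "0 \<le> nrm X (psum X e x n \<ominus> (a \<odot> u \<oplus> b \<odot> v))" for n
    using u(1) v(1) x by (intro nrm_nonneg) auto
  have "(\<lambda>n. nrm X (psum X e x n \<ominus> (a \<odot> u \<oplus> b \<odot> v))) \<longlonglongrightarrow> 0"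
    by (rule Lim_null_comparison[OF _ lim0], rule always_eventually) (simp only: real_norm_def abs_of_nonneg[OF nn] le simp_thms)
  moreover have "a \<odot> u \<oplus> b \<odot> v \<in> carrier X" using u(1) v(1) by simp
  ultimately show ?thesis unfolding p_co_altdef using e by blast
qed

lemma p_co_bounded:
  assumes q: "q \<ge> 1" and x: "x \<in> lp_uncond q X"
  obtains M where "M \<ge> 0" "\<And>z. z \<in> p_co q X x \<Longrightarrow> nrm X z \<le> M"
proof -
  obtain R where R: "\<And>n. R n \<ge> 0"
    "\<And>f n m. f \<in> dual_ball X \<Longrightarrow> (\<Sum>k=n..<m. norm (f (x k)) powr q) \<le> R n"
    using lp_uncond_tail_bound[OF q x] by metis
  have xr: "range x \<subseteq> carrier X" using lp_uncondD(1)[OF q x] .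
  have "nrm X z \<le> R 0 powr (1 / q)" if z: "z \<in> p_co q X x" for z
  proof (rule nrm_leI)
    fix f assume f: "f \<in> dual_ball X"
    show "norm (f z) \<le> R 0 powr (1 / q)"
      using q R(1)[of 0] R(2)[OF f, of 0]
      by (intro p_co_functional_le[OF q xr z f]) (auto simp: powr_powr lessThan_atLeast0)
  qed (use z in \<open>simp add: p_co_def\<close>)
  then show thesis by (intro that[of "R 0 powr (1 / q)"]) auto
qed

text \<open>
  The coefficient sequences of the approximating points have a coordinatewise cluster point
  \<open>d\<close>. Tails of all series involved are uniformly small, so the series with coefficients \<open>d\<close>
  converges to the limit of the points.
\<close>

lemma p_co_closed:
  assumes X: "banach_space X" and q: "q > 1" and x: "x \<in> lp_uncond q X"
    and u: "\<And>i. u i \<in> p_co q X x" and z: "z \<in> carrier X" and lim: "(\<lambda>i::nat. nrm X (u i \<ominus> z)) \<longlonglongrightarrow> 0"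
  shows "z \<in> p_co q X x"
proof -
  have q1: "q \<ge> 1" using q by simp
  have xr: "range x \<subseteq> carrier X" using lp_uncondD(1)[OF q1 x] .
  obtain R where R: "R \<longlonglongrightarrow> 0" "\<And>n. R n \<ge> 0"
    "\<And>f n m. f \<in> dual_ball X \<Longrightarrow> (\<Sum>k=n..<m. norm (f (x k)) powr q) \<le> R n"
    using lp_uncond_tail_bound[OF q1 x] by metis
  have uc: "u i \<in> carrier X" for i using u by (auto simp: p_co_def)
  obtain c where c: "\<And>i. c i \<in> conj_seq_ball q" "\<And>i. (\<lambda>n. nrm X (psum X (c i) x n \<ominus> u i)) \<longlonglongrightarrow> 0"
  proof -
    have "\<forall>i. \<exists>c. c \<in> conj_seq_ball q \<and> (\<lambda>n. nrm X (psum X c x n \<ominus> u i)) \<longlonglongrightarrow> 0"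
      using u unfolding p_co_altdef by blast
    then show thesis using that unfolding choice_iff by blast
  qed
  obtain s d where s: "strict_mono (s :: nat \<Rightarrow> nat)" and d: "d \<in> conj_seq_ball q" "\<And>k. (\<lambda>i. c (s i) k) \<longlonglongrightarrow> d k"
    by (rule conj_seq_ball_cluster_point[of q c, OF q c(1)]) (rule that, assumption+)
  obtain w where w: "w \<in> carrier X" "(\<lambda>n. nrm X (psum X d x n \<ominus> w)) \<longlonglongrightarrow> 0"
    by (rule series_converges[OF X q1 x d(1)])
  have "z = w"
  proof (rule vec_eqI[OF z w(1)])
    fix f assume f: "f \<in> dual_ball X"
    note fp = functional_psum[OF dual_ballD[OF f] xr]
    have 1: "norm (f (u i) - f (psum X (c i) x n)) \<le> R n powr (1 / q)" for i n
    proof (rule LIMSEQ_le_const2)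
      show "(\<lambda>m. norm (f (psum X (c i) x m) - f (psum X (c i) x n))) \<longlonglongrightarrow> norm (f (u i) - f (psum X (c i) x n))"
        using c(2) uc xr by (intro tendsto_intros functional_LIMSEQ[OF f]) auto
      show "\<exists>N. \<forall>m\<ge>N. norm (f (psum X (c i) x m) - f (psum X (c i) x n)) \<le> R n powr (1 / q)"
        using functional_psum_diff_le[OF q1 xr c(1) f R(2) R(3)[OF f]] by blast
    qed
    have fu: "(\<lambda>i. f (u (s i))) \<longlonglongrightarrow> f z"
      using LIMSEQ_subseq_LIMSEQ[OF functional_LIMSEQ[OF f uc z lim] s] by (simp add: o_def)
    have 2: "norm (f z - f (psum X d x n)) \<le> R n powr (1 / q)" for n
    proof (rule LIMSEQ_le_const2)
      have "(\<lambda>i. f (psum X (c (s i)) x n)) \<longlonglongrightarrow> f (psum X d x n)"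
        unfolding fp by (intro tendsto_intros d)
      then show "(\<lambda>i. norm (f (u (s i)) - f (psum X (c (s i)) x n))) \<longlonglongrightarrow> norm (f z - f (psum X d x n))"
        by (intro tendsto_intros fu)
    qed (use 1 in blast)
    have "norm (f z - f w) \<le> 0"
    proof (rule LIMSEQ_le)
      show "(\<lambda>n. norm (f z - f (psum X d x n))) \<longlonglongrightarrow> norm (f z - f w)"
        using w xr by (intro tendsto_intros functional_LIMSEQ[OF f]) auto
      have "(\<lambda>n. R n powr (1 / q)) \<longlonglongrightarrow> 0 powr (1 / q)"
        using q R(2) by (intro tendsto_powr' R tendsto_const) auto
      then show "(\<lambda>n. R n powr (1 / q)) \<longlonglongrightarrow> 0" by simp
    qed (use 2 in blast)
    then show "f z = f w" by simp
  qed
  then show ?thesis unfolding p_co_altdef using w d(1) by blast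
qed

end

section \<open>The Banach space generated by a disk\<close>

text \<open>
  The span of a set \<open>D\<close> with its Minkowski functional as norm. The operations are those of \<open>X\<close>,
  so the elements stay in the same type.
\<close>

definition gauge_space :: "('k::real_normed_field, 'a) nspace \<Rightarrow> 'a set \<Rightarrow> ('k, 'a) nspace" where
  "gauge_space X D = X\<lparr>carrier := {x \<in> carrier X. \<exists>t>0. of_real (1 / t) \<odot>\<^bsub>X\<^esub> x \<in> D},
     nrm := (\<lambda>x. Inf {t. 0 < t \<and> of_real (1 / t) \<odot>\<^bsub>X\<^esub> x \<in> D})\<rparr>"

locale banach_disk = nvs X for X :: "('k::real_normed_field, 'a) nspace" (structure) +
  fixes D :: "'a set" and M :: real
  assumes banach: "banach_space X"
    and disk_subset: "D \<subseteq> carrier X" and disk_zero: "\<zero> \<in> D"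
    and disk_abs_convex: "\<lbrakk>u \<in> D; v \<in> D; norm a + norm b \<le> 1\<rbrakk> \<Longrightarrow> a \<odot> u \<oplus> b \<odot> v \<in> D"
    and disk_bounded: "u \<in> D \<Longrightarrow> nrm X u \<le> M" and M_pos: "M > 0"
    and disk_closed: "\<lbrakk>\<And>i. w i \<in> D; z \<in> carrier X; (\<lambda>i::nat. nrm X (w i \<ominus> z)) \<longlonglongrightarrow> 0\<rbrakk> \<Longrightarrow> z \<in> D"
begin

abbreviation (input) Z where "Z \<equiv> gauge_space X D"

lemma gauge_space_simps [simp]:
  "add Z = add X" "ring.zero Z = \<zero>" "smult Z = smult X"
  "carrier Z = {x \<in> carrier X. \<exists>t>0. of_real (1 / t) \<odot> x \<in> D}"
  "nrm Z x = Inf {t. 0 < t \<and> of_real (1 / t) \<odot> x \<in> D}"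
  by (simp_all add: gauge_space_def)

lemma gauge_carrier_subset: "x \<in> carrier Z \<Longrightarrow> x \<in> carrier X"
  by simp

lemma disk_balanced: "\<lbrakk>u \<in> D; norm a \<le> 1\<rbrakk> \<Longrightarrow> a \<odot> u \<in> D"
  using disk_abs_convex[of u u a 0] disk_subset by (auto simp: subset_iff)

lemma gauge_upward:
  assumes "of_real (1 / t) \<odot> x \<in> D" "0 < t" "t \<le> s" "x \<in> carrier X"
  shows "of_real (1 / s) \<odot> x \<in> D"
proof -
  have "norm (of_real (t / s) :: 'k) \<le> 1" using assms(2,3) by (simp only: norm_of_real) simp
  note disk_balanced[OF assms(1) this]
  moreover have "(of_real (t / s) * of_real (1 / t) :: 'k) = of_real (1 / s)"
  proof -
    have "t / s * (1 / t) = 1 / s" using assms(2,3) by simp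
    then show ?thesis by (metis of_real_mult)
  qed
  ultimately show ?thesis using assms(4) by (metis sm_mult)
qed

lemma gauge_le: "\<lbrakk>of_real (1 / t) \<odot> x \<in> D; 0 < t\<rbrakk> \<Longrightarrow> nrm Z x \<le> t"
  unfolding gauge_space_simps by (intro cInf_lower bdd_belowI[of _ 0]) auto

lemma gauge_lessD:
  assumes "x \<in> carrier Z" "nrm Z x < t"
  shows "of_real (1 / t) \<odot> x \<in> D" "0 < t"
proof -
  have ne: "{t. 0 < t \<and> of_real (1 / t) \<odot> x \<in> D} \<noteq> {}" using assms by auto
  have "\<exists>s\<in>{t. 0 < t \<and> of_real (1 / t) \<odot> x \<in> D}. s < t"
    using cInf_lessD[OF ne] assms(2) unfolding gauge_space_simps by blast
  then obtain s where "0 < s" "of_real (1 / s) \<odot> x \<in> D" "s < t"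
    by (simp del: of_real_divide) blast
  then show "of_real (1 / t) \<odot> x \<in> D" "0 < t" using assms gauge_upward[of s x t] by auto
qed

lemma gauge_nonneg: "x \<in> carrier Z \<Longrightarrow> nrm Z x \<ge> 0"
  unfolding gauge_space_simps by (intro cInf_greatest) auto

lemma gauge_carrierI: "\<lbrakk>x \<in> carrier X; 0 < t; of_real (1 / t) \<odot> x \<in> D\<rbrakk> \<Longrightarrow> x \<in> carrier Z"
  by auto

lemma gauge_leI:
  assumes "\<And>e. e > 0 \<Longrightarrow> nrm Z x \<le> B + e"
  shows "nrm Z x \<le> B"
  using assms by (rule field_le_epsilon)

lemma nrm_le_gauge:
  assumes x: "x \<in> carrier Z"
  shows "nrm X x \<le> M * nrm Z x"
proof (rule field_le_epsilon)
  fix e :: real assume e: "e > 0"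
  define t where "t = nrm Z x + e / M"
  have "nrm Z x < t" using e M_pos by (simp add: t_def del: gauge_space_simps)
  note t = gauge_lessD[OF x this]
  have "nrm X (of_real (1 / t) \<odot> x) \<le> M" using t by (intro disk_bounded)
  then have "nrm X x / t \<le> M" using t x by (simp add: nrm_smult norm_divide)
  then have "nrm X x \<le> M * t" using t by (simp add: divide_le_eq)
  then show "nrm X x \<le> M * nrm Z x + e" using M_pos by (simp add: t_def algebra_simps del: gauge_space_simps)
qed

lemma gauge_add:
  assumes "of_real (1 / t) \<odot> x \<in> D" "0 < t" "of_real (1 / s) \<odot> y \<in> D" "0 < s" "x \<in> carrier X" "y \<in> carrier X"
  shows "of_real (1 / (t + s)) \<odot> (x \<oplus> y) \<in> D"
proof -
  have "of_real (t / (t + s)) \<odot> (of_real (1 / t) \<odot> x) \<oplus> of_real (s / (t + s)) \<odot> (of_real (1 / s) \<odot> y) \<in> D"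
    using assms by (intro disk_abs_convex) (simp_all only: norm_of_real, simp_all add: add_divide_distrib[symmetric])
  then show ?thesis using assms by (simp add: sm_mult sm_add_right flip: of_real_mult)
qed

lemma gauge_smult:
  assumes "of_real (1 / t) \<odot> x \<in> D" "0 < t" "x \<in> carrier X" "a \<noteq> 0"
  shows "of_real (1 / (norm a * t)) \<odot> (a \<odot> x) \<in> D"
proof -
  have "norm (a / of_real (norm a)) \<le> 1" using assms(4) by (simp add: norm_divide)
  note disk_balanced[OF assms(1) this]
  moreover have "(a / of_real (norm a)) * of_real (1 / t) = of_real (1 / (norm a * t)) * a"
    by simp
  ultimately show ?thesis using assms(3) by (metis sm_mult)
qed

lemma gauge_carrier_zero: "\<zero> \<in> carrier Z"
  using disk_zero by (auto intro!: exI[of _ 1])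

lemma gauge_carrier_add: "\<lbrakk>x \<in> carrier Z; y \<in> carrier Z\<rbrakk> \<Longrightarrow> x \<oplus> y \<in> carrier Z"
  using gauge_add add_pos_pos by (auto simp del: of_real_divide) blast

lemma gauge_carrier_smult: "x \<in> carrier Z \<Longrightarrow> a \<odot> x \<in> carrier Z"
proof (cases "a = 0")
  case False
  assume x: "x \<in> carrier Z"
  then obtain t where "t > 0" "of_real (1 / t) \<odot> x \<in> D" by auto
  then show ?thesis using gauge_smult[of t x a] x False by (intro gauge_carrierI[of _ "norm a * t"]) auto
qed (use gauge_carrier_zero in simp)

lemma gauge_triangle:
  assumes "x \<in> carrier Z" "y \<in> carrier Z"
  shows "nrm Z (x \<oplus> y) \<le> nrm Z x + nrm Z y"
proof (rule gauge_leI)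
  fix e :: real assume e: "e > 0"
  have "nrm Z x < nrm Z x + e / 2" "nrm Z y < nrm Z y + e / 2" using e by simp_all
  note 1 = gauge_lessD[OF assms(1) this(1)] and 2 = gauge_lessD[OF assms(2) this(2)]
  have "nrm Z (x \<oplus> y) \<le> (nrm Z x + e / 2) + (nrm Z y + e / 2)"
    by (rule gauge_le[OF gauge_add[OF 1 2 assms[THEN gauge_carrier_subset]] add_pos_pos[OF 1(2) 2(2)]])
  then show "nrm Z (x \<oplus> y) \<le> nrm Z x + nrm Z y + e" by simp
qed

lemma gauge_smult_le:
  assumes x: "x \<in> carrier Z" and a: "a \<noteq> 0"
  shows "nrm Z (a \<odot> x) \<le> norm a * nrm Z x"
proof (rule gauge_leI)
  fix e :: real assume e: "e > 0"
  have "nrm Z x < nrm Z x + e / norm a" using e a by simp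
  note 1 = gauge_lessD[OF x this]
  have "nrm Z (a \<odot> x) \<le> norm a * (nrm Z x + e / norm a)"
    using 1(2) a by (intro gauge_le[OF gauge_smult[OF 1 gauge_carrier_subset[OF x] a]]) (auto simp del: gauge_space_simps)
  then show "nrm Z (a \<odot> x) \<le> norm a * nrm Z x + e" using a by (simp add: distrib_left del: gauge_space_simps)
qed

lemma gauge_zero: "nrm Z \<zero> = 0"
proof (rule antisym)
  show "nrm Z \<zero> \<le> 0" by (rule gauge_leI) (use disk_zero in \<open>auto intro!: gauge_le simp del: gauge_space_simps\<close>)
qed (rule gauge_nonneg[OF gauge_carrier_zero])

lemma gauge_smult_eq:
  assumes x: "x \<in> carrier Z"
  shows "nrm Z (a \<odot> x) = norm a * nrm Z x"
proof (cases "a = 0")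
  case True
  then show ?thesis using gauge_zero gauge_carrier_subset[OF x] by (simp del: gauge_space_simps)
next
  case False
  have "inverse a \<odot> (a \<odot> x) = x" using False gauge_carrier_subset[OF x] by (simp add: sm_mult del: gauge_space_simps)
  then have "nrm Z x \<le> norm (inverse a) * nrm Z (a \<odot> x)"
    using gauge_smult_le[OF gauge_carrier_smult[OF x, of a], of "inverse a"] False by simp
  then have "norm a * nrm Z x \<le> nrm Z (a \<odot> x)"
    using False by (simp add: norm_inverse norm_divide field_simps del: gauge_space_simps)
  then show ?thesis using gauge_smult_le[OF x False] by simp
qed

lemma nvs_gauge_space: "nvs Z"
proof -
  have "cring (scalar_space :: ('k, 'k) nspace)"
    using nvs_scalar_space[where 'k = 'k] by (simp add: nvs_def module_def)
  moreover have "abelian_group Z"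
  proof (rule abelian_groupI)
    fix x assume x: "x \<in> carrier Z"
    have "(- 1) \<odot> x \<in> carrier Z" using x by (rule gauge_carrier_smult)
    moreover have "(- 1) \<odot> x \<oplus> x = \<zero>"
      using gauge_carrier_subset[OF x] by (simp add: uminus_eq_sm[symmetric] M.l_neg del: gauge_space_simps)
    ultimately show "\<exists>y\<in>carrier Z. y \<oplus>\<^bsub>Z\<^esub> x = \<zero>\<^bsub>Z\<^esub>"
      unfolding gauge_space_simps(1,2) by blast
  qed (use gauge_carrier_zero gauge_carrier_add in \<open>simp_all add: M.a_ac del: gauge_space_simps(4,5)\<close>,
      auto simp: M.a_ac)
  ultimately have "module (scalar_space :: ('k, 'k) nspace) Z"
    using gauge_carrier_smult
    by (intro moduleI) (auto simp: sm_add_left sm_add_right sm_mult gauge_carrier_subset simp del: gauge_space_simps(4,5))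
  moreover have "nvs_axioms Z"
  proof (rule nvs_axioms.intro)
    fix x assume x: "x \<in> carrier Z"
    have "nrm Z x = 0 \<Longrightarrow> x = \<zero>"
      using nrm_le_gauge[OF x] gauge_carrier_subset[OF x] nrm_nonneg[OF gauge_carrier_subset[OF x]]
      by (simp add: nrm_eq_0_iff[symmetric] del: gauge_space_simps)
    then show "nrm Z x = 0 \<longleftrightarrow> x = \<zero>\<^bsub>Z\<^esub>" using gauge_zero unfolding gauge_space_simps(2) by blast
  next
    show "nrm Z (a \<odot>\<^bsub>Z\<^esub> x) = norm a * nrm Z x" if "x \<in> carrier Z" for a x
      using gauge_smult_eq[OF that] unfolding gauge_space_simps(3) .
    show "nrm Z (x \<oplus>\<^bsub>Z\<^esub> y) \<le> nrm Z x + nrm Z y" if "x \<in> carrier Z" "y \<in> carrier Z" for x y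
      using gauge_triangle[OF that] unfolding gauge_space_simps(1) .
  qed (rule gauge_nonneg)
  ultimately show ?thesis by (rule nvs.intro)
qed

lemma gauge_minus: "\<lbrakk>x \<in> carrier Z; y \<in> carrier Z\<rbrakk> \<Longrightarrow> x \<ominus>\<^bsub>Z\<^esub> y = x \<ominus> y"
  using nvs.minus_eq_sm[OF nvs_gauge_space, of x y] minus_eq_sm[of x y] by simp

text \<open>
  Closedness of the disk makes the infimum in the gauge attained: \<open>x / s\<close> lies in the disk for
  all \<open>s > t\<close>, and these points converge to \<open>x / t\<close>.
\<close>

lemma gauge_le_iff:
  assumes x: "x \<in> carrier X" and t: "t > 0"
  shows "x \<in> carrier Z \<and> nrm Z x \<le> t \<longleftrightarrow> of_real (1 / t) \<odot> x \<in> D"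
proof
  assume "of_real (1 / t) \<odot> x \<in> D"
  then show "x \<in> carrier Z \<and> nrm Z x \<le> t" using x t gauge_le gauge_carrierI by blast
next
  assume z: "x \<in> carrier Z \<and> nrm Z x \<le> t"
  define s where "s i = t + 1 / real (Suc i)" for i
  have s: "s i > t" for i by (simp add: s_def)
  have mem: "of_real (1 / s i) \<odot> x \<in> D" for i
    using z s[of i] by (intro gauge_lessD(1)) (auto simp del: gauge_space_simps)
  have "s \<longlonglongrightarrow> t + 0" unfolding s_def by (intro tendsto_intros LIMSEQ_Suc[OF lim_1_over_n])
  then have "(\<lambda>i. \<bar>1 / s i - 1 / t\<bar> * nrm X x) \<longlonglongrightarrow> \<bar>1 / (t + 0) - 1 / t\<bar> * nrm X x"
    using t by (intro tendsto_intros) auto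
  moreover have "nrm X (of_real (1 / s i) \<odot> x \<ominus> of_real (1 / t) \<odot> x) = \<bar>1 / s i - 1 / t\<bar> * nrm X x" for i
  proof -
    have "of_real (1 / s i) \<odot> x \<ominus> of_real (1 / t) \<odot> x = of_real (1 / s i - 1 / t) \<odot> x"
      using x sm_add_left[of x "of_real (1 / s i)" "- of_real (1 / t)"]
      by (simp add: minus_eq_sm sm_mult del: of_real_divide)
    then show ?thesis using x by (simp only: nrm_smult norm_of_real)
  qed
  ultimately have "(\<lambda>i. nrm X (of_real (1 / s i) \<odot> x \<ominus> of_real (1 / t) \<odot> x)) \<longlonglongrightarrow> 0" by simp
  then show "of_real (1 / t) \<odot> x \<in> D" by (intro disk_closed[OF mem]) (use x in auto)
qed

lemma unit_ball_gauge_space: "unit_ball Z = D"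
proof -
  have "x \<in> unit_ball Z \<longleftrightarrow> x \<in> D" for x
    using gauge_le_iff[of x 1] disk_subset gauge_carrier_subset[of x]
    by (auto simp: unit_ball_def simp del: gauge_space_simps)
  then show ?thesis by blast
qed

text \<open>
  A Cauchy sequence for the gauge converges in the norm of \<open>X\<close>. The differences \<open>u n - u m\<close> lie
  in \<open>e D\<close> for large indices, and since \<open>e D\<close> is closed, letting \<open>m\<close> tend to infinity shows that the
  convergence also holds in the gauge.
\<close>

lemma banach_gauge_space: "banach_space Z"
  unfolding nvs.banach_space_iff[OF nvs_gauge_space]
proof (intro allI impI)
  fix u :: "nat \<Rightarrow> 'a"
  assume uZ: "range u \<subseteq> carrier Z" and cauchy: "\<forall>e>0. \<exists>N. \<forall>m\<ge>N. \<forall>n\<ge>N. nrm Z (u m \<ominus>\<^bsub>Z\<^esub> u n) < e"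
  have u: "u n \<in> carrier Z" for n using uZ by auto
  note uX = gauge_carrier_subset[OF u]
  have dZ: "u m \<ominus> u n \<in> carrier Z" for m n
    using u[of m] gauge_carrier_smult[OF u[of n], of "-1"] uX
    by (simp add: minus_eq_sm gauge_carrier_add del: gauge_space_simps)
  have cauchy': "\<exists>N. \<forall>m\<ge>N. \<forall>n\<ge>N. nrm Z (u m \<ominus> u n) < e" if "e > 0" for e
    using cauchy that by (simp only: gauge_minus[OF u u])
  have "\<exists>N. \<forall>m\<ge>N. \<forall>n\<ge>N. nrm X (u m \<ominus> u n) < e" if e: "e > 0" for e
  proof -
    obtain N where N: "\<And>m n. m \<ge> N \<Longrightarrow> n \<ge> N \<Longrightarrow> nrm Z (u m \<ominus> u n) < e / M"
      using cauchy'[of "e / M"] e M_pos by auto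
    have "nrm X (u m \<ominus> u n) < e" if "m \<ge> N" "n \<ge> N" for m n
      using nrm_le_gauge[OF dZ, of m n] N[OF that] M_pos
      by (simp add: less_divide_eq mult.commute del: gauge_space_simps)
    then show ?thesis by blast
  qed
  moreover have "range u \<subseteq> carrier X" using uX by auto
  ultimately obtain z where z: "z \<in> carrier X" "(\<lambda>n. nrm X (u n \<ominus> z)) \<longlonglongrightarrow> 0"
    using banach unfolding banach_space_iff by blast
  have close: "\<exists>N. \<forall>n\<ge>N. u n \<ominus> z \<in> carrier Z \<and> nrm Z (u n \<ominus> z) \<le> e" if e: "e > 0" for e
  proof -
    obtain N where N: "\<And>m n. m \<ge> N \<Longrightarrow> n \<ge> N \<Longrightarrow> nrm Z (u m \<ominus> u n) < e"
      using cauchy'[OF e] by blast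
    have "u n \<ominus> z \<in> carrier Z \<and> nrm Z (u n \<ominus> z) \<le> e" if n: "n \<ge> N" for n
    proof -
      have "of_real (1 / e) \<odot> (u n \<ominus> z) \<in> D"
      proof (rule disk_closed)
        show "of_real (1 / e) \<odot> (u n \<ominus> u (i + N)) \<in> D" for i
          using N[of n "i + N"] n dZ by (intro gauge_lessD(1)) auto
        have "nrm X (of_real (1 / e) \<odot> (u n \<ominus> u (i + N)) \<ominus> of_real (1 / e) \<odot> (u n \<ominus> z))
            = (1 / e) * nrm X (u (i + N) \<ominus> z)" for i
        proof -
          let ?a = "of_real (1 / e) :: 'k"
          have "?a \<odot> (u n \<ominus> u (i + N)) \<ominus> ?a \<odot> (u n \<ominus> z) = ?a \<odot> ((u n \<ominus> u (i + N)) \<ominus> (u n \<ominus> z))"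
            using uX z by (simp add: minus_eq_sm sm_add_right sm_mult del: of_real_divide gauge_space_simps)
          also have "(u n \<ominus> u (i + N)) \<ominus> (u n \<ominus> z) = (z \<ominus> u (i + N))"
            using uX z by (simp add: a_minus_def M.minus_add M.a_ac M.r_neg1 M.r_neg2 del: gauge_space_simps)
          finally show ?thesis using e z uX
            by (simp add: nrm_smult nrm_minus_commute[of z] norm_divide del: gauge_space_simps)
        qed
        moreover have "(\<lambda>i. (1 / e) * nrm X (u (i + N) \<ominus> z)) \<longlonglongrightarrow> (1 / e) * 0"
          by (intro tendsto_mult tendsto_const LIMSEQ_ignore_initial_segment z)
        ultimately show "(\<lambda>i. nrm X (of_real (1 / e) \<odot> (u n \<ominus> u (i + N)) \<ominus> of_real (1 / e) \<odot> (u n \<ominus> z))) \<longlonglongrightarrow> 0"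
          by simp
      qed (use uX z in \<open>auto simp del: gauge_space_simps\<close>)
      then show ?thesis using gauge_le_iff[of "u n \<ominus> z" e] e uX z by (auto simp del: gauge_space_simps)
    qed
    then show ?thesis by blast
  qed
  obtain N where "u N \<ominus> z \<in> carrier Z" using close[of 1] by (metis order_refl zero_less_one)
  then have "u N \<oplus> (- 1) \<odot> (u N \<ominus> z) \<in> carrier Z" by (intro gauge_carrier_add gauge_carrier_smult u)
  also have "u N \<oplus> (- 1) \<odot> (u N \<ominus> z) = z"
    using uX z by (simp add: uminus_eq_sm[symmetric] a_minus_def M.minus_add M.r_neg2 del: gauge_space_simps)
  finally have zZ: "z \<in> carrier Z" .
  have "(\<lambda>n. nrm Z (u n \<ominus>\<^bsub>Z\<^esub> z)) \<longlonglongrightarrow> 0"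
  proof (rule LIMSEQ_I)
    fix e :: real assume e: "e > 0"
    obtain N where "\<And>n. n \<ge> N \<Longrightarrow> u n \<ominus> z \<in> carrier Z \<and> nrm Z (u n \<ominus> z) \<le> e / 2"
      using close[of "e / 2"] e by auto
    then have "norm (nrm Z (u n \<ominus>\<^bsub>Z\<^esub> z) - 0) < e" if "n \<ge> N" for n
      using that e gauge_nonneg[of "u n \<ominus> z"] gauge_minus[OF u zZ, of n]
      by (fastforce simp del: gauge_space_simps)
    then show "\<exists>no. \<forall>n\<ge>no. norm (nrm Z (u n \<ominus>\<^bsub>Z\<^esub> z) - 0) < e" by blast
  qed
  then show "\<exists>z\<in>carrier Z. (\<lambda>n. nrm Z (u n \<ominus>\<^bsub>Z\<^esub> z)) \<longlonglongrightarrow> 0" using zZ by blast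
qed

end

section \<open>Rescaling\<close>

text \<open>
  The classical argument of Abel and Dini: if \<open>T\<close> and \<open>T'\<close> are consecutive tails, then
  \<open>T - T' = (\<surd>T - \<surd>T') (\<surd>T + \<surd>T') \<le> 2 (\<surd>T - \<surd>T') \<surd>s\<close>, and the right-hand sides telescope after
  division by \<open>\<surd>s\<close>.
\<close>

lemma sum_div_sqrt_tail_le:
  fixes t s :: "nat \<Rightarrow> real"
  assumes t: "\<And>k. t k \<ge> 0" and s: "\<And>k. s k > 0" and le: "\<And>k. (\<Sum>i=k..<m. t i) \<le> s k" and nm: "n \<le> m"
  shows "(\<Sum>k=n..<m. t k / sqrt (s k)) \<le> 2 * sqrt (\<Sum>i=n..<m. t i)"
proof -
  define T where "T k = (\<Sum>i=k..<m. t i)" for k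
  have T0: "T k \<ge> 0" for k by (simp add: T_def sum_nonneg t)
  have "t k / sqrt (s k) \<le> 2 * (sqrt (T k) - sqrt (T (Suc k)))" if k: "k < m" for k
  proof -
    have eq: "t k = T k - T (Suc k)" using k by (simp add: T_def sum.atLeast_Suc_lessThan)
    then have mono: "T (Suc k) \<le> T k" using t[of k] by simp
    have "t k = (sqrt (T k) - sqrt (T (Suc k))) * (sqrt (T k) + sqrt (T (Suc k)))"
      using T0 by (simp add: eq algebra_simps)
    also have "\<dots> \<le> (sqrt (T k) - sqrt (T (Suc k))) * (2 * sqrt (s k))"
    proof (rule mult_left_mono)
      have "sqrt (T k) \<le> sqrt (s k)" using le[of k] by (simp add: T_def)
      moreover have "sqrt (T (Suc k)) \<le> sqrt (T k)" using mono by simp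
      ultimately show "sqrt (T k) + sqrt (T (Suc k)) \<le> 2 * sqrt (s k)" by linarith
    qed (use mono in simp)
    finally show ?thesis using s[of k] by (simp add: divide_le_eq mult_ac)
  qed
  then have "(\<Sum>k=n..<m. t k / sqrt (s k)) \<le> (\<Sum>k=n..<m. 2 * (sqrt (T k) - sqrt (T (Suc k))))"
    by (intro sum_mono) auto
  also have "\<dots> = 2 * (sqrt (T n) - sqrt (T m))"
    using sum_Suc_diff'[OF nm, of "\<lambda>k. - 2 * sqrt (T k)"] by (simp add: algebra_simps)
  also have "\<dots> \<le> 2 * sqrt (T n)" using T0[of m] by simp
  finally show ?thesis by (simp add: T_def)
qed

text \<open>
  The factor \<open>1 / \<beta> k\<close> is essentially the power \<open>- 1 / (2 q)\<close> of the uniform tail bound \<open>R k\<close>. It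
  increases the \<open>q\<close>-th powers of the terms by \<open>1 / \<surd>(R k)\<close>, which by the preceding lemma leaves
  tails of order \<open>\<surd>(R n)\<close>.
\<close>

lemma (in nvs) lp_uncond_rescale:
  assumes q: "q \<ge> 1" and x: "x \<in> lp_uncond q X"
  obtains \<beta> :: "nat \<Rightarrow> real" where "\<And>k. 0 < \<beta> k" "\<And>k. \<beta> k \<le> 1" "antimono \<beta>" "\<beta> \<longlonglongrightarrow> 0"
    "(\<lambda>k. of_real (1 / \<beta> k) \<odot> x k) \<in> lp_uncond q X"
proof -
  have xr: "range x \<subseteq> carrier X" using lp_uncondD(1)[OF q x] .
  then have xk: "x k \<in> carrier X" for k by auto
  obtain R where R: "antimono R" "R \<longlonglongrightarrow> 0" "\<And>n. R n \<ge> 0"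
    "\<And>f n m. f \<in> dual_ball X \<Longrightarrow> (\<Sum>k=n..<m. norm (f (x k)) powr q) \<le> R n"
    using lp_uncond_tail_bound[OF q x] by metis
  \<comment> \<open>The summand \<open>1 / (k + 1)\<close> keeps the scaling factors positive when the tails vanish.\<close>
  define s where "s k = R k + 1 / real (Suc k)" for k
  have s0: "s k > 0" for k using R(3)[of k] by (simp add: s_def add_nonneg_pos)
  have s_anti: "s m \<le> s n" if "n \<le> m" for m n
    using antimonoD[OF R(1) that] that by (auto simp: s_def intro!: add_mono frac_le)
  define \<kappa> where "\<kappa> = max 1 (s 0)"
  have \<kappa>: "\<kappa> \<ge> 1" "s k \<le> \<kappa>" for k using s_anti[of 0 k] by (auto simp: \<kappa>_def)
  define \<beta> where "\<beta> k = (s k / \<kappa>) powr (1 / (2 * q))" for k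
  have \<beta>0: "\<beta> k > 0" for k using s0[of k] \<kappa>(1) by (simp add: \<beta>_def)
  have \<beta>q: "\<beta> k powr q = sqrt (s k) / sqrt \<kappa>" for k
    using q s0[of k] \<kappa>(1) by (simp add: \<beta>_def powr_powr powr_half_sqrt real_sqrt_divide)
  have \<beta>1: "\<beta> k \<le> 1" for k
    using q s0[of k] \<kappa>(1) \<kappa>(2)[of k] by (auto simp: \<beta>_def intro!: powr_le1)
  have \<beta>anti: "antimono \<beta>"
    using q s0 \<kappa>(1) s_anti by (auto simp: \<beta>_def less_imp_le intro!: antimonoI powr_mono2 divide_right_mono)
  have "s \<longlonglongrightarrow> 0 + 0" unfolding s_def by (intro tendsto_add R LIMSEQ_Suc[OF lim_1_over_n])
  then have "(\<lambda>k. (s k / \<kappa>) powr (1 / (2 * q))) \<longlonglongrightarrow> ((0 + 0) / \<kappa>) powr (1 / (2 * q))"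
    using q \<kappa>(1) s0 by (intro tendsto_powr' tendsto_divide tendsto_const) (auto simp: less_imp_le)
  then have \<beta>lim: "\<beta> \<longlonglongrightarrow> 0" by (simp add: \<beta>_def[abs_def])
  have "(\<lambda>k. of_real (1 / \<beta> k) \<odot> x k) \<in> lp_uncond q X"
  proof (rule lp_uncondI[OF q])
    show "range (\<lambda>k. of_real (1 / \<beta> k) \<odot> x k) \<subseteq> carrier X" using xk by auto
    fix e :: real assume e: "e > 0"
    have "(\<lambda>n. sqrt \<kappa> * (2 * sqrt (R n))) \<longlonglongrightarrow> sqrt \<kappa> * (2 * sqrt 0)"
      by (intro tendsto_intros R)
    then have "eventually (\<lambda>n. sqrt \<kappa> * (2 * sqrt (R n)) < e) sequentially"
      using e by (intro order_tendstoD(2)) auto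
    then obtain N where N: "sqrt \<kappa> * (2 * sqrt (R N)) < e" by (auto simp: eventually_sequentially)
    have "(\<Sum>k=N..<m. norm (f (of_real (1 / \<beta> k) \<odot> x k)) powr q) \<le> e" if f: "f \<in> dual_ball X" for f m
    proof (cases "N \<le> m")
      case True
      have fb: "f \<in> bounded_ops X scalar_space" using f by (simp add: dual_ball_def)
      have "norm (f (of_real (1 / \<beta> k) \<odot> x k)) powr q = sqrt \<kappa> * (norm (f (x k)) powr q / sqrt (s k))" for k
        using \<beta>0[of k] xk by (simp add: functional_simps(2)[OF fb] norm_mult norm_divide powr_divide \<beta>q)
      then have "(\<Sum>k=N..<m. norm (f (of_real (1 / \<beta> k) \<odot> x k)) powr q)
          = sqrt \<kappa> * (\<Sum>k=N..<m. norm (f (x k)) powr q / sqrt (s k))"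
        by (simp add: sum_distrib_left)
      also have "\<dots> \<le> sqrt \<kappa> * (2 * sqrt (\<Sum>k=N..<m. norm (f (x k)) powr q))"
      proof (intro mult_left_mono sum_div_sqrt_tail_le s0 True)
        show "(\<Sum>i=k..<m. norm (f (x i)) powr q) \<le> s k" for k
          using R(4)[OF f, of k m] by (simp add: s_def add_increasing2)
      qed (use \<kappa> in auto)
      also have "\<dots> \<le> sqrt \<kappa> * (2 * sqrt (R N))"
        using R(4)[OF f] \<kappa>(1) by (intro mult_left_mono real_sqrt_le_mono) auto
      finally show ?thesis using N by simp
    qed (use e in simp)
    then show "\<exists>N. \<forall>f\<in>dual_ball X. \<forall>m. (\<Sum>k=N..<m. norm (f (of_real (1 / \<beta> k) \<odot> x k)) powr q) \<le> e"
      by blast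
  qed
  then show thesis using that \<beta>0 \<beta>1 \<beta>anti \<beta>lim by blast
qed

section \<open>Copies of finite-dimensional sequence spaces in spaces with a smaller exponent\<close>

text \<open>
  A two-sided geometric series, bounded independently of its starting point. The function
  \<open>v / (1 + v)\<close> increases from \<open>0\<close> to \<open>1\<close>, and its increment from \<open>v\<close> to \<open>r v\<close> is at least a constant
  times \<open>min v (1/v)\<close>; the sum of the increments telescopes.
\<close>

lemma sum_min_geometric_le:
  fixes u r :: real
  assumes "u > 0" and "r > 1"
  shows "(\<Sum>j<J. min (u * r ^ j) (1 / (u * r ^ j))) \<le> 4 * r / (r - 1)"
proof -
  define \<Phi> where "\<Phi> j = u * r ^ j / (1 + u * r ^ j)" for j
  have pos: "u * r ^ j > 0" for j
    using assms by simp
  have step: "min (u * r ^ j) (1 / (u * r ^ j)) \<le> 4 * r / (r - 1) * (\<Phi> (Suc j) - \<Phi> j)" for j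
  proof -
    define v where "v = u * r ^ j"
    have v: "v > 0" using pos v_def by simp
    have "\<Phi> (Suc j) - \<Phi> j = r * v / (1 + r * v) - v / (1 + v)"
      by (simp add: \<Phi>_def v_def mult_ac)
    also have "\<dots> = v * (r - 1) / ((1 + v) * (1 + r * v))"
    proof -
      have "1 + v > 0" "1 + r * v > 0" using v assms by (auto intro: add_pos_pos mult_pos_pos)
      then have "1 + v \<noteq> 0" "1 + r * v \<noteq> 0" by simp_all
      then show ?thesis by (simp add: diff_frac_eq) (simp add: algebra_simps)
    qed
    also have "\<dots> \<ge> v * (r - 1) / ((1 + v) * (r * (1 + v)))"
      using v assms by (intro divide_left_mono mult_left_mono mult_pos_pos) (auto simp: algebra_simps add_pos_pos)
    finally have 1: "\<Phi> (Suc j) - \<Phi> j \<ge> (r - 1) / r * (v / (1 + v)^2)"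
      by (simp add: power2_eq_square mult_ac)
    have 2: "min v (1 / v) \<le> 4 * (v / (1 + v)^2)"
    proof (cases "v \<le> 1")
      case True
      have "(1 + v)^2 \<le> 2^2" using True v by (intro power_mono) auto
      then have "v * (1 + v)^2 \<le> v * 4" using v by (intro mult_left_mono) auto
      then have "v \<le> 4 * (v / (1 + v)^2)" using v by (simp add: pos_le_divide_eq)
      then show ?thesis by simp
    next
      case False
      have "(1 + v)^2 \<le> (2 * v)^2" using False v by (intro power_mono) auto
      then have "1 / v \<le> 4 * (v / (1 + v)^2)" using v by (simp add: field_simps power2_eq_square)
      then show ?thesis by simp
    qed
    have "min v (1 / v) \<le> 4 * r / (r - 1) * ((r - 1) / r * (v / (1 + v)^2))"
      using 2 assms by simp
    also have "\<dots> \<le> 4 * r / (r - 1) * (\<Phi> (Suc j) - \<Phi> j)"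
      using 1 assms by (intro mult_left_mono) auto
    finally show ?thesis unfolding v_def .
  qed
  have "(\<Sum>j<J. min (u * r ^ j) (1 / (u * r ^ j))) \<le> (\<Sum>j<J. 4 * r / (r - 1) * (\<Phi> (Suc j) - \<Phi> j))"
    by (intro sum_mono step)
  also have "\<dots> = 4 * r / (r - 1) * (\<Phi> J - \<Phi> 0)"
    by (simp only: sum_distrib_left [symmetric] sum_lessThan_telescope)
  also have "\<dots> \<le> 4 * r / (r - 1) * 1"
  proof (intro mult_left_mono)
    have "\<Phi> J \<le> 1" "\<Phi> 0 \<ge> 0"
      using pos[of J] pos[of 0] assms(1) unfolding \<Phi>_def by (simp_all add: divide_le_eq_1)
    then show "\<Phi> J - \<Phi> 0 \<le> 1" by simp
  qed (use assms in auto)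
  finally show ?thesis by simp
qed

text \<open>
  A symmetric random variable on \<open>{-J..J}\<close>: the points \<open>\<plusminus>j\<close> have total mass \<open>2\<^sup>-\<^sup>j\<close> and carry the
  values \<open>\<plusminus> 2\<^sup>j\<^sup>/\<^sup>q\<close>, so large values \<open>t\<close> occur with probability of order \<open>t\<^sup>-\<^sup>q\<close>. The mass left over at
  \<open>0\<close> makes the total mass \<open>1\<close>.
\<close>

definition site_weight :: "nat \<Rightarrow> int \<Rightarrow> real" where
  "site_weight J i = (if i = 0 then (1/2) ^ J else (1/2) ^ nat \<bar>i\<bar> / 2)"

definition site_value :: "real \<Rightarrow> int \<Rightarrow> real" where
  "site_value q i = sgn (real_of_int i) * 2 powr (real_of_int \<bar>i\<bar> / q)"

lemma site_weight_pos: "site_weight J i > 0"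
  by (simp add: site_weight_def)

lemma site_weight_uminus [simp]: "site_weight J (- i) = site_weight J i"
  by (simp add: site_weight_def)

lemma site_value_uminus [simp]: "site_value q (- i) = - site_value q i"
  by (simp add: site_value_def)

lemma sum_symmetric_interval:
  fixes f :: "int \<Rightarrow> 'v::comm_monoid_add"
  shows "(\<Sum>i\<in>{- int J..int J}. f i) = f 0 + (\<Sum>j=1..J. f (int j) + f (- int j))"
proof (induction J)
  case (Suc J)
  have "{- int (Suc J)..int (Suc J)} = insert (int (Suc J)) (insert (- int (Suc J)) {- int J..int J})"
    by auto
  then have "(\<Sum>i\<in>{- int (Suc J)..int (Suc J)}. f i)
     = f (int (Suc J)) + (f (- int (Suc J)) + (\<Sum>i\<in>{- int J..int J}. f i))"
    by (subst sum.insert | simp)+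
  then show ?case using Suc by (simp add: ac_simps)
qed simp

lemma sum_site_weight_even:
  fixes G :: "int \<Rightarrow> real"
  assumes "\<And>i. G (- i) = G i"
  shows "(\<Sum>i\<in>{- int J..int J}. site_weight J i * G i)
       = (1/2)^J * G 0 + (\<Sum>j=1..J. (1/2)^j * G (int j))"
  unfolding sum_symmetric_interval
  by (auto simp: site_weight_def assms intro!: sum.cong)

lemma sum_site_weight: "(\<Sum>i\<in>{- int J..int J}. site_weight J i) = 1"
proof -
  have "(1/2)^J + (\<Sum>j=1..J. (1/2)^j) = (1::real)"
    by (induction J) auto
  then show ?thesis using sum_site_weight_even[of "\<lambda>_. 1" J] by simp
qed

text \<open>
  \<open>N\<close> independent copies of the variable above, realized on a finite product space.
\<close>

definition configs :: "nat \<Rightarrow> nat \<Rightarrow> (nat \<Rightarrow> int) set" where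
  "configs J N = (PiE {..<N} (\<lambda>_. {- int J..int J}))"

definition config_weight :: "nat \<Rightarrow> nat \<Rightarrow> (nat \<Rightarrow> int) \<Rightarrow> real" where
  "config_weight J N \<omega> = (\<Prod>n<N. site_weight J (\<omega> n))"

lemma finite_configs: "finite (configs J N)"
  by (auto simp: configs_def intro: finite_PiE)

lemma config_weight_pos: "config_weight J N \<omega> > 0"
  by (simp add: config_weight_def prod_pos site_weight_pos)

lemma config_weight_prod:
  fixes g :: "nat \<Rightarrow> int \<Rightarrow> real"
  shows "(\<Sum>\<omega>\<in>configs J N. config_weight J N \<omega> * (\<Prod>n<N. g n (\<omega> n)))
       = (\<Prod>n<N. \<Sum>i\<in>{- int J..int J}. site_weight J i * g n i)"
  unfolding config_weight_def configs_def
  by (simp add: prod_sum_PiE prod.distrib)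

lemma config_weight_marginal:
  fixes g :: "int \<Rightarrow> real"
  assumes "n < N"
  shows "(\<Sum>\<omega>\<in>configs J N. config_weight J N \<omega> * g (\<omega> n))
       = (\<Sum>i\<in>{- int J..int J}. site_weight J i * g i)"
proof -
  have 1: "(\<Prod>k<N. (if k = n then f k else 1)) = f n" for f :: "nat \<Rightarrow> real"
    using assms by (simp add: prod.delta)
  have "(\<Sum>\<omega>\<in>configs J N. config_weight J N \<omega> * g (\<omega> n))
      = (\<Sum>\<omega>\<in>configs J N. config_weight J N \<omega> * (\<Prod>k<N. (if k = n then g (\<omega> k) else 1)))"
    by (simp add: 1)
  also have "\<dots> = (\<Prod>k<N. \<Sum>i\<in>{- int J..int J}. site_weight J i * (if k = n then g i else 1))"
    by (rule config_weight_prod)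
  also have "\<dots> = (\<Prod>k<N. (if k = n then \<Sum>i\<in>{- int J..int J}. site_weight J i * g i else 1))"
    by (intro prod.cong) (auto simp: sum_site_weight)
  also have "\<dots> = (\<Sum>i\<in>{- int J..int J}. site_weight J i * g i)"
    by (rule 1)
  finally show ?thesis .
qed

lemma sum_config_weight: "(\<Sum>\<omega>\<in>configs J N. config_weight J N \<omega>) = 1"
  using config_weight_prod[of J N "\<lambda>_ _. 1"] by (simp add: sum_site_weight)

text \<open>
  Changing the sign of one coordinate preserves the product measure. This kills all mixed
  terms below.
\<close>

lemma config_weight_odd:
  fixes G :: "(nat \<Rightarrow> int) \<Rightarrow> 'v::real_vector"
  assumes n: "n < N" and odd: "\<And>\<omega>. \<omega> \<in> configs J N \<Longrightarrow> G (fun_upd \<omega> n (- \<omega> n)) = - G \<omega>"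
  shows "(\<Sum>\<omega>\<in>configs J N. config_weight J N \<omega> *\<^sub>R G \<omega>) = 0"
proof -
  let ?flip = "\<lambda>\<omega>::nat \<Rightarrow> int. fun_upd \<omega> n (- \<omega> n)"
  have closed: "?flip \<omega> \<in> configs J N" if "\<omega> \<in> configs J N" for \<omega>
    using that n by (auto simp: configs_def PiE_def Pi_def extensional_def)
  have weight: "config_weight J N (?flip \<omega>) = config_weight J N \<omega>" for \<omega>
    unfolding config_weight_def by (intro prod.cong) auto
  have "(\<Sum>\<omega>\<in>configs J N. config_weight J N \<omega> *\<^sub>R G \<omega>)
      = (\<Sum>\<omega>\<in>configs J N. config_weight J N \<omega> *\<^sub>R G (?flip \<omega>))"
    by (rule sum.reindex_bij_witness[of _ ?flip ?flip]) (auto simp: closed weight)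
  also have "\<dots> = - (\<Sum>\<omega>\<in>configs J N. config_weight J N \<omega> *\<^sub>R G \<omega>)"
    by (simp add: odd sum_negf)
  finally have "2 *\<^sub>R (\<Sum>\<omega>\<in>configs J N. config_weight J N \<omega> *\<^sub>R G \<omega>) = 0"
    by (simp add: scaleR_2 eq_neg_iff_add_eq_0)
  then show ?thesis by simp
qed

text \<open>
  Only the case in which the sum \<open>T\<close> of squares exceeds \<open>1\<close> needs an argument: write \<open>T\<^sup>p\<^sup>/\<^sup>2\<close> as the
  sum of \<open>(s n)\<^sup>2 T\<^sup>p\<^sup>/\<^sup>2\<^sup>-\<^sup>1\<close> and use that the exponent \<open>p/2 - 1\<close> is not positive, with \<open>T \<ge> 1\<close> and
  \<open>T \<ge> (s n)\<^sup>2\<close>.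
\<close>

lemma powr_half_sum_squares_le:
  fixes s :: "nat \<Rightarrow> real"
  assumes p: "0 < p" "p \<le> 2" and s: "\<And>n. s n \<ge> 0"
  shows "(\<Sum>n<N. (s n)\<^sup>2) powr (p / 2) \<le> 1 + (\<Sum>n<N. min ((s n)\<^sup>2) (s n powr p))"
proof -
  define T where "T = (\<Sum>n<N. (s n)\<^sup>2)"
  have T0: "T \<ge> 0" unfolding T_def by (simp add: sum_nonneg)
  have nn: "(\<Sum>n<N. min ((s n)\<^sup>2) (s n powr p)) \<ge> 0"
    by (intro sum_nonneg) simp
  show ?thesis
  proof (cases "T \<le> 1")
    case True
    then have "T powr (p / 2) \<le> 1" using T0 p by (intro powr_le1) auto
    then show ?thesis using nn T_def by simp
  next
    case False
    have "T powr (p / 2) = T * T powr (p / 2 - 1)"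
      using False by (simp add: powr_diff)
    also have "\<dots> = (\<Sum>n<N. (s n)\<^sup>2 * T powr (p / 2 - 1))"
      by (simp add: T_def sum_distrib_right)
    also have "\<dots> \<le> (\<Sum>n<N. min ((s n)\<^sup>2) (s n powr p))"
    proof (intro sum_mono)
      fix n assume n: "n \<in> {..<N}"
      have a: "T powr (p / 2 - 1) \<le> 1"
        using False p powr_mono[of "p/2 - 1" 0 T] by simp
      have le: "(s n)\<^sup>2 \<le> T" unfolding T_def using n by (intro member_le_sum) auto
      have b: "(s n)\<^sup>2 * T powr (p / 2 - 1) \<le> s n powr p"
      proof (cases "s n = 0")
        case False
        then have sp: "s n > 0" using s[of n] by simp
        have "T powr (p / 2 - 1) \<le> ((s n)\<^sup>2) powr (p / 2 - 1)"
          using le p sp by (intro powr_mono2') auto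
        then have "(s n)\<^sup>2 * T powr (p / 2 - 1) \<le> (s n)\<^sup>2 * ((s n)\<^sup>2) powr (p / 2 - 1)"
          by (intro mult_left_mono) auto
        also have "\<dots> = ((s n)\<^sup>2) powr (p / 2)"
          using sp by (simp add: powr_diff)
        also have "\<dots> = s n powr p"
          using sp by (simp add: powr_powr flip: powr_numeral)
        finally show ?thesis .
      qed simp
      show "(s n)\<^sup>2 * T powr (p / 2 - 1) \<le> min ((s n)\<^sup>2) (s n powr p)"
        using a b by (simp add: mult_left_le)
    qed
    finally show ?thesis unfolding T_def by simp
  qed
qed

lemma powr_le_two_point:
  fixes t \<sigma> p :: real
  assumes "0 \<le> t" "0 < \<sigma>" "0 < p" "p \<le> 2"
  shows "t powr p \<le> \<sigma> powr (p / 2) + \<sigma> powr (p / 2 - 1) * t\<^sup>2"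
proof -
  define r where "r = t\<^sup>2 / \<sigma>"
  have r: "r \<ge> 0" using assms r_def by simp
  have "r powr (p / 2) \<le> 1 + r"
  proof (cases "r \<le> 1")
    case True
    then have "r powr (p / 2) \<le> 1" using r assms by (intro powr_le1) auto
    then show ?thesis using r by simp
  next
    case False
    then have "r powr (p / 2) \<le> r powr 1" using assms by (intro powr_mono) auto
    then show ?thesis using False by simp
  qed
  then have "\<sigma> powr (p / 2) * r powr (p / 2) \<le> \<sigma> powr (p / 2) * (1 + r)"
    by (intro mult_left_mono) auto
  moreover have "\<sigma> powr (p / 2) * r powr (p / 2) = t powr p"
  proof (cases "t = 0")
    case False
    have "\<sigma> powr (p / 2) * r powr (p / 2) = (t\<^sup>2) powr (p / 2)"
      using assms r by (simp add: r_def flip: powr_mult)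
    also have "\<dots> = t powr p"
      using assms False by (simp add: powr_powr flip: powr_numeral)
    finally show ?thesis .
  qed (use r_def in simp)
  moreover have "\<sigma> powr (p / 2) * (1 + r) = \<sigma> powr (p / 2) + \<sigma> powr (p / 2 - 1) * t\<^sup>2"
    using assms by (simp add: r_def powr_diff algebra_simps)
  ultimately show ?thesis by simp
qed

text \<open>
  The easy half of Khintchine's inequality with a crude constant. The square function \<open>\<sigma>\<close>
  depends only on the absolute values, so the signs make the summands orthogonal even with the
  weight \<open>\<sigma>\<^sup>p\<^sup>/\<^sup>2\<^sup>-\<^sup>1\<close>, and the two-point estimate \<open>powr_le_two_point\<close> turns the \<open>p\<close>-th moment into a
  weighted second moment.
\<close>

lemma config_moment_le_square_function:
  fixes a :: "nat \<Rightarrow> 'v::real_inner"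
  assumes p: "0 < p" "p \<le> 2"
  shows "(\<Sum>\<omega>\<in>configs J N. config_weight J N \<omega> * norm (\<Sum>n<N. site_value q (\<omega> n) *\<^sub>R a n) powr p)
    \<le> 2 * (\<Sum>\<omega>\<in>configs J N. config_weight J N \<omega> *
            (\<Sum>n<N. (\<bar>site_value q (\<omega> n)\<bar> * norm (a n))\<^sup>2) powr (p / 2))"
proof -
  define h where "h = site_value q"
  define \<sigma> where "\<sigma> \<omega> = (\<Sum>n<N. (\<bar>h (\<omega> n)\<bar> * norm (a n))\<^sup>2)" for \<omega>
  define f where "f \<omega> = (\<Sum>n<N. h (\<omega> n) *\<^sub>R a n)" for \<omega>
  define w where "w \<omega> = \<sigma> \<omega> powr (p / 2 - 1)" for \<omega>
  have \<sigma>0: "\<sigma> \<omega> \<ge> 0" for \<omega> unfolding \<sigma>_def by (simp add: sum_nonneg)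
  have pt: "norm (f \<omega>) powr p \<le> \<sigma> \<omega> powr (p / 2) + w \<omega> * (norm (f \<omega>))\<^sup>2" for \<omega>
  proof (cases "\<sigma> \<omega> = 0")
    case True
    then have "\<forall>n\<in>{..<N}. h (\<omega> n) *\<^sub>R a n = 0"
      unfolding \<sigma>_def by (subst (asm) sum_nonneg_eq_0_iff) auto
    then have "f \<omega> = 0" unfolding f_def by (intro sum.neutral) auto
    then show ?thesis by simp
  next
    case False
    then show ?thesis using powr_le_two_point[of "norm (f \<omega>)" "\<sigma> \<omega>" p] p \<sigma>0[of \<omega>] w_def by simp
  qed
  have cross: "(\<Sum>\<omega>\<in>configs J N. config_weight J N \<omega> * (w \<omega> * (h (\<omega> n) * h (\<omega> m) * inner (a n) (a m))))
     = (if n = m then (\<Sum>\<omega>\<in>configs J N. config_weight J N \<omega> * (w \<omega> * (\<bar>h (\<omega> n)\<bar> * norm (a n))\<^sup>2)) else 0)"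
    if nm: "n < N" "m < N" for n m
  proof (cases "n = m")
    case True
    then show ?thesis
      by (auto simp: power_mult_distrib power2_norm_eq_inner power2_eq_square[of "h _"] mult_ac intro!: sum.cong)
  next
    case False
    have "\<sigma> (fun_upd \<omega> n (- \<omega> n)) = \<sigma> \<omega>" for \<omega>
      unfolding \<sigma>_def by (intro sum.cong) (auto simp: h_def)
    then have "w (fun_upd \<omega> n (- \<omega> n)) = w \<omega>" for \<omega>
      by (simp add: w_def)
    then show ?thesis
      using False config_weight_odd[OF nm(1), of J "\<lambda>\<omega>. w \<omega> * (h (\<omega> n) * h (\<omega> m) * inner (a n) (a m))"]
      by (auto simp: h_def)
  qed
  have sq: "(norm (f \<omega>))\<^sup>2 = (\<Sum>n<N. \<Sum>m<N. h (\<omega> n) * h (\<omega> m) * inner (a n) (a m))" for \<omega>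
    unfolding power2_norm_eq_inner f_def
    by (simp add: inner_sum_left inner_sum_right sum_distrib_left inner_commute mult_ac)
  have "(\<Sum>\<omega>\<in>configs J N. config_weight J N \<omega> * (w \<omega> * (norm (f \<omega>))\<^sup>2))
      = (\<Sum>n<N. \<Sum>m<N. \<Sum>\<omega>\<in>configs J N. config_weight J N \<omega> * (w \<omega> * (h (\<omega> n) * h (\<omega> m) * inner (a n) (a m))))"
    unfolding sq sum_distrib_left
    by (subst sum.swap, intro sum.cong[OF refl], subst sum.swap) simp
  also have "\<dots> = (\<Sum>n<N. \<Sum>\<omega>\<in>configs J N. config_weight J N \<omega> * (w \<omega> * (\<bar>h (\<omega> n)\<bar> * norm (a n))\<^sup>2))"
    by (simp add: cross)
  also have "\<dots> = (\<Sum>\<omega>\<in>configs J N. config_weight J N \<omega> * (w \<omega> * \<sigma> \<omega>))"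
    unfolding \<sigma>_def sum_distrib_left by (rule sum.swap)
  also have "\<dots> = (\<Sum>\<omega>\<in>configs J N. config_weight J N \<omega> * \<sigma> \<omega> powr (p / 2))"
  proof -
    have "w \<omega> * \<sigma> \<omega> = \<sigma> \<omega> powr (p / 2)" for \<omega>
      using \<sigma>0[of \<omega>] by (cases "\<sigma> \<omega> = 0") (simp_all add: w_def powr_diff)
    then show ?thesis by simp
  qed
  finally have var: "(\<Sum>\<omega>\<in>configs J N. config_weight J N \<omega> * (w \<omega> * (norm (f \<omega>))\<^sup>2))
     = (\<Sum>\<omega>\<in>configs J N. config_weight J N \<omega> * \<sigma> \<omega> powr (p / 2))" .
  have "(\<Sum>\<omega>\<in>configs J N. config_weight J N \<omega> * norm (f \<omega>) powr p)
     \<le> (\<Sum>\<omega>\<in>configs J N. config_weight J N \<omega> * (\<sigma> \<omega> powr (p / 2) + w \<omega> * (norm (f \<omega>))\<^sup>2))"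
    by (intro sum_mono mult_left_mono pt) (simp add: config_weight_pos less_imp_le)
  also have "\<dots> = 2 * (\<Sum>\<omega>\<in>configs J N. config_weight J N \<omega> * \<sigma> \<omega> powr (p / 2))"
    by (simp add: distrib_left sum.distrib var)
  finally show ?thesis unfolding f_def \<sigma>_def h_def .
qed

text \<open>
  Write \<open>h\<close> for the absolute value of the variable. Values of \<open>h t\<close> below \<open>1\<close> are measured by their
  square and values above \<open>1\<close> by their \<open>p\<close>-th power. Since \<open>p < q < 2\<close>, the contribution of the
  level \<open>j\<close> decays geometrically on both sides of the level at which \<open>2\<^sup>j t\<^sup>q = 1\<close>, and there it is
  \<open>t\<^sup>q\<close>.
\<close>

lemma site_min_moment_le:
  fixes p q :: real
  assumes p: "1 \<le> p" "p < q" and q: "q < 2"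
  obtains K where "K > 0"
    "\<And>J t. t \<ge> 0 \<Longrightarrow> (\<Sum>i\<in>{- int J..int J}. site_weight J i *
        min ((\<bar>site_value q i\<bar> * t)\<^sup>2) ((\<bar>site_value q i\<bar> * t) powr p)) \<le> K * t powr q"
proof -
  define \<gamma> where "\<gamma> = min (2 / q - 1) (1 - p / q)"
  have \<gamma>: "\<gamma> > 0" "\<gamma> \<le> 2 / q - 1" "\<gamma> \<le> 1 - p / q" using p q by (auto simp: \<gamma>_def)
  define r where "r = 2 powr \<gamma>"
  have r: "r > 1" using \<gamma> by (simp add: r_def)
  show thesis
  proof
    show "4 * r / (r - 1) > 0" using r by simp
    fix J :: nat and t :: real assume t: "t \<ge> 0"
    show "(\<Sum>i\<in>{- int J..int J}. site_weight J i *
        min ((\<bar>site_value q i\<bar> * t)\<^sup>2) ((\<bar>site_value q i\<bar> * t) powr p)) \<le> 4 * r / (r - 1) * t powr q"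
    proof (cases "t = 0")
      case False
      then have tp: "t > 0" using t by simp
      define A where "A = t powr q"
      have A: "A > 0" using tp A_def by simp
      define u where "u = A powr \<gamma>"
      have u: "u > 0" using A u_def by simp
      let ?G = "\<lambda>i. min ((\<bar>site_value q i\<bar> * t)\<^sup>2) ((\<bar>site_value q i\<bar> * t) powr p)"
      have summand: "(1/2)^j * ?G (int j) \<le> A * min (u * r ^ j) (1 / (u * r ^ j))" if j: "j \<ge> 1" for j
      proof -
        define B where "B = A * 2 ^ j"
        have B: "B > 0" using A B_def by simp
        have ur: "u * r ^ j = B powr \<gamma>"
          using A by (simp add: u_def r_def B_def powr_mult powr_powr mult.commute flip: powr_realpow)
        have val: "\<bar>site_value q (int j)\<bar> * t = B powr (1 / q)"
          using tp j p by (simp add: site_value_def B_def A_def powr_mult powr_powr abs_mult flip: powr_realpow)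
        have half: "(1/2)^j = A / B" using A by (simp add: B_def power_one_over)
        have sq: "A / B * (B powr (1 / q))\<^sup>2 = A * B powr (2 / q - 1)"
          using B by (simp add: powr_diff powr_powr flip: powr_numeral)
        have pw: "A / B * (B powr (1 / q)) powr p = A * B powr (p / q - 1)"
          using B by (simp add: powr_diff powr_powr)
        have le: "min (B powr (2 / q - 1)) (B powr (p / q - 1)) \<le> min (B powr \<gamma>) (1 / B powr \<gamma>)"
        proof (cases "B \<le> 1")
          case True
          have "B powr (2 / q - 1) \<le> B powr \<gamma>" using True B \<gamma> by (intro powr_mono') auto
          moreover have "B powr \<gamma> \<le> 1" using True B \<gamma> by (intro powr_le1) auto
          then have "B powr \<gamma> \<le> 1 / B powr \<gamma>" using B by (simp add: field_simps mult_le_one)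
          ultimately show ?thesis by simp
        next
          case False
          have "B powr (p / q - 1) \<le> B powr (- \<gamma>)" using False \<gamma> by (intro powr_mono) auto
          moreover have "B powr (- \<gamma>) = 1 / B powr \<gamma>" by (simp add: powr_minus_divide)
          moreover have "B powr \<gamma> \<ge> 1" using False \<gamma> by (intro ge_one_powr_ge_zero) auto
          then have "1 / B powr \<gamma> \<le> 1" using B by (simp add: divide_le_eq)
          with \<open>B powr \<gamma> \<ge> 1\<close> have "1 / B powr \<gamma> \<le> B powr \<gamma>" by linarith
          ultimately show ?thesis by simp
        qed
        have "(1/2)^j * ?G (int j) = min (A * B powr (2 / q - 1)) (A * B powr (p / q - 1))"
          unfolding val half using A B by (simp add: min_mult_distrib_left sq pw del: times_divide_eq_left)
        also have "\<dots> = A * min (B powr (2 / q - 1)) (B powr (p / q - 1))"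
          using A by (simp add: min_mult_distrib_left)
        also have "\<dots> \<le> A * min (B powr \<gamma>) (1 / B powr \<gamma>)"
          using A le by (intro mult_left_mono) auto
        finally show ?thesis by (simp add: ur)
      qed
      have "(\<Sum>i\<in>{- int J..int J}. site_weight J i * ?G i) = (1/2)^J * ?G 0 + (\<Sum>j=1..J. (1/2)^j * ?G (int j))"
        by (rule sum_site_weight_even) simp
      also have "\<dots> = (\<Sum>j=1..J. (1/2)^j * ?G (int j))"
        using p by (simp add: site_value_def)
      also have "\<dots> \<le> (\<Sum>j=1..J. A * min (u * r ^ j) (1 / (u * r ^ j)))"
        by (intro sum_mono summand) auto
      also have "\<dots> \<le> (\<Sum>j<Suc J. A * min (u * r ^ j) (1 / (u * r ^ j)))"
        using A u r by (intro sum_mono2) auto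
      also have "\<dots> \<le> A * (4 * r / (r - 1))"
        unfolding sum_distrib_left [symmetric] by (intro mult_left_mono sum_min_geometric_le u r less_imp_le[OF A])
      finally show ?thesis by (simp add: A_def mult.commute)
    qed (use p in simp)
  qed
qed

text \<open>
  The upper half of the embedding of \<open>\<ell>\<^sup>q\<close>. It is stated with \<open>1 + \<dots>\<close> instead of a homogeneous
  right-hand side; homogeneity is restored later by scaling.
\<close>

lemma config_moment_le:
  fixes p q :: real
  assumes p: "1 \<le> p" "p < q" and q: "q < 2"
  obtains K where "K > 0"
    "\<And>J N (a :: nat \<Rightarrow> 'v::real_inner).
      (\<Sum>\<omega>\<in>configs J N. config_weight J N \<omega> * norm (\<Sum>n<N. site_value q (\<omega> n) *\<^sub>R a n) powr p)
        \<le> K * (1 + (\<Sum>n<N. norm (a n) powr q))"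
proof -
  obtain K where K: "K > 0"
    "\<And>J t. t \<ge> 0 \<Longrightarrow> (\<Sum>i\<in>{- int J..int J}. site_weight J i *
        min ((\<bar>site_value q i\<bar> * t)\<^sup>2) ((\<bar>site_value q i\<bar> * t) powr p)) \<le> K * t powr q"
    using site_min_moment_le[OF assms] by blast
  show thesis
  proof
    show "2 * (1 + K) > 0" using K by simp
    fix J N and a :: "nat \<Rightarrow> 'v"
    let ?s = "\<lambda>\<omega> n. \<bar>site_value q (\<omega> n)\<bar> * norm (a n)"
    let ?m = "\<lambda>n i. min ((\<bar>site_value q i\<bar> * norm (a n))\<^sup>2) ((\<bar>site_value q i\<bar> * norm (a n)) powr p)"
    have S0: "(\<Sum>n<N. norm (a n) powr q) \<ge> 0" by (simp add: sum_nonneg)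
    have "(\<Sum>\<omega>\<in>configs J N. config_weight J N \<omega> * norm (\<Sum>n<N. site_value q (\<omega> n) *\<^sub>R a n) powr p)
      \<le> 2 * (\<Sum>\<omega>\<in>configs J N. config_weight J N \<omega> * (\<Sum>n<N. (?s \<omega> n)\<^sup>2) powr (p / 2))"
      using p q by (intro config_moment_le_square_function) auto
    also have "\<dots> \<le> 2 * (\<Sum>\<omega>\<in>configs J N. config_weight J N \<omega> * (1 + (\<Sum>n<N. ?m n (\<omega> n))))"
      using p q by (intro mult_left_mono sum_mono powr_half_sum_squares_le) (auto simp: config_weight_pos less_imp_le)
    also have "(\<Sum>\<omega>\<in>configs J N. config_weight J N \<omega> * (1 + (\<Sum>n<N. ?m n (\<omega> n))))
       = 1 + (\<Sum>n<N. \<Sum>\<omega>\<in>configs J N. config_weight J N \<omega> * ?m n (\<omega> n))"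
      unfolding distrib_left sum.distrib sum_distrib_left
      by (subst sum.swap) (simp add: sum_config_weight)
    also have "(\<Sum>n<N. \<Sum>\<omega>\<in>configs J N. config_weight J N \<omega> * ?m n (\<omega> n))
       = (\<Sum>n<N. \<Sum>i\<in>{- int J..int J}. site_weight J i * ?m n i)"
      by (intro sum.cong refl config_weight_marginal) auto
    also have "2 * (1 + \<dots>) \<le> 2 * (1 + (\<Sum>n<N. K * norm (a n) powr q))"
      by (intro mult_left_mono add_left_mono sum_mono K) auto
    also have "\<dots> = 2 + 2 * K * (\<Sum>n<N. norm (a n) powr q)"
      by (simp add: sum_distrib_left mult.assoc)
    also have "\<dots> \<le> 2 * (1 + K) * (1 + (\<Sum>n<N. norm (a n) powr q))"
      using S0 K(1) by (simp add: algebra_simps)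
    finally show "(\<Sum>\<omega>\<in>configs J N. config_weight J N \<omega> * norm (\<Sum>n<N. site_value q (\<omega> n) *\<^sub>R a n) powr p)
        \<le> 2 * (1 + K) * (1 + (\<Sum>n<N. norm (a n) powr q))" .
  qed
qed

lemma ex_dyadic_scale:
  fixes t :: real
  assumes t: "0 \<le> t" "t \<le> 1" and J: "J \<ge> 1"
  obtains k :: nat where "1 \<le> k" "k \<le> J" "(1/2)^k \<le> t / 4 + (1/2)^J" "t \<le> 8 * (1/2)^k"
proof -
  define m where "m = max (t / 4) ((1/2)^J)"
  define k where "k = (LEAST k. (1/2)^k \<le> m)"
  have ex: "(1/2)^J \<le> m" by (simp add: m_def)
  have k1: "(1/2)^k \<le> m" unfolding k_def using ex by (rule LeastI)
  have kJ: "k \<le> J" unfolding k_def using ex by (rule Least_le)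
  have "(1/2)^J \<le> (1/2::real)^1" using J by (intro power_decreasing) auto
  then have m1: "m < 1" using t by (simp add: m_def)
  have k0: "k \<noteq> 0" using k1 m1 by (intro notI) simp
  have "\<not> (1/2)^(k - 1) \<le> m" unfolding k_def using k0 k_def by (intro not_less_Least) simp
  moreover have "(1/2::real)^(k - 1) = 2 * (1/2)^k" using k0 by (cases k) auto
  ultimately have "t / 4 \<le> 2 * (1/2)^k" by (simp add: m_def)
  then have "t \<le> 8 * (1/2)^k" by simp
  moreover have "(1/2)^k \<le> t / 4 + (1/2)^J"
  proof -
    have "m \<le> t / 4 + (1/2)^J" using t unfolding m_def by simp
    then show ?thesis using k1 by linarith
  qed
  ultimately show thesis using that[of k] k0 kJ by simp
qed

lemma one_minus_sum_le_prod:
  fixes b :: "nat \<Rightarrow> real"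
  assumes "finite A" "\<And>n. n \<in> A \<Longrightarrow> 0 \<le> b n \<and> b n \<le> 1"
  shows "1 - (\<Sum>n\<in>A. b n) \<le> (\<Prod>n\<in>A. 1 - b n)"
  using assms
proof (induction A rule: finite_induct)
  case (insert x A)
  have "(\<Prod>n\<in>A. 1 - b n) \<le> 1" using insert by (intro prod_le_1) auto
  then have "b x * (\<Prod>n\<in>A. 1 - b n) \<le> b x" using insert by (simp add: mult_left_le)
  then show ?case using insert by (simp add: algebra_simps)
qed simp

text \<open>
  The lower half of the embedding of \<open>\<ell>\<^sup>q\<close>, in dual form: every \<open>a\<close> in the unit ball of \<open>\<ell>\<^sup>q\<^sup>'\<close> is the
  sequence of coefficients \<open>E[h n b]\<close> of an explicit bounded function \<open>b\<close>; here \<open>E\<close> is the mean for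
  the product measure and \<open>h n\<close> the value of the \<open>n\<close>-th variable. Choose the level \<open>k n\<close> with \<open>2\<^sup>-\<^sup>k\<^sup>n\<close>
  about \<open>\<bar>a n\<bar>\<^sup>q\<^sup>' / 4\<close>, or the lowest level \<open>J\<close> if that is too small; on the event that coordinate
  \<open>n\<close> is at this level (up to sign) and no other coordinate is at its own level, let \<open>b\<close> be a
  multiple of the sign of \<open>a n\<close> times the sign of the coordinate. These events are disjoint,
  hence \<open>b\<close> is bounded as soon as the multiples are. In \<open>E[h n b]\<close> the contributions of the other
  coordinates cancel by symmetry. The contribution of coordinate \<open>n\<close> with multiple \<open>1\<close> is
  \<open>2\<^sup>-\<^sup>k\<^sup>n 2\<^sup>k\<^sup>n\<^sup>/\<^sup>q\<close> times the probability that no other coordinate is at its level. The first factor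
  is at least a constant times \<open>\<bar>a n\<bar>\<close>, and the second is at least \<open>1/2\<close>; so bounded multiples
  suffice.
\<close>

lemma bounded_config_lift:
  fixes a :: "nat \<Rightarrow> 'v::real_normed_vector" and q :: real
  assumes q: "q > 1" and J: "4 * real N \<le> 2 ^ J" "J \<ge> 1"
    and a: "(\<Sum>n<N. norm (a n) powr (q / (q - 1))) \<le> 1"
  obtains b where "\<And>\<omega>. norm (b \<omega>) \<le> 16"
    "\<And>n. n < N \<Longrightarrow> (\<Sum>\<omega>\<in>configs J N. (config_weight J N \<omega> * site_value q (\<omega> n)) *\<^sub>R b \<omega>) = a n"
proof -
  define r where "r = q / (q - 1)"
  have r: "r > 1" "1 / r = 1 - 1 / q" using q by (auto simp: r_def field_simps)
  have ar: "norm (a n) powr r \<le> 1" if "n < N" for n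
  proof -
    have "norm (a n) powr r \<le> (\<Sum>n<N. norm (a n) powr r)" using that by (intro member_le_sum) auto
    then show ?thesis using a by (simp add: r_def)
  qed
  have "\<exists>k\<ge>1. k \<le> J \<and> (n < N \<longrightarrow> (1/2)^k \<le> norm (a n) powr r / 4 + (1/2)^J \<and> norm (a n) powr r \<le> 8 * (1/2)^k)" for n
  proof (cases "n < N")
    case True
    then show ?thesis using ex_dyadic_scale[of "norm (a n) powr r" J] ar[of n] J(2) by auto
  qed (use J in auto)
  then obtain k where k: "\<And>n. k n \<ge> 1" "\<And>n. k n \<le> J"
    "\<And>n. n < N \<Longrightarrow> (1/2)^(k n) \<le> norm (a n) powr r / 4 + (1/2)^J"
    "\<And>n. n < N \<Longrightarrow> norm (a n) powr r \<le> 8 * (1/2)^(k n)"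
    by metis
  define P where "P n = (\<Prod>m\<in>{..<N} - {n}. 1 - (1/2::real)^(k m))" for n
  \<comment> \<open>\<open>P n\<close> is the probability that no coordinate other than \<open>n\<close> is at its level, and \<open>e n\<close> is the value of \<open>E[h n b]\<close> for the multiple \<open>1\<close>.\<close>
  define e where "e n = (1/2)^(k n) * 2 powr (real (k n) / q) * P n" for n
  have sumk: "(\<Sum>n<N. (1/2::real)^(k n)) \<le> 1/2"
  proof -
    have "(\<Sum>n<N. (1/2::real)^(k n)) \<le> (\<Sum>n<N. norm (a n) powr r / 4 + (1/2)^J)"
      by (intro sum_mono k) auto
    also have "\<dots> = (\<Sum>n<N. norm (a n) powr r) / 4 + real N * (1/2)^J"
      by (simp add: sum.distrib sum_divide_distrib)
    also have "real N * (1/2)^J \<le> 1/4"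
      using J(1) by (simp add: field_simps power_one_over)
    also have "(\<Sum>n<N. norm (a n) powr r) / 4 + 1/4 \<le> 1/2"
      using a by (simp add: r_def)
    finally show ?thesis by simp
  qed
  have P: "P n \<ge> 1/2" for n
  proof -
    have "(\<Sum>m\<in>{..<N} - {n}. (1/2::real)^(k m)) \<le> (\<Sum>m<N. (1/2::real)^(k m))"
      by (intro sum_mono2) auto
    moreover have "1 - (\<Sum>m\<in>{..<N} - {n}. (1/2::real)^(k m)) \<le> P n"
      unfolding P_def by (intro one_minus_sum_le_prod) (auto simp: power_le_one)
    ultimately show ?thesis using sumk by simp
  qed
  have e_pos: "e n > 0" for n using P[of n] by (simp add: e_def)
  have c: "norm (a n) / e n \<le> 16" if n: "n < N" for n
  proof -
    have "norm (a n) = (norm (a n) powr r) powr (1 / r)" using r(1) by (simp add: powr_powr)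
    also have "\<dots> \<le> (8 * (1/2)^(k n)) powr (1 / r)" using k(4)[OF n] r(1) by (intro powr_mono2) auto
    also have "\<dots> = 8 powr (1 / r) * ((1/2)^(k n)) powr (1 / r)" by (simp add: powr_mult)
    also have "((1/2)^(k n)) powr (1 / r) = (1/2)^(k n) * 2 powr (real (k n) / q)"
      unfolding r(2) by (simp add: powr_diff power_one_over powr_divide powr_powr flip: powr_realpow)
    also have "8 powr (1 / r) * ((1/2)^(k n) * 2 powr (real (k n) / q)) \<le> 8 * ((1/2)^(k n) * 2 powr (real (k n) / q))"
      using r q powr_mono[of "1/r" 1 "8::real"] by (intro mult_right_mono) auto
    also have "\<dots> \<le> 8 * ((1/2)^(k n) * 2 powr (real (k n) / q)) * (2 * P n)"
      using P[of n] mult_left_mono[of 1 "2 * P n" "8 * ((1/2)^(k n) * 2 powr (real (k n) / q))"] by simp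
    also have "\<dots> = 16 * e n" by (simp add: e_def)
    finally show ?thesis using e_pos[of n] by (simp add: field_simps)
  qed
  define E where "E n \<omega> \<longleftrightarrow> \<bar>\<omega> n\<bar> = int (k n) \<and> (\<forall>m\<in>{..<N} - {n}. \<bar>\<omega> m\<bar> \<noteq> int (k m))" for n and \<omega> :: "nat \<Rightarrow> int"
  define \<beta> where "\<beta> n \<omega> = norm (a n) / e n * sgn (real_of_int (\<omega> n)) * of_bool (E n \<omega>)" for n \<omega>
  define b where "b \<omega> = (\<Sum>n<N. \<beta> n \<omega> *\<^sub>R sgn (a n))" for \<omega>
  show thesis
  proof
    fix \<omega>
    show "norm (b \<omega>) \<le> 16"
    proof (cases "\<exists>n<N. E n \<omega>")
      case True
      then obtain n where n: "n < N" "E n \<omega>" by blast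
      have "\<beta> m \<omega> = 0" if "m < N" "m \<noteq> n" for m
        using n that by (auto simp: \<beta>_def E_def)
      then have "b \<omega> = \<beta> n \<omega> *\<^sub>R sgn (a n)"
        unfolding b_def using n by (subst sum.remove[of _ n]) (auto intro!: sum.neutral)
      then have "norm (b \<omega>) \<le> \<bar>\<beta> n \<omega>\<bar>" by (simp add: norm_sgn)
      also have "\<dots> \<le> norm (a n) / e n"
        using e_pos[of n] by (simp add: \<beta>_def abs_mult abs_sgn_eq)
      also have "\<dots> \<le> 16" using c n by simp
      finally show ?thesis .
    next
      case False
      then have "b \<omega> = 0" unfolding b_def by (intro sum.neutral) (auto simp: \<beta>_def)
      then show ?thesis by simp
    qed
  next
    fix n assume n: "n < N"
    have off: "(\<Sum>\<omega>\<in>configs J N. config_weight J N \<omega> * (site_value q (\<omega> n) * \<beta> m \<omega>)) = 0"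
      if m: "m \<noteq> n" for m
    proof -
      have "\<beta> m (fun_upd \<omega> n (- \<omega> n)) = \<beta> m \<omega>" for \<omega>
      proof -
        have "E m (fun_upd \<omega> n (- \<omega> n)) = E m \<omega>" using m by (auto simp: E_def)
        then show ?thesis using m by (simp add: \<beta>_def)
      qed
      then show ?thesis
        using config_weight_odd[OF n, of J "\<lambda>\<omega>. site_value q (\<omega> n) * \<beta> m \<omega>"] by simp
    qed
    define g where "g m i = (if m = n then \<bar>site_value q i\<bar> * of_bool (\<bar>i\<bar> = int (k n)) else of_bool (\<bar>i\<bar> \<noteq> int (k m)))" for m i
    have E_prod: "\<bar>site_value q (\<omega> n)\<bar> * of_bool (E n \<omega>) = (\<Prod>m<N. g m (\<omega> m))" for \<omega>
    proof -
      have "(\<Prod>m<N. g m (\<omega> m)) = g n (\<omega> n) * (\<Prod>m\<in>{..<N} - {n}. g m (\<omega> m))"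
        using n by (subst prod.remove[of _ n]) auto
      also have "(\<Prod>m\<in>{..<N} - {n}. g m (\<omega> m)) = (\<Prod>m\<in>{..<N} - {n}. of_bool (\<bar>\<omega> m\<bar> \<noteq> int (k m)))"
        by (intro prod.cong) (auto simp: g_def)
      also have "\<dots> = of_bool (\<forall>m\<in>{..<N} - {n}. \<bar>\<omega> m\<bar> \<noteq> int (k m))"
        by (cases "\<forall>m\<in>{..<N} - {n}. \<bar>\<omega> m\<bar> \<noteq> int (k m)") (auto intro!: prod.neutral bexI)
      finally show ?thesis by (auto simp: g_def E_def)
    qed
    have site_n: "(\<Sum>i\<in>{- int J..int J}. site_weight J i * g n i) = (1/2)^(k n) * 2 powr (real (k n) / q)"
    proof -
      have "(\<Sum>i\<in>{- int J..int J}. site_weight J i * g n i) = (1/2)^J * g n 0 + (\<Sum>j=1..J. (1/2)^j * g n (int j))"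
        by (rule sum_site_weight_even) (simp add: g_def)
      also have "g n 0 = 0" by (simp add: g_def site_value_def)
      also have "(\<Sum>j=1..J. (1/2)^j * g n (int j)) = (\<Sum>j=1..J. if j = k n then (1/2)^(k n) * 2 powr (real (k n) / q) else 0)"
        by (intro sum.cong refl) (auto simp: g_def site_value_def abs_mult)
      also have "(1/2)^J * 0 + \<dots> = \<dots>" by simp
      also have "\<dots> = (1/2)^(k n) * 2 powr (real (k n) / q)"
        using k(1,2)[of n] by simp
      finally show ?thesis .
    qed
    have site_m: "(\<Sum>i\<in>{- int J..int J}. site_weight J i * g m i) = 1 - (1/2)^(k m)" if "m \<noteq> n" for m
    proof -
      have "(\<Sum>i\<in>{- int J..int J}. site_weight J i * g m i)
          = (\<Sum>i\<in>{- int J..int J}. site_weight J i - site_weight J i * of_bool (\<bar>i\<bar> = int (k m)))"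
        using that by (intro sum.cong) (auto simp: g_def)
      also have "\<dots> = 1 - (\<Sum>i\<in>{- int J..int J}. site_weight J i * of_bool (\<bar>i\<bar> = int (k m)))"
        by (simp only: sum_subtractf sum_site_weight)
      also have "(\<Sum>i\<in>{- int J..int J}. site_weight J i * of_bool (\<bar>i\<bar> = int (k m)))
          = (1/2)^J * of_bool (\<bar>0\<bar> = int (k m)) + (\<Sum>j=1..J. (1/2)^j * of_bool (\<bar>int j\<bar> = int (k m)))"
        by (rule sum_site_weight_even) simp
      also have "(\<Sum>j=1..J. (1/2)^j * of_bool (\<bar>int j\<bar> = int (k m))) = (\<Sum>j=1..J. if j = k m then (1/2::real)^(k m) else 0)"
        by (intro sum.cong refl) auto
      also have "(1/2)^J * of_bool (\<bar>0\<bar> = int (k m)) + \<dots> = \<dots>" using k(1)[of m] by simp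
      also have "\<dots> = (1/2)^(k m)" using k(1,2)[of m] by simp
      finally show ?thesis .
    qed
    have "(\<Sum>\<omega>\<in>configs J N. config_weight J N \<omega> * (site_value q (\<omega> n) * \<beta> n \<omega>))
        = (\<Sum>\<omega>\<in>configs J N. norm (a n) / e n * (config_weight J N \<omega> * (\<bar>site_value q (\<omega> n)\<bar> * of_bool (E n \<omega>))))"
      by (intro sum.cong) (auto simp: \<beta>_def site_value_def abs_mult abs_sgn_eq sgn_mult mult_ac sgn_if)
    also have "\<dots> = norm (a n) / e n * (\<Prod>m<N. \<Sum>i\<in>{- int J..int J}. site_weight J i * g m i)"
      unfolding sum_distrib_left [symmetric] E_prod config_weight_prod ..
    also have "(\<Prod>m<N. \<Sum>i\<in>{- int J..int J}. site_weight J i * g m i) = e n"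
      using n by (subst prod.remove[of _ n]) (auto simp: site_n site_m e_def P_def intro!: prod.cong)
    also have "norm (a n) / e n * e n = norm (a n)" using e_pos[of n] by simp
    finally have diag: "(\<Sum>\<omega>\<in>configs J N. config_weight J N \<omega> * (site_value q (\<omega> n) * \<beta> n \<omega>)) = norm (a n)" .
    have "(\<Sum>\<omega>\<in>configs J N. (config_weight J N \<omega> * site_value q (\<omega> n)) *\<^sub>R b \<omega>)
        = (\<Sum>m<N. (\<Sum>\<omega>\<in>configs J N. config_weight J N \<omega> * (site_value q (\<omega> n) * \<beta> m \<omega>)) *\<^sub>R sgn (a m))"
      unfolding b_def scaleR_sum_right scaleR_sum_left by (subst sum.swap) (simp add: mult.assoc)
    also have "\<dots> = (\<Sum>m<N. if m = n then norm (a n) *\<^sub>R sgn (a n) else 0)"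
      using off diag by (intro sum.cong) auto
    also have "\<dots> = a n" using n by (cases "a n = 0") (simp_all add: sgn_div_norm)
    finally show "(\<Sum>\<omega>\<in>configs J N. (config_weight J N \<omega> * site_value q (\<omega> n)) *\<^sub>R b \<omega>) = a n" .
  qed
qed

text \<open>
  A finite probability space of \<open>M\<close> points with masses \<open>\<mu> i\<close> and \<open>N\<close> functions \<open>h _ n\<close> on it. The
  first estimate says that the map \<open>a \<mapsto> (\<Sum>n. a n h _ n)\<close> is bounded from \<open>\<ell>\<^sup>q\<close> to \<open>L\<^sup>p\<close>, the second
  that its adjoint maps a ball of \<open>L\<^sup>\<infinity>\<close> onto a set containing the unit ball of \<open>\<ell>\<^sup>q\<^sup>'\<close>. The type
  argument fixes the space of the coefficients \<open>a n\<close>.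
\<close>

definition heavy_tailed_system ::
  "'v::real_inner itself \<Rightarrow> real \<Rightarrow> real \<Rightarrow> real \<Rightarrow> nat \<Rightarrow> nat \<Rightarrow> (nat \<Rightarrow> real) \<Rightarrow> (nat \<Rightarrow> nat \<Rightarrow> real) \<Rightarrow> bool"
where
  "heavy_tailed_system U p q C N M \<mu> h \<longleftrightarrow>
     (\<forall>i<M. \<mu> i > 0) \<and> (\<Sum>i<M. \<mu> i) = 1 \<and>
     (\<forall>(a :: nat \<Rightarrow> 'v) s. s > 0 \<longrightarrow> (\<Sum>n<N. norm (a n) powr q) \<le> s powr q \<longrightarrow>
        (\<Sum>i<M. \<mu> i * norm (\<Sum>n<N. h i n *\<^sub>R a n) powr p) \<le> C * s powr p) \<and>
     (\<forall>a :: nat \<Rightarrow> 'v. (\<Sum>n<N. norm (a n) powr (q / (q - 1))) \<le> 1 \<longrightarrow>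
        (\<exists>b. (\<forall>i. norm (b i) \<le> 16) \<and> (\<forall>n<N. (\<Sum>i<M. (\<mu> i * h i n) *\<^sub>R b i) = a n)))"

text \<open>
  The number of levels, and with it the number of points, grows with \<open>N\<close>; the constants do not.
  Independence of \<open>N\<close> is what allows blocks of arbitrary lengths to be combined later.
\<close>

lemma finite_heavy_tailed_systems:
  fixes p q :: real
  assumes p: "1 \<le> p" "p < q" and q: "q < 2"
  obtains C :: real where "C > 0"
    "\<And>N. \<exists>M \<mu> h. heavy_tailed_system TYPE('v::real_inner) p q C N M \<mu> h"
proof -
  obtain K where K: "K > 0"
    "\<And>J N (a :: nat \<Rightarrow> 'v).
      (\<Sum>\<omega>\<in>configs J N. config_weight J N \<omega> * norm (\<Sum>n<N. site_value q (\<omega> n) *\<^sub>R a n) powr p)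
        \<le> K * (1 + (\<Sum>n<N. norm (a n) powr q))"
    using config_moment_le[OF assms] by blast
  show thesis
  proof
    show "2 * K > 0" using K by simp
    fix N :: nat
    \<comment> \<open>The lowest level must have mass at most \<open>1 / (4 N)\<close>, so that rounding small coefficients up to it costs little.\<close>
    obtain J0 where "4 * real N < 2 ^ J0" using real_arch_pow[of 2 "4 * real N"] by auto
    moreover have "2 ^ J0 \<le> (2::real) ^ Suc J0" by simp
    ultimately have J: "4 * real N \<le> 2 ^ Suc J0" by linarith
    define J where "J = Suc J0"
    obtain \<phi> where \<phi>: "bij_betw \<phi> {..<card (configs J N)} (configs J N)"
      using ex_bij_betw_nat_finite[OF finite_configs[of J N]] atLeast0LessThan by auto
    define M where "M = card (configs J N)"
    define \<mu> where "\<mu> i = config_weight J N (\<phi> i)" for i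
    define h where "h i n = site_value q (\<phi> i n)" for i n
    have re: "(\<Sum>i<M. f (\<phi> i)) = (\<Sum>\<omega>\<in>configs J N. f \<omega>)" for f :: "(nat \<Rightarrow> int) \<Rightarrow> 'w::comm_monoid_add"
      unfolding M_def by (rule sum.reindex_bij_betw[OF \<phi>])
    have "(\<Sum>i<M. \<mu> i * norm (\<Sum>n<N. h i n *\<^sub>R a n) powr p) \<le> 2 * K * s powr p"
      if s: "s > 0" and a: "(\<Sum>n<N. norm (a n) powr q) \<le> s powr q" for a :: "nat \<Rightarrow> 'v" and s
    proof -
      let ?a = "\<lambda>n. a n /\<^sub>R s"
      have "(\<Sum>n<N. norm (?a n) powr q) = (\<Sum>n<N. norm (a n) powr q) / s powr q"
        using s by (simp add: powr_divide divide_inverse_commute[symmetric] sum_divide_distrib)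
      also have "\<dots> \<le> 1" using a s by simp
      finally have le: "(\<Sum>n<N. norm (?a n) powr q) \<le> 1" .
      have "(\<Sum>i<M. \<mu> i * norm (\<Sum>n<N. h i n *\<^sub>R ?a n) powr p) \<le> K * (1 + (\<Sum>n<N. norm (?a n) powr q))"
        unfolding \<mu>_def h_def re[of "\<lambda>\<omega>. config_weight J N \<omega> * norm (\<Sum>n<N. site_value q (\<omega> n) *\<^sub>R ?a n) powr p"]
        by (rule K)
      also have "\<dots> \<le> 2 * K" using le K(1) by simp
      finally have 1: "(\<Sum>i<M. \<mu> i * norm (\<Sum>n<N. h i n *\<^sub>R ?a n) powr p) \<le> 2 * K" .
      have "norm (\<Sum>n<N. h i n *\<^sub>R ?a n) powr p = norm (\<Sum>n<N. h i n *\<^sub>R a n) powr p / s powr p" for i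
      proof -
        have "(\<Sum>n<N. h i n *\<^sub>R ?a n) = (\<Sum>n<N. h i n *\<^sub>R a n) /\<^sub>R s"
          by (simp add: scaleR_sum_right mult.commute)
        then show ?thesis using s by (simp add: powr_divide divide_inverse_commute[symmetric])
      qed
      then have "(\<Sum>i<M. \<mu> i * norm (\<Sum>n<N. h i n *\<^sub>R a n) powr p) / s powr p \<le> 2 * K"
        using 1 by (simp add: sum_divide_distrib)
      then show ?thesis using s by (simp add: pos_divide_le_eq)
    qed
    moreover have "\<exists>b. (\<forall>i. norm (b i) \<le> 16) \<and> (\<forall>n<N. (\<Sum>i<M. (\<mu> i * h i n) *\<^sub>R b i) = a n)"
      if a: "(\<Sum>n<N. norm (a n) powr (q / (q - 1))) \<le> 1" for a :: "nat \<Rightarrow> 'v"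
    proof -
      obtain b where b: "\<And>\<omega>. norm (b \<omega>) \<le> 16"
        "\<And>n. n < N \<Longrightarrow> (\<Sum>\<omega>\<in>configs J N. (config_weight J N \<omega> * site_value q (\<omega> n)) *\<^sub>R b \<omega>) = a n"
        using bounded_config_lift[of q N J a] J a p unfolding J_def by auto
      have "(\<Sum>i<M. (\<mu> i * h i n) *\<^sub>R b (\<phi> i)) = a n" if "n < N" for n
        using b(2)[OF that] re[of "\<lambda>\<omega>. (config_weight J N \<omega> * site_value q (\<omega> n)) *\<^sub>R b \<omega>"]
        by (simp add: \<mu>_def h_def)
      then show ?thesis using b(1) by (intro exI[of _ "b \<circ> \<phi>"]) simp
    qed
    moreover have "\<forall>i<M. \<mu> i > 0" by (simp add: \<mu>_def config_weight_pos)
    moreover have "(\<Sum>i<M. \<mu> i) = 1" using re[of "config_weight J N"] by (simp add: \<mu>_def sum_config_weight)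
    ultimately have "heavy_tailed_system TYPE('v) p q (2 * K) N M \<mu> h"
      unfolding heavy_tailed_system_def by blast
    then show "\<exists>M \<mu> h. heavy_tailed_system TYPE('v) p q (2 * K) N M \<mu> h"
      by blast
  qed
qed

section \<open>Passing to a smaller exponent\<close>

text \<open>
  Blocks of different finite lengths \<open>M j\<close> are laid out in one sequence by the pairing
  function, with zeros at the positions \<open>(j, i)\<close> with \<open>i \<ge> M j\<close>; unconditional convergence makes
  the order irrelevant.
\<close>

lemma sum_prod_decode_tail_le:
  fixes g :: "nat \<times> nat \<Rightarrow> real"
  assumes g0: "\<And>z. g z \<ge> 0" and supp: "\<And>j i. i \<ge> M j \<Longrightarrow> g (j, i) = 0"
    and block: "\<And>j. (\<Sum>i<M j. g (j, i)) \<le> G * (1/2) ^ j" and G: "G \<ge> 0"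
    and K: "finite K" "\<And>k. k \<in> K \<Longrightarrow> J \<le> fst (prod_decode k)"
  shows "(\<Sum>k\<in>K. g (prod_decode k)) \<le> 2 * G * (1/2) ^ J"
proof -
  define L where "L = Suc (Max (insert 0 ((fst \<circ> prod_decode) ` K)))"
  have L: "fst (prod_decode k) < L" if "k \<in> K" for k
    unfolding L_def using that K(1) by (intro le_imp_less_Suc Max_ge) auto
  have geo: "(\<Sum>j\<in>{J..<L}. (1/2::real) ^ j) \<le> 2 * (1/2) ^ J"
  proof (cases "J \<le> L")
    case True
    have "(\<Sum>j\<in>{J..<L}. (1/2::real) ^ j) = 2 * (1/2) ^ J - 2 * (1/2) ^ L"
      using True by (induction rule: dec_induct) (auto simp: atLeastLessThanSuc)
    then show ?thesis by simp
  qed simp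
  have "(\<Sum>k\<in>K. g (prod_decode k)) = (\<Sum>z\<in>prod_decode ` K. g z)"
    by (simp add: sum.reindex inj_prod_decode)
  also have "\<dots> \<le> (\<Sum>z\<in>(SIGMA j:{J..<L}. {..<M j}) \<union> {z \<in> prod_decode ` K. M (fst z) \<le> snd z}. g z)"
  proof (rule sum_mono2)
    show "finite ((SIGMA j:{J..<L}. {..<M j}) \<union> {z \<in> prod_decode ` K. M (fst z) \<le> snd z})"
      using K(1) by simp
    show "prod_decode ` K \<subseteq> (SIGMA j:{J..<L}. {..<M j}) \<union> {z \<in> prod_decode ` K. M (fst z) \<le> snd z}"
    proof
      fix z assume z: "z \<in> prod_decode ` K"
      then have "J \<le> fst z" "fst z < L" using K(2) L by blast+
      then show "z \<in> (SIGMA j:{J..<L}. {..<M j}) \<union> {z \<in> prod_decode ` K. M (fst z) \<le> snd z}"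
        using z by (cases z) (simp add: not_le[symmetric])
    qed
  qed (rule g0)
  also have "\<dots> = (\<Sum>z\<in>(SIGMA j:{J..<L}. {..<M j}). g z)"
  proof (rule sum.mono_neutral_right)
    have "g z = 0" if "M (fst z) \<le> snd z" for z using supp[of "fst z" "snd z"] that by simp
    then show "\<forall>z\<in>(SIGMA j:{J..<L}. {..<M j}) \<union> {z \<in> prod_decode ` K. M (fst z) \<le> snd z} -
        (SIGMA j:{J..<L}. {..<M j}). g z = 0" by blast
  qed (use K(1) in simp_all)
  also have "\<dots> = (\<Sum>j=J..<L. \<Sum>i<M j. g (j, i))"
    by (simp add: sum.Sigma)
  also have "\<dots> \<le> (\<Sum>j=J..<L. G * (1/2) ^ j)" by (intro sum_mono block)
  also have "\<dots> \<le> G * (2 * (1/2) ^ J)" unfolding sum_distrib_left[symmetric] using G geo by (intro mult_left_mono)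
  finally show ?thesis by (simp add: mult_ac)
qed

lemma prod_decode_finite_blocks:
  fixes M :: "nat \<Rightarrow> nat"
  obtains N where "\<And>j i. j < J \<Longrightarrow> i < M j \<Longrightarrow> prod_encode (j, i) < N"
proof -
  have "finite (prod_encode ` (SIGMA j:{..<J}. {..<M j}))" by simp
  then obtain N where N: "\<forall>k\<in>prod_encode ` (SIGMA j:{..<J}. {..<M j}). k < N"
    unfolding finite_nat_set_iff_bounded by (elim exE)
  have "prod_encode (j, i) < N" if "j < J" "i < M j" for j i
    by (rule bspec[OF N]) (use that in simp)
  then show thesis by (rule that)
qed

lemma sum_prod_decode_blocks:
  fixes F :: "nat \<times> nat \<Rightarrow> 'v::ab_group_add"
  assumes supp: "\<And>j i. i \<ge> M j \<Longrightarrow> F (j, i) = 0"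
    and N: "\<And>j i. j < J \<Longrightarrow> i < M j \<Longrightarrow> prod_encode (j, i) < N" and n: "N \<le> n"
  shows "(\<Sum>k<n. F (prod_decode k)) - (\<Sum>k | k < n \<and> J \<le> fst (prod_decode k). F (prod_decode k))
       = (\<Sum>j<J. \<Sum>i<M j. F (j, i))"
proof -
  let ?A = "{k. k < n \<and> fst (prod_decode k) < J}"
  have "(\<Sum>k<n. F (prod_decode k)) = (\<Sum>k\<in>?A \<union> {k. k < n \<and> J \<le> fst (prod_decode k)}. F (prod_decode k))"
    by (intro sum.cong) auto
  also have "\<dots> = (\<Sum>k\<in>?A. F (prod_decode k)) + (\<Sum>k | k < n \<and> J \<le> fst (prod_decode k). F (prod_decode k))"
    by (intro sum.union_disjoint) auto
  finally have "(\<Sum>k<n. F (prod_decode k)) - (\<Sum>k | k < n \<and> J \<le> fst (prod_decode k). F (prod_decode k))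
      = (\<Sum>k\<in>?A. F (prod_decode k))" by simp
  also have "\<dots> = (\<Sum>z\<in>prod_decode ` ?A. F z)" by (simp add: sum.reindex inj_prod_decode)
  also have "\<dots> = (\<Sum>z\<in>(SIGMA j:{..<J}. {..<M j}). F z)"
  proof (rule sum.mono_neutral_right)
    show "(SIGMA j:{..<J}. {..<M j}) \<subseteq> prod_decode ` ?A"
    proof
      fix z assume "z \<in> (SIGMA j:{..<J}. {..<M j})"
      then have "prod_encode z \<in> ?A" using N n by (force intro: less_le_trans)
      then show "z \<in> prod_decode ` ?A" by (metis imageI prod_encode_inverse)
    qed
    show "\<forall>z\<in>prod_decode ` ?A - (SIGMA j:{..<J}. {..<M j}). F z = 0"
    proof
      fix z assume z: "z \<in> prod_decode ` ?A - (SIGMA j:{..<J}. {..<M j})"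
      obtain j i where ji: "z = (j, i)" by fastforce
      obtain k where "z = prod_decode k" "k \<in> ?A" using z by blast
      then have "j < J" using ji by (metis (mono_tags, lifting) fst_conv mem_Collect_eq)
      then show "F z = 0" using z ji supp[where j = j and i = i] by auto
    qed
  qed simp
  also have "\<dots> = (\<Sum>j<J. \<Sum>i<M j. F (j, i))" by (simp add: sum.Sigma)
  finally show ?thesis .
qed

lemma ex_fast_subsequence:
  fixes R e :: "nat \<Rightarrow> real"
  assumes "R \<longlonglongrightarrow> 0" "\<And>j. e j > 0"
  obtains nn :: "nat \<Rightarrow> nat" where "strict_mono nn" "nn 0 = 0" "\<And>j. R (nn (Suc j)) \<le> e (Suc j)"
proof -
  have "\<exists>N. \<forall>n\<ge>N. R n \<le> e j" for j
    using order_tendstoD(2)[OF assms, of j] by (auto simp: eventually_sequentially) (meson less_imp_le)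
  then obtain g where g: "\<And>j n. n \<ge> g j \<Longrightarrow> R n \<le> e j" by metis
  define nn where "nn = rec_nat 0 (\<lambda>j r. max (Suc r) (g (Suc j)))"
  have Suc: "nn (Suc j) = max (Suc (nn j)) (g (Suc j))" for j by (simp add: nn_def)
  show thesis
  proof
    show "strict_mono nn" by (rule strict_monoI_Suc) (simp add: Suc less_max_iff_disj)
    show "nn 0 = 0" by (simp add: nn_def)
    show "R (nn (Suc j)) \<le> e (Suc j)" for j by (rule g) (simp add: Suc)
  qed
qed

lemma sum_consecutive_blocks:
  fixes F :: "nat \<Rightarrow> 'v::comm_monoid_add"
  assumes "mono nn" "nn 0 = 0"
  shows "(\<Sum>j<J. \<Sum>n<nn (Suc j) - nn j. F (nn j + n)) = (\<Sum>k<nn J. F k)"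
proof (induction J)
  case (Suc J)
  have le: "nn J \<le> nn (Suc J)" using assms by (simp add: monoD)
  have "(\<Sum>n<nn (Suc J) - nn J. F (nn J + n)) = (\<Sum>k=nn J..<nn (Suc J). F k)"
    using sum.shift_bounds_nat_ivl[of F 0 "nn J" "nn (Suc J) - nn J"] le
    by (simp add: lessThan_atLeast0 add.commute)
  moreover have "(\<Sum>k<nn J. F k) + (\<Sum>k=nn J..<nn (Suc J). F k) = (\<Sum>k<nn (Suc J). F k)"
    using le by (simp add: lessThan_atLeast0 sum.atLeastLessThan_concat)
  ultimately show ?case using Suc by simp
qed (use assms in simp)

context norming_space begin

text \<open>
  Cut \<open>x\<close> into blocks such that the weak \<open>q\<close>-norm of the \<open>j\<close>-th block is at most \<open>B 4\<^sup>-\<^sup>j\<close>. For each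
  block take a finite system as above and put \<open>\<mu> i\<^sup>1\<^sup>/\<^sup>p (\<Sum>n. h i n x n)\<close> into the new sequence:
  its weak \<open>p\<close>-norm is at most a constant times \<open>4\<^sup>-\<^sup>j\<close>, and a block of coefficients \<open>c\<close> in the ball
  of \<open>\<ell>\<^sup>q\<^sup>'\<close> is reproduced by the coefficients \<open>\<mu> i\<^sup>1\<^sup>-\<^sup>1\<^sup>/\<^sup>p b i\<close> with \<open>b\<close> the bounded lift of \<open>c\<close>. Moving a
  factor \<open>\<Lambda> j\<close> of order \<open>2\<^sup>j\<close> from the coefficients to the vectors makes both the vectors and the
  coefficients summable over the blocks. For \<open>p = 1\<close> it also makes the coefficients tend to \<open>0\<close>.
\<close>

lemma p_co_subset_smaller_exponent:
  assumes X: "banach_space X" and p: "1 \<le> p" "p < q" and q: "q < 2" and x: "x \<in> lp_uncond q X"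
  shows "\<exists>y\<in>lp_uncond p X. p_co q X x \<subseteq> p_co p X y"
proof -
  have q1: "q > 1" "q \<ge> 1" using p by simp_all
  have xr: "range x \<subseteq> carrier X" using lp_uncondD(1)[OF q1(2) x] .
  then have xk: "x k \<in> carrier X" for k by auto
  obtain R where R: "R \<longlonglongrightarrow> 0" "\<And>n. R n \<ge> 0"
    "\<And>f n m. f \<in> dual_ball X \<Longrightarrow> (\<Sum>k=n..<m. norm (f (x k)) powr q) \<le> R n"
    using lp_uncond_tail_bound[OF q1(2) x] by metis
  obtain nn where nn: "strict_mono nn" "nn 0 = 0" "\<And>j. R (nn (Suc j)) \<le> ((1/4) ^ Suc j) powr q"
    using ex_fast_subsequence[of R "\<lambda>j. ((1/4) ^ j) powr q"] R(1) by auto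
  have nn_le: "nn j \<le> nn (Suc j)" for j using nn(1) by (simp add: strict_mono_less_eq)
  \<comment> \<open>The block before \<open>nn 1\<close> has no small tail bound; \<open>B\<close> accounts for it.\<close>
  define B where "B = max 1 (R 0 powr (1 / q))"
  have B: "B \<ge> 1" by (simp add: B_def)
  have RB: "R (nn j) \<le> (B * (1/4) ^ j) powr q" for j
  proof (cases j)
    case 0
    have "R 0 = (R 0 powr (1 / q)) powr q" using q1 R(2)[of 0] by (simp add: powr_powr)
    also have "\<dots> \<le> B powr q" using q1 by (intro powr_mono2) (auto simp: B_def)
    finally show ?thesis using 0 nn(2) by simp
  next
    case (Suc i)
    have "((1/4) ^ Suc i) powr q \<le> (B * (1/4) ^ Suc i) powr q"
      using q1 B by (intro powr_mono2) auto
    then show ?thesis using nn(3)[of i] Suc by simp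
  qed
  define len where "len j = nn (Suc j) - nn j" for j
  have block_q: "(\<Sum>n<len j. norm (f (x (nn j + n))) powr q) \<le> (B * (1/4) ^ j) powr q" if "f \<in> dual_ball X" for f j
  proof -
    have "(\<Sum>n<len j. norm (f (x (nn j + n))) powr q) = (\<Sum>k=nn j..<nn (Suc j). norm (f (x k)) powr q)"
      using sum.shift_bounds_nat_ivl[of "\<lambda>k. norm (f (x k)) powr q" 0 "nn j" "len j"] nn_le[of j]
      by (simp add: len_def lessThan_atLeast0 add.commute)
    then show ?thesis using R(3)[OF that, of "nn j" "nn (Suc j)"] RB[of j] by simp
  qed
  obtain C where C: "C > 0" "\<And>N. \<exists>M \<mu> h. heavy_tailed_system TYPE('k) p q C N M \<mu> h"
    by (rule finite_heavy_tailed_systems[OF p q, where 'v = 'k]) (rule that, assumption+)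
  obtain M \<mu> h where sys: "\<And>j. heavy_tailed_system TYPE('k) p q C (len j) (M j) (\<mu> j) (h j)"
  proof -
    have "\<forall>j. \<exists>M \<mu> h. heavy_tailed_system TYPE('k) p q C (len j) M \<mu> h" using C(2) by blast
    from choice[OF this] obtain M where "\<forall>j. \<exists>\<mu> h. heavy_tailed_system TYPE('k) p q C (len j) (M j) \<mu> h"
      by (elim exE)
    from choice[OF this] obtain \<mu> where "\<forall>j. \<exists>h. heavy_tailed_system TYPE('k) p q C (len j) (M j) (\<mu> j) h"
      by (elim exE)
    from choice[OF this] show thesis using that by blast
  qed
  have \<mu>0: "\<And>j i. i < M j \<Longrightarrow> \<mu> j i > 0" and \<mu>1: "\<And>j. (\<Sum>i<M j. \<mu> j i) = 1"
    and upper: "\<And>j (a :: nat \<Rightarrow> 'k) s. s > 0 \<Longrightarrow> (\<Sum>n<len j. norm (a n) powr q) \<le> s powr q \<Longrightarrow>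
          (\<Sum>i<M j. \<mu> j i * norm (\<Sum>n<len j. h j i n *\<^sub>R a n) powr p) \<le> C * s powr p"
    and lift: "\<And>j (a :: nat \<Rightarrow> 'k). (\<Sum>n<len j. norm (a n) powr (q / (q - 1))) \<le> 1 \<Longrightarrow>
          \<exists>b. (\<forall>i. norm (b i) \<le> 16) \<and> (\<forall>n<len j. (\<Sum>i<M j. (\<mu> j i * h j i n) *\<^sub>R b i) = a n)"
    using sys unfolding heavy_tailed_system_def by blast+
  \<comment> \<open>With \<open>norm (b i) \<le> 16\<close>, division by \<open>32 * 2\<^sup>j\<close> leaves coefficients of size at most \<open>2\<^sup>-\<^sup>j / 2\<close>, whose sum over \<open>j\<close> is \<open>1\<close>.\<close>
  define \<Lambda> :: "nat \<Rightarrow> real" where "\<Lambda> j = 32 * 2 ^ j" for j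
  have \<Lambda>0: "\<Lambda> j > 0" for j by (simp add: \<Lambda>_def)
  define v where "v j i = finsum X (\<lambda>n. of_real (h j i n) \<odot> x (nn j + n)) {..<len j}" for j i
  have vX: "v j i \<in> carrier X" for j i unfolding v_def using xk by (intro M.finsum_closed) auto
  define y where "y = (\<lambda>(j, i). if i < M j then of_real (\<Lambda> j * \<mu> j i powr (1 / p)) \<odot> v j i else \<zero>)"
  define Y where "Y k = y (prod_decode k)" for k
  have yX: "y z \<in> carrier X" for z using vX by (auto simp: y_def split: prod.split)
  then have Yr: "range Y \<subseteq> carrier X" unfolding Y_def by blast
  have fy: "f (y (j, i)) = (\<Lambda> j * \<mu> j i powr (1 / p)) *\<^sub>R (\<Sum>n<len j. h j i n *\<^sub>R f (x (nn j + n)))"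
    if f: "f \<in> dual_ball X" and i: "i < M j" for f j i
    using i vX xk unfolding y_def v_def
    by (simp add: functional_simps(2)[OF dual_ballD[OF f]] functional_simps(5)[OF dual_ballD[OF f]] scaleR_conv_of_real M.finsum_closed)
  have fy0: "f (y (j, i)) = 0" if "f \<in> dual_ball X" "i \<ge> M j" for f j i
    using that functional_simps(3)[OF dual_ballD] by (simp add: y_def)
  define G where "G = C * (32 * B) powr p"
  have G0: "G \<ge> 0" using C by (simp add: G_def)
  have block_p: "(\<Sum>i<M j. norm (f (y (j, i))) powr p) \<le> G * (1/2) ^ j" if f: "f \<in> dual_ball X" for f j
  proof -
    have "(\<Sum>i<M j. norm (f (y (j, i))) powr p)
       = (\<Sum>i<M j. \<Lambda> j powr p * (\<mu> j i * norm (\<Sum>n<len j. h j i n *\<^sub>R f (x (nn j + n))) powr p))"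
      using p \<mu>0[THEN less_imp_le] \<Lambda>0[of j]
      by (intro sum.cong refl) (simp add: fy[OF f] abs_mult powr_mult powr_powr abs_of_pos)
    also have "\<dots> = \<Lambda> j powr p * (\<Sum>i<M j. \<mu> j i * norm (\<Sum>n<len j. h j i n *\<^sub>R f (x (nn j + n))) powr p)"
      by (simp add: sum_distrib_left)
    also have "\<dots> \<le> \<Lambda> j powr p * (C * (B * (1/4) ^ j) powr p)"
      using B block_q[OF f] by (intro mult_left_mono upper) auto
    also have "\<dots> = C * (\<Lambda> j * (B * (1/4) ^ j)) powr p"
      using B \<Lambda>0[of j] by (simp add: powr_mult)
    also have "\<Lambda> j * (B * (1/4) ^ j) = (32 * B) * (1/2) ^ j"
      by (simp add: \<Lambda>_def power_one_over field_simps flip: power_mult_distrib)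
    also have "C * ((32 * B) * (1/2) ^ j) powr p = G * ((1/2) ^ j) powr p"
      using B by (simp add: G_def powr_mult)
    also have "\<dots> \<le> G * (1/2) ^ j"
      using G0 p powr_mono'[of 1 p "(1/2) ^ j"] by (intro mult_left_mono) (auto simp: power_le_one)
    finally show ?thesis .
  qed
  have tail_p: "(\<Sum>k\<in>K. norm (f (Y k)) powr p) \<le> 2 * G * (1/2) ^ J"
    if f: "f \<in> dual_ball X" and K: "finite K" "\<And>k. k \<in> K \<Longrightarrow> J \<le> fst (prod_decode k)" for f K J
    unfolding Y_def using p fy0[OF f] block_p[OF f] G0 K
    by (intro sum_prod_decode_tail_le[of "\<lambda>z. norm (f (y z)) powr p" M]) auto
  have Y: "Y \<in> lp_uncond p X"
  proof (rule lp_uncondI[OF p(1) Yr])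
    fix e :: real assume e: "e > 0"
    have "(\<lambda>J. 2 * G * (1/2) ^ J) \<longlonglongrightarrow> 2 * G * 0" by (intro tendsto_mult tendsto_const LIMSEQ_power_zero) auto
    then have "eventually (\<lambda>J. 2 * G * (1/2) ^ J < e) sequentially" using e by (intro order_tendstoD(2)) auto
    then obtain J where J: "2 * G * (1/2) ^ J < e" by (auto simp: eventually_sequentially)
    obtain N where N: "\<And>j i. j < J \<Longrightarrow> i < M j \<Longrightarrow> prod_encode (j, i) < N"
      using prod_decode_finite_blocks[of J M] by blast
    have "(\<Sum>k=N..<m. norm (f (Y k)) powr p) \<le> e" if f: "f \<in> dual_ball X" for f m
    proof -
      have zero: "f (Y k) = 0" if "k \<ge> N" "fst (prod_decode k) < J" for k
      proof -
        obtain j i where ji: "prod_decode k = (j, i)" by fastforce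
        then have "k = prod_encode (j, i)" by (metis prod_decode_inverse)
        then show ?thesis using N[of j i] that ji fy0[OF f, of j i] by (force simp: Y_def)
      qed
      have "(\<Sum>k=N..<m. norm (f (Y k)) powr p) = (\<Sum>k\<in>{k \<in> {N..<m}. J \<le> fst (prod_decode k)}. norm (f (Y k)) powr p)"
      proof (rule sum.mono_neutral_right)
        show "\<forall>k\<in>{N..<m} - {k \<in> {N..<m}. J \<le> fst (prod_decode k)}. norm (f (Y k)) powr p = 0"
        proof
          fix k assume "k \<in> {N..<m} - {k \<in> {N..<m}. J \<le> fst (prod_decode k)}"
          then have "N \<le> k" "fst (prod_decode k) < J" by auto
          then show "norm (f (Y k)) powr p = 0" using zero[of k] by simp
        qed
      qed auto
      also have "\<dots> \<le> 2 * G * (1/2) ^ J" by (intro tail_p[OF f]) auto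
      finally show ?thesis using J by simp
    qed
    then show "\<exists>N. \<forall>f\<in>dual_ball X. \<forall>m. (\<Sum>k=N..<m. norm (f (Y k)) powr p) \<le> e" by blast
  qed
  have "z \<in> p_co p X Y" if zq: "z \<in> p_co q X x" for z
  proof -
    obtain c where z: "z \<in> carrier X" and c: "c \<in> conj_seq_ball q"
      and lim: "(\<lambda>n. nrm X (psum X c x n \<ominus> z)) \<longlonglongrightarrow> 0"
      using zq unfolding p_co_altdef by blast
    have "(\<Sum>n<len j. norm (c (nn j + n)) powr (q / (q - 1))) \<le> 1" for j
    proof -
      have "(\<Sum>n<len j. norm (c (nn j + n)) powr (q / (q - 1))) = (\<Sum>k\<in>(+) (nn j) ` {..<len j}. norm (c k) powr (q / (q - 1)))"
        by (simp add: sum.reindex)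
      also have "\<dots> \<le> 1" by (rule conj_seq_ballD[OF q1(1) c]) simp
      finally show ?thesis .
    qed
    then have "\<forall>j. \<exists>b. (\<forall>i. norm (b i) \<le> 16) \<and> (\<forall>n<len j. (\<Sum>i<M j. (\<mu> j i * h j i n) *\<^sub>R b i) = c (nn j + n))"
      by (intro allI lift)
    from choice[OF this] obtain b where b: "\<And>j i. norm (b j i) \<le> 16"
      "\<And>j n. n < len j \<Longrightarrow> (\<Sum>i<M j. (\<mu> j i * h j i n) *\<^sub>R b j i) = c (nn j + n)"
      by blast
    define d where "d = (\<lambda>(j, i). if i < M j then (\<mu> j i powr (1 - 1 / p) / \<Lambda> j) *\<^sub>R b j i else 0)"
    define E where "E k = d (prod_decode k)" for k
    have d0: "d (j, i) = 0" if "i \<ge> M j" for j i using that by (simp add: d_def)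
    have \<mu>le: "\<mu> j i \<le> 1" if "i < M j" for j i
    proof -
      have "\<mu> j i \<le> (\<Sum>i<M j. \<mu> j i)" using that \<mu>0[THEN less_imp_le] by (intro member_le_sum) auto
      then show ?thesis using \<mu>1 by simp
    qed
    have nd: "norm (d (j, i)) \<le> \<mu> j i powr (1 - 1 / p) * ((1/2) * (1/2) ^ j)" if "i < M j" for j i
    proof -
      have "norm (d (j, i)) = \<mu> j i powr (1 - 1 / p) / \<Lambda> j * norm (b j i)"
        using that \<Lambda>0[of j] by (simp add: d_def)
      also have "\<dots> \<le> \<mu> j i powr (1 - 1 / p) / \<Lambda> j * 16"
        using b \<Lambda>0[of j] by (intro mult_left_mono) auto
      also have "\<dots> = \<mu> j i powr (1 - 1 / p) * ((1/2) * (1/2) ^ j)"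
        by (simp add: \<Lambda>_def power_one_over)
      finally show ?thesis .
    qed
    have E: "E \<in> conj_seq_ball p"
    proof (cases "p = 1")
      case True
      have le: "norm (d (j, i)) \<le> (1/2) ^ j" for j i
      proof (cases "i < M j")
        case i: True
        have "\<mu> j i powr (1 - 1 / p) * ((1/2) * (1/2) ^ j) \<le> 1 * (1 * (1/2) ^ j)"
          using True \<mu>0[OF i] by (intro mult_mono) auto
        from order_trans[OF nd[OF i] this] show ?thesis by simp
      qed (simp add: d0)
      have "norm (E k) \<le> 1" for k
        using le[of "fst (prod_decode k)" "snd (prod_decode k)"] power_le_one[of "1/2::real" "fst (prod_decode k)"]
        by (simp add: E_def)
      moreover have "E \<longlonglongrightarrow> 0"
      proof (rule LIMSEQ_I)
        fix e :: real assume e: "e > 0"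
        obtain J where J: "(1/2) ^ J < e" using real_arch_pow_inv[OF e, of "1/2"] by auto
        obtain N where N: "\<And>j i. j < J \<Longrightarrow> i < M j \<Longrightarrow> prod_encode (j, i) < N"
          using prod_decode_finite_blocks[of J M] by blast
        have "norm (E k - 0) < e" if k: "k \<ge> N" for k
        proof -
          obtain j i where ji: "prod_decode k = (j, i)" by fastforce
          then have k': "k = prod_encode (j, i)" by (metis prod_decode_inverse)
          show ?thesis
          proof (cases "J \<le> j")
            case True
            have "(1/2) ^ j \<le> (1/2::real) ^ J" using True by (intro power_decreasing) auto
            with le[of j i] J have "norm (d (j, i)) < e" by linarith
            then show ?thesis using ji by (simp add: E_def)
          next
            case False
            then have "\<not> i < M j" using N[of j i] k k' by auto
            then show ?thesis using e ji d0[of j i] by (simp add: E_def)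
          qed
        qed
        then show "\<exists>no. \<forall>n\<ge>no. norm (E n - 0) < e" by blast
      qed
      ultimately show ?thesis using True by (simp add: conj_seq_ball_def)
    next
      case False
      then have p1: "p > 1" using p by simp
      define r where "r = p / (p - 1)"
      have r: "r > 1" "(1 - 1 / p) * r = 1" using p1 by (auto simp: r_def field_simps)
      show ?thesis
      proof (rule conj_seq_ballI[OF p1])
        fix n
        have "(\<Sum>k<n. norm (d (prod_decode k)) powr r) \<le> 2 * (1/2) * (1/2) ^ 0"
        proof (rule sum_prod_decode_tail_le[of "\<lambda>z. norm (d z) powr r" M])
          show "norm (d (j, i)) powr r = 0" if "M j \<le> i" for j i using d0[OF that] r by simp
          show "(\<Sum>i<M j. norm (d (j, i)) powr r) \<le> (1/2) * (1/2) ^ j" for j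
          proof -
            have "(\<Sum>i<M j. norm (d (j, i)) powr r) \<le> (\<Sum>i<M j. \<mu> j i * ((1/2) * (1/2) ^ j))"
            proof (rule sum_mono)
              fix i assume "i \<in> {..<M j}"
              then have i: "i < M j" by simp
              have "norm (d (j, i)) powr r \<le> (\<mu> j i powr (1 - 1 / p) * ((1/2) * (1/2) ^ j)) powr r"
                using nd[OF i] r by (intro powr_mono2) auto
              also have "\<dots> = \<mu> j i * ((1/2) * (1/2) ^ j) powr r"
                using \<mu>0[OF i] r by (subst powr_mult) (auto simp: powr_powr)
              also have "\<dots> \<le> \<mu> j i * ((1/2) * (1/2) ^ j) powr 1"
                using \<mu>0[OF i] r power_le_one[of "1/2::real" j] by (intro mult_left_mono powr_mono') auto
              finally show "norm (d (j, i)) powr r \<le> \<mu> j i * ((1/2) * (1/2) ^ j)" by simp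
            qed
            also have "\<dots> = (1/2) * (1/2) ^ j" by (simp only: sum_distrib_right[symmetric] \<mu>1 mult_1)
            finally show ?thesis .
          qed
        qed auto
        then show "(\<Sum>k<n. norm (E k) powr (p / (p - 1))) \<le> 1" by (simp add: E_def r_def)
      qed
    qed
    have block_sum: "(\<Sum>i<M j. d (j, i) * f (y (j, i))) = (\<Sum>n<len j. c (nn j + n) * f (x (nn j + n)))"
      if f: "f \<in> dual_ball X" for f j
    proof -
      have "d (j, i) * f (y (j, i)) = (\<Sum>n<len j. ((\<mu> j i * h j i n) *\<^sub>R b j i) * f (x (nn j + n)))" if i: "i < M j" for i
      proof -
        have "\<Lambda> j * \<mu> j i powr (1 / p) * (\<mu> j i powr (1 - 1 / p) / \<Lambda> j) = \<mu> j i"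
          using \<Lambda>0[of j] \<mu>0[OF i] by (simp flip: powr_add)
        moreover have "d (j, i) * f (y (j, i)) = (\<Lambda> j * \<mu> j i powr (1 / p) * (\<mu> j i powr (1 - 1 / p) / \<Lambda> j)) *\<^sub>R
            (b j i * (\<Sum>n<len j. h j i n *\<^sub>R f (x (nn j + n))))"
          by (simp only: d_def prod.case i if_True fy[OF f i] mult_scaleR_left mult_scaleR_right scaleR_scaleR)
        ultimately have "d (j, i) * f (y (j, i)) = \<mu> j i *\<^sub>R (b j i * (\<Sum>n<len j. h j i n *\<^sub>R f (x (nn j + n))))"
          by (simp only:)
        also have "\<dots> = (\<Sum>n<len j. ((\<mu> j i * h j i n) *\<^sub>R b j i) * f (x (nn j + n)))"
          by (simp add: sum_distrib_left scaleR_sum_right)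
        finally show ?thesis .
      qed
      then have "(\<Sum>i<M j. d (j, i) * f (y (j, i)))
          = (\<Sum>n<len j. \<Sum>i<M j. ((\<mu> j i * h j i n) *\<^sub>R b j i) * f (x (nn j + n)))"
        by (subst sum.swap) simp
      also have "\<dots> = (\<Sum>n<len j. c (nn j + n) * f (x (nn j + n)))"
        by (intro sum.cong refl) (simp only: b(2) lessThan_iff sum_distrib_right[symmetric])
      finally show ?thesis .
    qed
    have close: "\<exists>N. \<forall>n\<ge>N. nrm X (psum X E Y n \<ominus> z) \<le> (2 * G * (1/2) ^ J) powr (1 / p) + nrm X (psum X c x (nn J) \<ominus> z)" for J
    proof -
      obtain N where N: "\<And>j i. j < J \<Longrightarrow> i < M j \<Longrightarrow> prod_encode (j, i) < N"
        using prod_decode_finite_blocks[of J M] by blast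
      have "nrm X (psum X E Y n \<ominus> z) \<le> (2 * G * (1/2) ^ J) powr (1 / p) + nrm X (psum X c x (nn J) \<ominus> z)"
        if n: "n \<ge> N" for n
      proof (rule nrm_leI)
        fix f assume f: "f \<in> dual_ball X"
        let ?K = "{k. k < n \<and> J \<le> fst (prod_decode k)}"
        let ?F = "\<lambda>z. d z * f (y z)"
        have "(\<Sum>k<n. ?F (prod_decode k)) - (\<Sum>k\<in>?K. ?F (prod_decode k)) = (\<Sum>j<J. \<Sum>i<M j. ?F (j, i))"
          using d0 by (intro sum_prod_decode_blocks[OF _ N n]) auto
        also have "\<dots> = (\<Sum>k<nn J. c k * f (x k))"
          unfolding block_sum[OF f] len_def
          using nn by (intro sum_consecutive_blocks strict_mono_mono) auto
        finally have "f (psum X E Y n) - f (psum X c x (nn J)) = (\<Sum>k\<in>?K. E k * f (Y k))"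
          unfolding functional_psum[OF dual_ballD[OF f] Yr] functional_psum[OF dual_ballD[OF f] xr] E_def Y_def
          by (simp add: algebra_simps)
        also have "norm \<dots> \<le> (\<Sum>k\<in>?K. norm (E k) * norm (f (Y k)))"
          by (intro order_trans[OF norm_sum]) (simp add: norm_mult)
        also have "\<dots> \<le> (2 * G * (1/2) ^ J) powr (1 / p)"
        proof (rule conj_seq_ball_Hoelder[OF p(1) E])
          have "(\<Sum>k\<in>?K. norm (f (Y k)) powr p) \<le> 2 * G * (1/2) ^ J" by (rule tail_p[OF f]) simp_all
          moreover have "((2 * G * (1/2) ^ J) powr (1 / p)) powr p = 2 * G * (1/2) ^ J"
            using p G0 by (simp add: powr_powr)
          ultimately show "(\<Sum>k\<in>?K. norm (f (Y k)) powr p) \<le> ((2 * G * (1/2) ^ J) powr (1 / p)) powr p"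
            by (simp only:)
        qed simp_all
        finally have 1: "norm (f (psum X E Y n) - f (psum X c x (nn J))) \<le> (2 * G * (1/2) ^ J) powr (1 / p)" .
        have 2: "norm (f (psum X c x (nn J)) - f z) \<le> nrm X (psum X c x (nn J) \<ominus> z)"
          using dual_ball_bound[OF f, of "psum X c x (nn J) \<ominus> z"] z xr
          by (simp add: functional_simps(4)[OF dual_ballD[OF f]])
        have "f (psum X E Y n \<ominus> z) = (f (psum X E Y n) - f (psum X c x (nn J))) + (f (psum X c x (nn J)) - f z)"
          using z Yr by (simp add: functional_simps(4)[OF dual_ballD[OF f]])
        then show "norm (f (psum X E Y n \<ominus> z)) \<le> (2 * G * (1/2) ^ J) powr (1 / p) + nrm X (psum X c x (nn J) \<ominus> z)"
          using norm_triangle_le[OF add_mono[OF 1 2]] by simp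
      qed (use Yr z in auto)
      then show ?thesis by blast
    qed
    have "(\<lambda>J. (2 * G * (1/2) ^ J) powr (1 / p)) \<longlonglongrightarrow> (2 * G * 0) powr (1 / p)"
      using p G0 by (intro tendsto_powr' tendsto_mult tendsto_const LIMSEQ_power_zero) auto
    moreover have "(\<lambda>J. nrm X (psum X c x (nn J) \<ominus> z)) \<longlonglongrightarrow> 0"
      using LIMSEQ_subseq_LIMSEQ[OF lim nn(1)] by (simp add: o_def)
    ultimately have bound0: "(\<lambda>J. (2 * G * (1/2) ^ J) powr (1 / p) + nrm X (psum X c x (nn J) \<ominus> z)) \<longlonglongrightarrow> 0"
      using tendsto_add by fastforce
    have "(\<lambda>n. nrm X (psum X E Y n \<ominus> z)) \<longlonglongrightarrow> 0"
    proof (rule LIMSEQ_I)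
      fix e :: real assume e: "e > 0"
      obtain J where J: "(2 * G * (1/2) ^ J) powr (1 / p) + nrm X (psum X c x (nn J) \<ominus> z) < e"
        using order_tendstoD(2)[OF bound0 e] by (auto simp: eventually_sequentially)
      obtain N where N: "\<And>n. n \<ge> N \<Longrightarrow> nrm X (psum X E Y n \<ominus> z) \<le> (2 * G * (1/2) ^ J) powr (1 / p) + nrm X (psum X c x (nn J) \<ominus> z)"
        using close[of J] by blast
      have "norm (nrm X (psum X E Y n \<ominus> z) - 0) < e" if "n \<ge> N" for n
        using N[OF that] J nrm_nonneg[of "psum X E Y n \<ominus> z"] z Yr by simp
      then show "\<exists>no. \<forall>n\<ge>no. norm (nrm X (psum X E Y n \<ominus> z) - 0) < e" by blast
    qed
    then show ?thesis unfolding p_co_altdef using z E by blast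
  qed
  then show ?thesis using Y by blast
qed

end

section \<open>The approximation property\<close>

lemma finite_rank_ops_comp:
  assumes "F \<in> finite_rank_ops Z X" "T \<in> bounded_ops Y Z"
    and nneg: "\<And>z. z \<in> carrier Z \<Longrightarrow> 0 \<le> nrm Z z"
  shows "(\<lambda>y. F (T y)) \<in> finite_rank_ops Y X"
proof -
  have F: "F \<in> bounded_ops Z X" using assms(1) by (simp add: finite_rank_ops_def)
  note T = bounded_opsD[OF assms(2)] and F' = bounded_opsD[OF F]
  obtain C where C: "\<And>x. x \<in> carrier Y \<Longrightarrow> nrm Z (T x) \<le> C * nrm Y x"
    using assms(2) by (simp add: bounded_ops_def) blast
  obtain D where D: "\<And>x. x \<in> carrier Z \<Longrightarrow> nrm X (F x) \<le> D * nrm Z x"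
    using F by (simp add: bounded_ops_def) blast
  have "nrm X (F (T x)) \<le> (max D 0 * C) * nrm Y x" if "x \<in> carrier Y" for x
  proof -
    have "nrm X (F (T x)) \<le> D * nrm Z (T x)" using D T(1) that by blast
    also have "\<dots> \<le> max D 0 * nrm Z (T x)" using nneg[OF T(1)[OF that]] by (intro mult_right_mono) auto
    also have "\<dots> \<le> max D 0 * (C * nrm Y x)" using C[OF that] by (intro mult_left_mono) auto
    finally show ?thesis by (simp add: mult.assoc)
  qed
  then have "(\<lambda>y. F (T y)) \<in> bounded_ops Y X"
    unfolding bounded_ops_def using T F' by (auto simp: Pi_def)
  moreover obtain S where "finite S" "S \<subseteq> carrier X"
    "\<And>x. x \<in> carrier Z \<Longrightarrow> \<exists>c. F x = finsum X (\<lambda>s. c s \<odot>\<^bsub>X\<^esub> s) S"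
    using assms(1) unfolding finite_rank_ops_def by blast
  ultimately show ?thesis unfolding finite_rank_ops_def using T(1) by blast
qed

context norming_space begin

lemma banach_disk_p_co:
  assumes X: "banach_space X" and q: "q > 1" and x: "x \<in> lp_uncond q X"
  obtains M where "banach_disk X (p_co q X x) M"
proof -
  have q1: "q \<ge> 1" using q by simp
  note xr = lp_uncondD(1)[OF q1 x]
  obtain M where M: "M \<ge> 0" "\<And>z. z \<in> p_co q X x \<Longrightarrow> nrm X z \<le> M"
    using p_co_bounded[OF q1 x] by metis
  have "(\<lambda>_. 0) \<in> (conj_seq_ball q :: (nat \<Rightarrow> 'k) set)"
    using q by (intro conj_seq_ballI) auto
  moreover have "psum X (\<lambda>_. 0) x n = \<zero>" for n
    using xr by (intro vec_eqI) (auto simp: functional_psum dual_ballD functional_simps(3))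
  ultimately have zero: "\<zero> \<in> p_co q X x"
    unfolding p_co_altdef by (auto simp: minus_eq_sm intro!: bexI[of _ "\<lambda>_. 0"])
  have "banach_disk X (p_co q X x) (M + 1)"
  proof (intro banach_disk.intro banach_disk_axioms.intro nvs_axioms X zero)
    show "p_co q X x \<subseteq> carrier X" by (auto simp: p_co_def)
    show "\<And>u v a b. \<lbrakk>u \<in> p_co q X x; v \<in> p_co q X x; norm a + norm b \<le> 1\<rbrakk> \<Longrightarrow> a \<odot> u \<oplus> b \<odot> v \<in> p_co q X x"
      by (rule p_co_abs_convex[OF q xr])
    show "\<And>u. u \<in> p_co q X x \<Longrightarrow> nrm X u \<le> M + 1" using M(2) by fastforce
    show "M + 1 > 0" using M by simp
    show "\<And>w z. \<lbrakk>\<And>i. w i \<in> p_co q X x; z \<in> carrier X; (\<lambda>i::nat. nrm X (w i \<ominus> z)) \<longlonglongrightarrow> 0\<rbrakk> \<Longrightarrow> z \<in> p_co q X x"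
      by (rule p_co_closed[OF X q x])
  qed
  then show thesis by (rule that)
qed

text \<open>
  The tail of a series after \<open>n\<close> terms has coefficients that are at most \<open>\<beta> n\<close> times an element
  of the unit ball, relative to the rescaled sequence. Thus partial sums converge with respect
  to the gauge of the rescaled hull, at the rate \<open>\<beta> n\<close>.
\<close>

lemma p_co_rescaled_tail:
  assumes q: "q > 1" and x: "range x \<subseteq> carrier X"
    and \<beta>: "\<And>k. 0 < \<beta> k" "antimono \<beta>"
    and c: "c \<in> conj_seq_ball q" and z: "z \<in> carrier X" and lim: "(\<lambda>m. nrm X (psum X c x m \<ominus> z)) \<longlonglongrightarrow> 0"
  shows "of_real (1 / \<beta> n) \<odot> (z \<ominus> psum X c x n) \<in> p_co q X (\<lambda>k. of_real (1 / \<beta> k) \<odot> x k)"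
proof -
  let ?x = "\<lambda>k. of_real (1 / \<beta> k) \<odot> x k" and ?a = "of_real (1 / \<beta> n) :: 'k"
  have xk: "x k \<in> carrier X" for k using x by auto
  have xr: "range ?x \<subseteq> carrier X" using xk by auto
  define d where "d k = (if k < n then 0 else c k * of_real (\<beta> k / \<beta> n))" for k
  have nd: "norm (d k) \<le> norm (c k)" for k
  proof (cases "k < n")
    case False
    then have "\<beta> k \<le> \<beta> n" using \<beta>(2) by (simp add: antimono_def)
    then have "\<bar>\<beta> k / \<beta> n\<bar> \<le> 1" using \<beta>(1)[of k] \<beta>(1)[of n] by simp
    then have "norm (c k) * \<bar>\<beta> k / \<beta> n\<bar> \<le> norm (c k)" by (intro mult_left_le) auto
    then show ?thesis using False by (simp only: d_def norm_mult norm_of_real if_False)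
  qed (simp add: d_def)
  have d: "d \<in> conj_seq_ball q"
  proof (rule conj_seq_ballI[OF q])
    fix m
    have "(\<Sum>k<m. norm (d k) powr (q / (q - 1))) \<le> (\<Sum>k<m. norm (c k) powr (q / (q - 1)))"
      using q nd by (intro sum_mono powr_mono2) auto
    also have "\<dots> \<le> 1" by (rule conj_seq_ballD[OF q c]) simp
    finally show "(\<Sum>k<m. norm (d k) powr (q / (q - 1))) \<le> 1" .
  qed
  have eq: "psum X d ?x m \<ominus> ?a \<odot> (z \<ominus> psum X c x n) = ?a \<odot> (psum X c x m \<ominus> z)" if nm: "n \<le> m" for m
  proof (rule vec_eqI)
    fix f assume f: "f \<in> dual_ball X"
    note fs = functional_simps[OF dual_ballD[OF f]]
    have "(\<Sum>k<m. d k * f (?x k)) = (\<Sum>k=n..<m. ?a * (c k * f (x k)))"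
    proof -
      have "(\<Sum>k<m. d k * f (?x k)) = (\<Sum>k=n..<m. d k * f (?x k))"
        by (intro sum.mono_neutral_right) (auto simp: d_def)
      also have "\<dots> = (\<Sum>k=n..<m. ?a * (c k * f (x k)))"
        using \<beta>(1) xk by (intro sum.cong refl) (simp add: d_def fs(2) less_imp_neq[THEN not_sym])
      finally show ?thesis .
    qed
    also have "\<dots> = ?a * ((\<Sum>k<m. c k * f (x k)) - (\<Sum>k<n. c k * f (x k)))"
      using nm by (simp only: sum_distrib_left[symmetric] lessThan_atLeast0 sum_diff_nat_ivl)
    finally have "f (psum X d ?x m) = ?a * (f (psum X c x m) - f (psum X c x n))"
      unfolding functional_psum[OF dual_ballD[OF f] xr] functional_psum[OF dual_ballD[OF f] x] .
    moreover have "psum X d ?x m \<in> carrier X" using xr by (rule psum_closed)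
    ultimately show "f (psum X d ?x m \<ominus> ?a \<odot> (z \<ominus> psum X c x n)) = f (?a \<odot> (psum X c x m \<ominus> z))"
      using z x by (simp add: fs psum_closed algebra_simps del: of_real_divide)
  qed (use z x xr in \<open>auto intro: psum_closed simp del: of_real_divide\<close>)
  have "(\<lambda>m. norm ?a * nrm X (psum X c x m \<ominus> z)) \<longlonglongrightarrow> norm ?a * 0"
    by (intro tendsto_mult tendsto_const lim)
  moreover have "eventually (\<lambda>m. norm ?a * nrm X (psum X c x m \<ominus> z) = nrm X (psum X d ?x m \<ominus> ?a \<odot> (z \<ominus> psum X c x n))) sequentially"
    unfolding eventually_sequentially
  proof (intro exI allI impI)
    fix m assume "n \<le> m"
    then show "norm ?a * nrm X (psum X c x m \<ominus> z) = nrm X (psum X d ?x m \<ominus> ?a \<odot> (z \<ominus> psum X c x n))"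
      unfolding eq[OF \<open>n \<le> m\<close>] using z x by (intro nrm_smult[symmetric]) auto
  qed
  ultimately have "(\<lambda>m. nrm X (psum X d ?x m \<ominus> ?a \<odot> (z \<ominus> psum X c x n))) \<longlonglongrightarrow> 0"
    by (simp only: mult_zero_right) (rule Lim_transform_eventually)
  moreover have "?a \<odot> (z \<ominus> psum X c x n) \<in> carrier X" using z x by auto
  ultimately show ?thesis unfolding p_co_altdef using d by blast
qed

text \<open>
  The test space for the hypothesis is the gauge space of the hull of the rescaled sequence,
  with the inclusion into \<open>X\<close> as test operator; its approximant is then composed with the given
  operator.
\<close>

lemma Kup_AP_larger_exponent:
  assumes X: "banach_space X" and p: "1 \<le> p" "p < q" and q: "q < 2" and AP: "Kup_AP TYPE('a) p X"
  shows "Kup_AP TYPE('b) q X"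
  unfolding Kup_AP_def
proof (intro allI impI ballI)
  fix Y :: "('k, 'b) nspace" and T and \<epsilon> :: ennreal
  assume Y: "banach_space Y" and T: "T \<in> Kup_ops q Y X" and \<epsilon>: "\<epsilon> > 0"
  have q1: "q > 1" "q \<ge> 1" using p by simp_all
  interpret Y: nvs Y using Y by (simp add: banach_space_def)
  obtain x where Tb: "T \<in> bounded_ops Y X" and x: "x \<in> lp_uncond q X" and Tx: "T ` unit_ball Y \<subseteq> p_co q X x"
    using T unfolding Kup_ops_def by blast
  have xr: "range x \<subseteq> carrier X" by (rule lp_uncondD(1)[OF q1(2) x])
  then have xk: "x k \<in> carrier X" for k by auto
  obtain \<beta> where \<beta>0: "\<And>k. 0 < \<beta> k" and \<beta>1: "\<And>k. \<beta> k \<le> 1" and \<beta>: "antimono \<beta>" "\<beta> \<longlonglongrightarrow> 0"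
    and x': "(\<lambda>k. of_real (1 / \<beta> k) \<odot> x k) \<in> lp_uncond q X"
    by (rule lp_uncond_rescale[OF q1(2) x]) (rule that, assumption+)
  define D where "D = p_co q X (\<lambda>k. of_real (1 / \<beta> k) \<odot> x k)"
  obtain M where "banach_disk X D M" using banach_disk_p_co[OF X q1(1) x'] unfolding D_def by blast
  then interpret D: banach_disk X D M .
  define Z where "Z = gauge_space X D"
  note Z_simps = D.gauge_space_simps[folded Z_def]
  have ZX: "\<And>z. z \<in> carrier Z \<Longrightarrow> z \<in> carrier X" using D.gauge_carrier_subset by (simp only: Z_def)
  interpret Z: nvs Z unfolding Z_def by (rule D.nvs_gauge_space)
  note tail = p_co_rescaled_tail[OF q1(1) xr \<beta>0 \<beta>(1), folded D_def]
  have incl: "(\<lambda>z. z) \<in> bounded_ops Z X"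
    unfolding bounded_ops_def using ZX D.nrm_le_gauge[folded Z_def] Z_simps(1,3) by auto
  obtain y where y: "y \<in> lp_uncond p X" "D \<subseteq> p_co p X y"
    using p_co_subset_smaller_exponent[OF X p q x'] unfolding D_def by blast
  have "(\<lambda>z. z) \<in> Kup_ops p Z X"
    unfolding Kup_ops_def using incl y D.unit_ball_gauge_space[folded Z_def] by auto
  moreover have "banach_space Z" unfolding Z_def by (rule D.banach_gauge_space)
  ultimately have "\<exists>F\<in>finite_rank_ops Z X. Kup_norm p Z X (\<lambda>z. z \<ominus> F z) < \<epsilon>"
    using \<epsilon> by (intro AP[unfolded Kup_AP_def, rule_format, of Z "\<lambda>z. z" \<epsilon>])
  then obtain F where F: "F \<in> finite_rank_ops Z X" and Fn: "Kup_norm p Z X (\<lambda>z. z \<ominus> F z) < \<epsilon>"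
    by blast
  obtain v where v: "v \<in> lp_uncond p X" "(\<lambda>z. z \<ominus> F z) ` unit_ball Z \<subseteq> p_co p X v" and vn: "wnorm p X v < \<epsilon>"
    using Fn unfolding Kup_norm_def INF_less_iff by blast
  obtain e where e: "wnorm p X v = ennreal e" "e \<ge> 0" using vn by (cases "wnorm p X v") auto
  have Fb: "F \<in> bounded_ops Z X" using F by (simp add: finite_rank_ops_def)
  note F_simps = bounded_opsD[OF Fb]
  have FX: "\<And>z. z \<in> carrier Z \<Longrightarrow> F z \<in> carrier X" by (rule F_simps(1))
  have DZ: "z \<in> carrier Z" if "z \<in> carrier X" "t > 0" "of_real (1 / t) \<odot> z \<in> D" for z t
    unfolding Z_def by (rule D.gauge_carrierI[OF that])
  \<comment> \<open>By homogeneity the bound for \<open>z - F z\<close> on \<open>D\<close> extends to \<open>Z\<close>; the factor \<open>t\<close> is what makes tails small below.\<close>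
  have small: "norm (f z - f (F z)) \<le> t * e"
    if f: "f \<in> dual_ball X" and z: "z \<in> carrier X" and t: "t > 0" "of_real (1 / t) \<odot> z \<in> D" for f z t
  proof -
    let ?s = "of_real (1 / t) \<odot> z"
    have zZ: "z \<in> carrier Z" by (rule DZ[OF z t])
    have Fs: "F ?s = of_real (1 / t) \<odot> F z" using F_simps(3)[OF zZ] by (simp only: Z_simps(3))
    have "?s \<ominus> F ?s \<in> p_co p X v" using v(2) t(2) D.unit_ball_gauge_space[folded Z_def] by blast
    then have "norm (f (?s \<ominus> F ?s)) \<le> e"
      using v(1) e f
      by (intro p_co_functional_le[OF p(1) lp_uncondD(1)[OF p(1) v(1)] _ f] wnormD[OF p(1)]) (auto simp: lp_uncond_def)
    moreover have "f (?s \<ominus> F ?s) = of_real (1 / t) * (f z - f (F z))"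
      unfolding Fs using z FX[OF zZ]
      by (simp add: functional_simps[OF dual_ballD[OF f]] right_diff_distrib del: of_real_divide)
    ultimately have "(1 / t) * norm (f z - f (F z)) \<le> e"
      using t(1) by (simp only: norm_mult norm_of_real) simp
    then show ?thesis using t(1) by (simp add: field_simps)
  qed
  have mem_D: "z \<in> D" if zx: "z \<in> p_co q X x" for z
  proof -
    obtain c where z: "z \<in> carrier X" and c: "c \<in> conj_seq_ball q" "(\<lambda>n. nrm X (psum X c x n \<ominus> z)) \<longlonglongrightarrow> 0"
      using zx unfolding p_co_altdef by blast
    have "psum X c x 0 = \<zero>" by (simp add: psum_def)
    then have "of_real (1 / \<beta> 0) \<odot> z \<in> D" using tail[OF c(1) z c(2), of 0] z by (simp add: minus_eq_sm)
    then have "of_real (1 / 1) \<odot> z \<in> D" using D.gauge_upward[OF _ \<beta>0 \<beta>1 z] by blast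
    then show ?thesis using z by simp
  qed
  have T_unit: "of_real (1 / nrm Y u) \<odot> T u \<in> D" if u: "u \<in> carrier Y" "nrm Y u > 0" for u
  proof -
    have "of_real (1 / nrm Y u) \<odot>\<^bsub>Y\<^esub> u \<in> unit_ball Y"
      using u by (simp add: unit_ball_def Y.nrm_smult norm_divide)
    then have "T (of_real (1 / nrm Y u) \<odot>\<^bsub>Y\<^esub> u) \<in> D" using Tx mem_D by blast
    then show ?thesis by (simp only: bounded_opsD(3)[OF Tb u(1)])
  qed
  have T_gauge: "T u \<in> carrier Z \<and> nrm Z (T u) \<le> 1 * nrm Y u" if u: "u \<in> carrier Y" for u
  proof (cases "nrm Y u = 0")
    case True
    then have "T u = \<zero>\<^bsub>Z\<^esub>"
      using u bounded_ops_zero[OF Y.nvs_axioms nvs_axioms Tb] Z_simps(2) by (simp add: Y.nrm_eq_0_iff)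
    then show ?thesis using True Z.nrm_zero by (simp del: Z_simps)
  next
    case False
    then have pos: "nrm Y u > 0" using Y.nrm_nonneg[OF u] by simp
    show ?thesis using D.gauge_le_iff[OF bounded_opsD(1)[OF Tb u] pos] T_unit[OF u pos]
      unfolding Z_def by (simp only: mult_1)
  qed
  have TZ: "T \<in> bounded_ops Y Z"
    unfolding bounded_ops_def Z_simps(1,3)
  proof (intro CollectI conjI)
    show "T \<in> carrier Y \<rightarrow> carrier Z" unfolding Pi_def using T_gauge by blast
    show "\<forall>u\<in>carrier Y. \<forall>v\<in>carrier Y. T (u \<oplus>\<^bsub>Y\<^esub> v) = T u \<oplus> T v"
      using bounded_opsD(2)[OF Tb] by blast
    show "\<forall>a. \<forall>u\<in>carrier Y. T (a \<odot>\<^bsub>Y\<^esub> u) = a \<odot> T u"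
      using bounded_opsD(3)[OF Tb] by blast
    show "\<exists>C. \<forall>u\<in>carrier Y. nrm Z (T u) \<le> C * nrm Y u" using T_gauge by blast
  qed
  have G: "(\<lambda>u. F (T u)) \<in> finite_rank_ops Y X"
    by (rule finite_rank_ops_comp[OF F TZ Z.nrm_nonneg])
  have xZ: "x k \<in> carrier Z" for k
  proof (rule DZ[OF xk \<beta>0[of k]])
    define a where "a i = (if i = k then 1 else 0 :: 'k)" for i
    have "(\<Sum>i<n. norm (a i) powr (q / (q - 1))) \<le> 1" for n
    proof -
      have "(\<Sum>i<n. norm (a i) powr (q / (q - 1))) = (\<Sum>i<n. if i = k then 1 else 0)"
        using q1 by (intro sum.cong) (auto simp: a_def)
      then show ?thesis by simp
    qed
    then have a: "a \<in> conj_seq_ball q" by (rule conj_seq_ballI[OF q1(1)])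
    have ps: "psum X a x n = (if k < n then x k else \<zero>)" for n
    proof (rule vec_eqI)
      fix f assume f: "f \<in> dual_ball X"
      have "(\<Sum>i<n. a i * f (x i)) = (\<Sum>i<n. if i = k then f (x k) else 0)"
        by (intro sum.cong) (auto simp: a_def)
      then show "f (psum X a x n) = f (if k < n then x k else \<zero>)"
        by (simp add: functional_psum[OF dual_ballD[OF f] xr] functional_simps(3)[OF dual_ballD[OF f]])
    qed (use xr xk in auto)
    have "(\<lambda>n. nrm X (psum X a x n \<ominus> x k)) \<longlonglongrightarrow> 0"
      by (rule tendsto_eventually) (auto simp: eventually_sequentially ps a_minus_def M.r_neg xk intro!: exI[of _ "Suc k"])
    from tail[OF a xk this, of k] show "of_real (1 / \<beta> k) \<odot> x k \<in> D"
      using xk by (simp add: ps minus_eq_sm)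
  qed
  have psum_Z: "psum X c x n = finsum Z (\<lambda>k. c k \<odot> x k) {..<n}" "psum X c x n \<in> carrier Z" for c n
  proof -
    have cx: "c k \<odot> x k \<in> carrier Z" for k using Z.sm_closed[OF xZ] by (simp only: Z_simps(3))
    show "psum X c x n = finsum Z (\<lambda>k. c k \<odot> x k) {..<n}"
      unfolding psum_def
      by (rule bounded_ops_finsum[OF Z.nvs_axioms nvs_axioms incl, symmetric]) (use cx in auto)
    then show "psum X c x n \<in> carrier Z" using cx Z.M.finsum_closed[of "\<lambda>k. c k \<odot> x k" "{..<n}"] by simp
  qed
  \<comment> \<open>Finite sums may be formed in \<open>X\<close> or in \<open>Z\<close>, so \<open>F\<close> commutes with partial sums.\<close>
  have fF_psum: "f (F (psum X c x n)) = (\<Sum>k<n. c k * f (F (x k)))" if f: "f \<in> dual_ball X" for f c n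
  proof -
    have cx: "c k \<odot> x k \<in> carrier Z" for k using Z.sm_closed[OF xZ] by (simp only: Z_simps(3))
    have "F (psum X c x n) = finsum X (\<lambda>k. F (c k \<odot> x k)) {..<n}"
      unfolding psum_Z(1) by (rule bounded_ops_finsum[OF Z.nvs_axioms nvs_axioms Fb]) (use cx in auto)
    also have "f \<dots> = (\<Sum>k<n. f (F (c k \<odot> x k)))"
      using FX[OF cx] by (intro functional_simps(5)[OF dual_ballD[OF f]]) auto
    also have "\<dots> = (\<Sum>k<n. c k * f (F (x k)))"
    proof (intro sum.cong refl)
      fix k
      have "F (c k \<odot> x k) = c k \<odot> F (x k)" using F_simps(3)[OF xZ, of "c k" k] by (simp only: Z_simps(3))
      then show "f (F (c k \<odot> x k)) = c k * f (F (x k))"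
        using FX[OF xZ] by (simp add: functional_simps(2)[OF dual_ballD[OF f]])
    qed
    finally show ?thesis .
  qed
  define w where "w k = x k \<ominus> F (x k)" for k
  have wX: "w k \<in> carrier X" for k unfolding w_def using xk FX[OF xZ] by auto
  then have wr: "range w \<subseteq> carrier X" by auto
  have fw: "f (w k) = f (x k) - f (F (x k))" if f: "f \<in> dual_ball X" for f k
    unfolding w_def using xk FX[OF xZ] by (simp add: functional_simps(4)[OF dual_ballD[OF f]])
  \<comment> \<open>Norming coefficients \<open>a\<close> on the section give \<open>f (s - F s)\<close> with \<open>s\<close> in \<open>\<beta> n D\<close>.\<close>
  have w_tail: "(\<Sum>k=n..<m. norm (f (w k)) powr q) \<le> (\<beta> n * e) powr q" if f: "f \<in> dual_ball X" for f n m
  proof -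
    let ?S = "\<Sum>k=n..<m. norm (f (w k)) powr q"
    have S0: "?S \<ge> 0" by (simp add: sum_nonneg)
    obtain a where a: "a \<in> conj_seq_ball q" "\<And>k. k \<notin> {n..<m} \<Longrightarrow> a k = 0"
      "(\<Sum>k=n..<m. a k * f (w k)) = of_real (?S powr (1 / q))"
      using ex_dual_coefficients[OF q1(1), of "{n..<m}" "\<lambda>k. f (w k)"] by auto
    let ?s = "psum X a x m"
    have sX: "?s \<in> carrier X" using xr by auto
    have const: "psum X a x i = ?s" if "i \<ge> m" for i
    proof (rule vec_eqI)
      fix f assume f: "f \<in> dual_ball X"
      show "f (psum X a x i) = f ?s"
        unfolding functional_psum[OF dual_ballD[OF f] xr]
        using a(2) that by (intro sum.mono_neutral_right) auto
    qed (use xr in auto)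
    have "nrm X (psum X a x i \<ominus> ?s) = 0" if "i \<ge> m" for i
      unfolding const[OF that] using sX by (simp add: a_minus_def M.r_neg)
    then have "eventually (\<lambda>i. nrm X (psum X a x i \<ominus> ?s) = 0) sequentially"
      unfolding eventually_sequentially by blast
    then have "(\<lambda>i. nrm X (psum X a x i \<ominus> ?s)) \<longlonglongrightarrow> 0" by (rule tendsto_eventually)
    note tail[OF a(1) sX this, of n]
    moreover have "psum X a x n = \<zero>"
    proof (rule vec_eqI)
      fix f assume f: "f \<in> dual_ball X"
      show "f (psum X a x n) = f \<zero>"
        unfolding functional_psum[OF dual_ballD[OF f] xr] functional_simps(3)[OF dual_ballD[OF f]]
        using a(2) by (intro sum.neutral) auto
    qed (use xr in auto)
    ultimately have "of_real (1 / \<beta> n) \<odot> ?s \<in> D" using sX by (simp add: minus_eq_sm)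
    then have "norm (f ?s - f (F ?s)) \<le> \<beta> n * e" by (rule small[OF f sX \<beta>0])
    also have "f ?s - f (F ?s) = (\<Sum>k<m. a k * f (w k))"
      unfolding functional_psum[OF dual_ballD[OF f] xr] fF_psum[OF f] fw[OF f]
      by (simp add: sum_subtractf right_diff_distrib)
    also have "\<dots> = (\<Sum>k=n..<m. a k * f (w k))"
      using a(2) by (intro sum.mono_neutral_right) auto
    finally have "?S powr (1 / q) \<le> \<beta> n * e" unfolding a(3) by simp
    then have "(?S powr (1 / q)) powr q \<le> (\<beta> n * e) powr q" using q1 by (intro powr_mono2) auto
    then show ?thesis using q1 S0 by (simp add: powr_powr)
  qed
  have w: "w \<in> lp_uncond q X"
  proof (rule lp_uncondI[OF q1(2) wr])
    fix \<delta> :: real assume \<delta>: "\<delta> > 0"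
    have "(\<lambda>n. (\<beta> n * e) powr q) \<longlonglongrightarrow> (0 * e) powr q"
      using q1 \<beta>0 e(2) by (intro tendsto_powr' tendsto_mult \<beta>(2) tendsto_const) (auto simp: less_imp_le)
    then have "eventually (\<lambda>n. (\<beta> n * e) powr q < \<delta>) sequentially"
      using \<delta> by (intro order_tendstoD(2)) auto
    then obtain N where N: "(\<beta> N * e) powr q < \<delta>" by (auto simp: eventually_sequentially)
    have "(\<Sum>k=N..<m. norm (f (w k)) powr q) \<le> \<delta>" if "f \<in> dual_ball X" for f m
      using w_tail[OF that, of N m] N by linarith
    then show "\<exists>N. \<forall>f\<in>dual_ball X. \<forall>m. (\<Sum>k=N..<m. norm (f (w k)) powr q) \<le> \<delta>" by blast
  qed
  have wn: "wnorm q X w \<le> ennreal e"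
  proof (rule wnorm_leI[OF q1(2) e(2)])
    fix f m assume f: "f \<in> dual_ball X"
    have "(\<Sum>k<m. norm (f (w k)) powr q) \<le> (\<beta> 0 * e) powr q"
      using w_tail[OF f, of 0 m] by (simp only: lessThan_atLeast0)
    also have "\<dots> \<le> e powr q"
      using q1 e(2) \<beta>0[of 0] \<beta>1[of 0] by (intro powr_mono2) (auto simp: mult_left_le_one_le)
    finally show "(\<Sum>k<m. norm (f (w k)) powr q) \<le> e powr q" .
  qed
  have image: "T u \<ominus> F (T u) \<in> p_co q X w" if u: "u \<in> unit_ball Y" for u
  proof -
    have "T u \<in> p_co q X x" using Tx u by blast
    then obtain c where TuX: "T u \<in> carrier X" and c: "c \<in> conj_seq_ball q" "(\<lambda>n. nrm X (psum X c x n \<ominus> T u)) \<longlonglongrightarrow> 0"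
      unfolding p_co_altdef by blast
    have TuZ: "T u \<in> carrier Z" using T_gauge u by (simp only: unit_ball_def mem_Collect_eq)
    have dX: "T u \<ominus> F (T u) \<in> carrier X" using TuX FX[OF TuZ] by auto
    have pw: "psum X c w n \<in> carrier X" for n using wr by (rule psum_closed)
    have le: "nrm X (psum X c w n \<ominus> (T u \<ominus> F (T u))) \<le> \<beta> n * e" for n
    proof (rule nrm_leI)
      fix f assume f: "f \<in> dual_ball X"
      note fs = functional_simps[OF dual_ballD[OF f]]
      let ?t = "T u \<ominus> psum X c x n"
      have tX: "?t \<in> carrier X" using TuX xr by auto
      have "?t = T u \<ominus>\<^bsub>Z\<^esub> psum X c x n"
        using D.gauge_minus[folded Z_def, OF TuZ psum_Z(2)] by (rule sym)
      then have Ft: "F ?t = F (T u) \<ominus> F (psum X c x n)"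
        using bounded_ops_minus[OF Z.nvs_axioms nvs_axioms Fb TuZ psum_Z(2)] by (simp only:)
      have "norm (f ?t - f (F ?t)) \<le> \<beta> n * e"
        by (rule small[OF f tX \<beta>0 tail[OF c(1) TuX c(2)]])
      moreover have "f (psum X c w n) = f (psum X c x n) - f (F (psum X c x n))"
        unfolding functional_psum[OF dual_ballD[OF f] xr] functional_psum[OF dual_ballD[OF f] wr] fF_psum[OF f] fw[OF f]
        by (simp add: sum_subtractf right_diff_distrib)
      then have "f (psum X c w n \<ominus> (T u \<ominus> F (T u))) = - (f ?t - f (F ?t))"
        unfolding Ft using pw TuX FX[OF TuZ] FX[OF psum_Z(2)] ZX[OF psum_Z(2)] dX by (simp add: fs)
      ultimately show "norm (f (psum X c w n \<ominus> (T u \<ominus> F (T u)))) \<le> \<beta> n * e"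
        by (simp only: norm_minus_cancel)
    qed (use pw dX in auto)
    have "(\<lambda>n. \<beta> n * e) \<longlonglongrightarrow> 0 * e" by (intro tendsto_mult \<beta>(2) tendsto_const)
    then have lim0: "(\<lambda>n. \<beta> n * e) \<longlonglongrightarrow> 0" by simp
    have nn: "0 \<le> nrm X (psum X c w n \<ominus> (T u \<ominus> F (T u)))" for n
      using pw dX by (intro nrm_nonneg) auto
    have "(\<lambda>n. nrm X (psum X c w n \<ominus> (T u \<ominus> F (T u)))) \<longlonglongrightarrow> 0"
      by (rule Lim_null_comparison[OF _ lim0], rule always_eventually) (simp only: real_norm_def abs_of_nonneg[OF nn] le simp_thms)
    then show ?thesis unfolding p_co_altdef using dX c(1) by blast
  qed
  have "Kup_norm q Y X (\<lambda>u. T u \<ominus> F (T u)) \<le> wnorm q X w"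
    unfolding Kup_norm_def using w image by (intro INF_lower) blast
  also have "\<dots> \<le> wnorm p X v" using wn e(1) by simp
  also have "\<dots> < \<epsilon>" by (rule vn)
  finally show "\<exists>F\<in>finite_rank_ops Y X. Kup_norm q Y X (\<lambda>y. T y \<ominus> F y) < \<epsilon>"
    by (intro bexI[OF _ G])
qed

end

theorem theorem3p1:
  fixes p q :: real
  assumes "1 \<le> p" and "p < q" and "q < 2"
  shows "(\<forall>X :: (real, 'a) nspace. banach_space X \<longrightarrow>
            Kup_AP TYPE('a) p X \<longrightarrow> Kup_AP TYPE('b) q X) \<and>
         (\<forall>X :: (complex, 'a) nspace. banach_space X \<longrightarrow>
            Kup_AP TYPE('a) p X \<longrightarrow> Kup_AP TYPE('b) q X)"
proof (intro conjI allI impI)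
  fix X :: "(real, 'a) nspace" assume X: "banach_space X" and AP: "Kup_AP TYPE('a) p X"
  then have "nvs X" by (simp add: banach_space_def)
  then interpret norming_space X
    by (intro norming_space.intro norming_space_axioms.intro norming_real)
  show "Kup_AP TYPE('b) q X" by (rule Kup_AP_larger_exponent[OF X assms AP])
next
  fix X :: "(complex, 'a) nspace" assume X: "banach_space X" and AP: "Kup_AP TYPE('a) p X"
  then have "nvs X" by (simp add: banach_space_def)
  then interpret norming_space X
    by (intro norming_space.intro norming_space_axioms.intro norming_complex)
  show "Kup_AP TYPE('b) q X" by (rule Kup_AP_larger_exponent[OF X assms AP])
qed

end
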